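(* Let $k$ be a domain and let $X$ be a $k$-scheme locally of finite type. Then the strong $k$-congruence space $\mathrm{SCong}_kX$ is a sober space, i.e. every irreducible closed subset of it has a unique generic point.
   Context: All monoids are commutative. A pointed monoid is a multiplicative monoid $A$ with unit $1$ and absorbing element $0$; morphisms preserve products, $0$ and $1$. A domain is a pointed monoid isomorphic to a pointed submonoid of the multiplicative monoid $K^\bullet$ of some field $K$. A $k$-algebra is a pointed monoid $A$ with a morphism $k\to A$; it is finitely generated if there are $a_1,\dots,a_n\in A$ such that every element of $A$ has the form $\lambda a_1^{m_1}\cdots a_n^{m_n}$ with $\lambda\in k$, $m_i\in\mathbb{N}$. A congruence on $A$ is an equivalence relation $\mathfrak{c}\subseteq A\times A$ such that $(a,b)\in\mathfrak{c}$ implies $(\lambda a,\lambda b)\in\mathfrak{c}$ for all $\lambda\in A$. A $k$-congruence on a $k$-algebra $A$ is a congruence $\mathfrak{c}$ such that $A/\mathfrak{c}$ is a domain and $k\to A/\mathfrak{c}$ is injective. $\mathrm{SCong}_kA$ is the set of $k$-congruences with the topology generated by the sets $\{\mathfrak{c}:(a,b)\notin\mathfrak{c}\}$, $a,b\in A$. An ideal of $A$ is a subset $I\ni0$ with $AI\subseteq I$; it is prime if it is proper and $ab\in I$ implies $a\in I$ or $b\in I$. $\mathrm{MSpec}\,A$ is the set of prime ideals with basis of opens $U_h=\{P:h\notin P\}$ and sheaf of pointed monoids with $\Gamma(U_h)=A[h^{-1}]$. A monoid scheme is a topological space with a sheaf of pointed monoids, locally isomorphic to $\mathrm{MSpec}\,A$'s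 (morphisms are local on stalks). A $k$-scheme is a monoid scheme with a morphism to $\mathrm{MSpec}\,k$. $\mathrm{SCong}_kX=\mathrm{colim}_U\,\mathrm{SCong}_k\Gamma U$ over affine opens $U\subseteq X$ with inclusions (transition maps: pullback of congruences). A morphism of monoid schemes $\varphi:X\to Y$ is locally of finite type if every $x\in X$ has an affine open neighborhood $U$ and $\varphi(x)$ has an affine open neighborhood $V$ containing $\varphi(U)$ such that $\Gamma U$ is a finitely generated $\Gamma V$-algebra. A $k$-scheme $X$ is locally of finite type if $X\to\mathrm{MSpec}\,k$ is. *)

theory Defs
  imports "HOL-Analysis.Sum_Topology" "HOL-Algebra.Subrings" "HOL-Algebra.Weak_Morphisms"
begin

section \<open>Pointed monoids\<close>

record 'a pmonoid = "'a monoid" + pzero :: 'a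

locale pointed_monoid = comm_monoid A for A :: "'a pmonoid" (structure) +
  assumes pzero_closed [simp]: "pzero A \<in> carrier A"
    and pzero_absorb [simp]: "a \<in> carrier A \<Longrightarrow> pzero A \<otimes> a = pzero A"

definition pm_hom :: "'a pmonoid \<Rightarrow> 'b pmonoid \<Rightarrow> ('a \<Rightarrow> 'b) set" where
  "pm_hom A B = {f \<in> hom A B. f \<one>\<^bsub>A\<^esub> = \<one>\<^bsub>B\<^esub> \<and> f (pzero A) = pzero B}"

definition pm_iso :: "'a pmonoid \<Rightarrow> 'b pmonoid \<Rightarrow> ('a \<Rightarrow> 'b) set" where
  "pm_iso A B = {f \<in> pm_hom A B. bij_betw f (carrier A) (carrier B)}"

definition local_hom :: "'a pmonoid \<Rightarrow> 'b pmonoid \<Rightarrow> ('a \<Rightarrow> 'b) \<Rightarrow> bool" where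
  "local_hom A B f \<longleftrightarrow>
     f \<in> pm_hom A B \<and> (\<forall>a \<in> carrier A - Units A. f a \<in> carrier B - Units B)"

definition pm_submonoid :: "'a set \<Rightarrow> 'a pmonoid \<Rightarrow> bool" where
  "pm_submonoid S A \<longleftrightarrow> submonoid S A \<and> pzero A \<in> S"

text \<open>The multiplicative pointed monoid of a ring.\<close>

definition mult_pm :: "'a ring \<Rightarrow> 'a pmonoid" where
  "mult_pm K = \<lparr>carrier = carrier K, mult = mult K, one = \<one>\<^bsub>K\<^esub>, pzero = \<zero>\<^bsub>K\<^esub>\<rparr>"

text \<open>
  HOL cannot quantify over the type of the elements of the field. Fixing that type to be
  \<^typ>\<open>'a list list\<close> loses no generality: if a pointed monoid embeds into a field of whatever
  type, then the elements of the subfield generated by its image are of the form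
  \<open>(\<Sum>ps - \<Sum>ns) / (\<Sum>qs - \<Sum>ms)\<close> and so are coded by four lists. See \<open>pm_domainI\<close> below.
\<close>

definition pm_domain :: "'a pmonoid \<Rightarrow> bool" where
  "pm_domain A \<longleftrightarrow> pointed_monoid A \<and>
     (\<exists>(K :: 'a list list ring) S f. field K \<and> pm_submonoid S (mult_pm K) \<and>
        f \<in> pm_iso A ((mult_pm K)\<lparr>carrier := S\<rparr>))"


section \<open>Algebras and congruences\<close>

definition pm_algebra :: "'k pmonoid \<Rightarrow> 'a pmonoid \<Rightarrow> ('k \<Rightarrow> 'a) \<Rightarrow> bool" where
  "pm_algebra k A \<phi> \<longleftrightarrow> pointed_monoid k \<and> pointed_monoid A \<and> \<phi> \<in> pm_hom k A"

definition fin_gen_algebra :: "'k pmonoid \<Rightarrow> 'a pmonoid \<Rightarrow> ('k \<Rightarrow> 'a) \<Rightarrow> bool" where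
  "fin_gen_algebra k A \<phi> \<longleftrightarrow> pm_algebra k A \<phi> \<and>
     (\<exists>(n :: nat) a. a \<in> {..<n} \<rightarrow> carrier A \<and>
        (\<forall>x \<in> carrier A. \<exists>l \<in> carrier k. \<exists>m :: nat \<Rightarrow> nat.
           x = \<phi> l \<otimes>\<^bsub>A\<^esub> (\<Otimes>\<^bsub>A\<^esub>i \<in> {..<n}. a i [^]\<^bsub>A\<^esub> m i)))"

definition congruence :: "'a pmonoid \<Rightarrow> ('a \<times> 'a) set \<Rightarrow> bool" where
  "congruence A c \<longleftrightarrow> equiv (carrier A) c \<and>
     (\<forall>(a, b) \<in> c. \<forall>l \<in> carrier A. (l \<otimes>\<^bsub>A\<^esub> a, l \<otimes>\<^bsub>A\<^esub> b) \<in> c)"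

definition quot_pm :: "'a pmonoid \<Rightarrow> ('a \<times> 'a) set \<Rightarrow> 'a set pmonoid" where
  "quot_pm A c =
     \<lparr>carrier = carrier A // c,
      mult = (\<lambda>x y. \<Union>a \<in> x. \<Union>b \<in> y. c `` {a \<otimes>\<^bsub>A\<^esub> b}),
      one = c `` {\<one>\<^bsub>A\<^esub>},
      pzero = c `` {pzero A}\<rparr>"

definition k_congruence :: "'k pmonoid \<Rightarrow> 'a pmonoid \<Rightarrow> ('k \<Rightarrow> 'a) \<Rightarrow> ('a \<times> 'a) set \<Rightarrow> bool" where
  "k_congruence k A \<phi> c \<longleftrightarrow>
     congruence A c \<and> pm_domain (quot_pm A c) \<and> inj_on (\<lambda>l. c `` {\<phi> l}) (carrier k)"

text \<open>The set of all \<open>k\<close>-congruences is itself put into the subbase, so that it is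
  the topspace regardless of whether the other subbasic sets cover it.\<close>

definition scong :: "'k pmonoid \<Rightarrow> 'a pmonoid \<Rightarrow> ('k \<Rightarrow> 'a) \<Rightarrow> ('a \<times> 'a) set topology" where
  "scong k A \<phi> = topology_generated_by
     (insert {c. k_congruence k A \<phi> c}
        {{c. k_congruence k A \<phi> c \<and> (a, b) \<notin> c} | a b. a \<in> carrier A \<and> b \<in> carrier A})"


section \<open>Localizations\<close>

definition loc_rel :: "'a pmonoid \<Rightarrow> 'a set \<Rightarrow> (('a \<times> 'a) \<times> ('a \<times> 'a)) set" where
  "loc_rel A S = {((a, s), (b, t)). a \<in> carrier A \<and> s \<in> S \<and> b \<in> carrier A \<and> t \<in> S \<and>
     (\<exists>u \<in> S. u \<otimes>\<^bsub>A\<^esub> (t \<otimes>\<^bsub>A\<^esub> a) = u \<otimes>\<^bsub>A\<^esub> (s \<otimes>\<^bsub>A\<^esub> b))}"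

definition fraction :: "'a pmonoid \<Rightarrow> 'a set \<Rightarrow> 'a \<Rightarrow> 'a \<Rightarrow> ('a \<times> 'a) set" where
  "fraction A S a s = loc_rel A S `` {(a, s)}"

definition localization :: "'a pmonoid \<Rightarrow> 'a set \<Rightarrow> ('a \<times> 'a) set pmonoid" where
  "localization A S =
     \<lparr>carrier = (carrier A \<times> S) // loc_rel A S,
      mult = (\<lambda>x y. \<Union>(a, s) \<in> x. \<Union>(b, t) \<in> y. fraction A S (a \<otimes>\<^bsub>A\<^esub> b) (s \<otimes>\<^bsub>A\<^esub> t)),
      one = fraction A S \<one>\<^bsub>A\<^esub> \<one>\<^bsub>A\<^esub>,
      pzero = fraction A S (pzero A) \<one>\<^bsub>A\<^esub>\<rparr>"

definition powers :: "'a pmonoid \<Rightarrow> 'a \<Rightarrow> 'a set" where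
  "powers A h = {h [^]\<^bsub>A\<^esub> n | n :: nat. True}"


section \<open>Spaces with a sheaf of pointed monoids\<close>

record ('x, 's) mspace =
  mtop :: "'x topology"
  msec :: "'x set \<Rightarrow> 's pmonoid"
  mres :: "'x set \<Rightarrow> 'x set \<Rightarrow> 's \<Rightarrow> 's"  \<comment> \<open>\<open>mres X U V\<close> restricts from \<open>U\<close> to \<open>V\<close>\<close>

definition presheaf :: "('x, 's) mspace \<Rightarrow> bool" where
  "presheaf X \<longleftrightarrow>
     (\<forall>U. openin (mtop X) U \<longrightarrow> pointed_monoid (msec X U)) \<and>
     (\<forall>U V. openin (mtop X) U \<and> openin (mtop X) V \<and> V \<subseteq> U \<longrightarrow>
        mres X U V \<in> pm_hom (msec X U) (msec X V)) \<and>
     (\<forall>U. openin (mtop X) U \<longrightarrow> (\<forall>s \<in> carrier (msec X U). mres X U U s = s)) \<and>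
     (\<forall>U V W. openin (mtop X) U \<and> openin (mtop X) V \<and> openin (mtop X) W \<and> V \<subseteq> U \<and> W \<subseteq> V \<longrightarrow>
        (\<forall>s \<in> carrier (msec X U). mres X V W (mres X U V s) = mres X U W s))"

definition sheaf :: "('x, 's) mspace \<Rightarrow> bool" where
  "sheaf X \<longleftrightarrow> presheaf X \<and>
     (\<forall>\<C>. (\<forall>V \<in> \<C>. openin (mtop X) V) \<longrightarrow>
        (\<forall>s \<in> carrier (msec X (\<Union>\<C>)). \<forall>t \<in> carrier (msec X (\<Union>\<C>)).
           (\<forall>V \<in> \<C>. mres X (\<Union>\<C>) V s = mres X (\<Union>\<C>) V t) \<longrightarrow> s = t) \<and>
        (\<forall>s. (\<forall>V \<in> \<C>. s V \<in> carrier (msec X V)) \<and>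
             (\<forall>V \<in> \<C>. \<forall>W \<in> \<C>. mres X V (V \<inter> W) (s V) = mres X W (V \<inter> W) (s W)) \<longrightarrow>
           (\<exists>t \<in> carrier (msec X (\<Union>\<C>)). \<forall>V \<in> \<C>. mres X (\<Union>\<C>) V t = s V)))"

definition germ_rel :: "('x, 's) mspace \<Rightarrow> 'x \<Rightarrow> (('x set \<times> 's) \<times> ('x set \<times> 's)) set" where
  "germ_rel X x = {((U, s), (V, t)).
     openin (mtop X) U \<and> x \<in> U \<and> s \<in> carrier (msec X U) \<and>
     openin (mtop X) V \<and> x \<in> V \<and> t \<in> carrier (msec X V) \<and>
     (\<exists>W. openin (mtop X) W \<and> x \<in> W \<and> W \<subseteq> U \<inter> V \<and> mres X U W s = mres X V W t)}"

definition germ :: "('x, 's) mspace \<Rightarrow> 'x \<Rightarrow> 'x set \<Rightarrow> 's \<Rightarrow> ('x set \<times> 's) set" where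
  "germ X x U s = germ_rel X x `` {(U, s)}"

definition stalk :: "('x, 's) mspace \<Rightarrow> 'x \<Rightarrow> ('x set \<times> 's) set pmonoid" where
  "stalk X x =
     \<lparr>carrier = {germ X x U s | U s. openin (mtop X) U \<and> x \<in> U \<and> s \<in> carrier (msec X U)},
      mult = (\<lambda>p q. \<Union>(U, s) \<in> p. \<Union>(V, t) \<in> q.
        germ X x (U \<inter> V) (mres X U (U \<inter> V) s \<otimes>\<^bsub>msec X (U \<inter> V)\<^esub> mres X V (U \<inter> V) t)),
      one = germ X x (topspace (mtop X)) \<one>\<^bsub>msec X (topspace (mtop X))\<^esub>,
      pzero = germ X x (topspace (mtop X)) (pzero (msec X (topspace (mtop X))))\<rparr>"

definition preim :: "('x, 's) mspace \<Rightarrow> ('x \<Rightarrow> 'y) \<Rightarrow> 'y set \<Rightarrow> 'x set" where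
  "preim X f V = {x \<in> topspace (mtop X). f x \<in> V}"

text \<open>A morphism \<open>X \<rightarrow> Y\<close> consists of a map \<open>f\<close> of the spaces and of the homomorphisms
  \<open>\<phi> V\<close> from the sections of \<open>Y\<close> over \<open>V\<close> to the sections of \<open>X\<close> over the preimage of \<open>V\<close>.\<close>

definition stalk_map :: "('x, 's) mspace \<Rightarrow> ('x \<Rightarrow> 'y) \<Rightarrow> ('y set \<Rightarrow> 't \<Rightarrow> 's) \<Rightarrow> 'x \<Rightarrow>
    ('y set \<times> 't) set \<Rightarrow> ('x set \<times> 's) set" where
  "stalk_map X f \<phi> x p = (\<Union>(V, t) \<in> p. germ X x (preim X f V) (\<phi> V t))"

definition mspace_morphism :: "('x, 's) mspace \<Rightarrow> ('y, 't) mspace \<Rightarrow>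
    ('x \<Rightarrow> 'y) \<Rightarrow> ('y set \<Rightarrow> 't \<Rightarrow> 's) \<Rightarrow> bool" where
  "mspace_morphism X Y f \<phi> \<longleftrightarrow>
     continuous_map (mtop X) (mtop Y) f \<and>
     (\<forall>V. openin (mtop Y) V \<longrightarrow> \<phi> V \<in> pm_hom (msec Y V) (msec X (preim X f V))) \<and>
     (\<forall>V W. openin (mtop Y) V \<and> openin (mtop Y) W \<and> W \<subseteq> V \<longrightarrow>
        (\<forall>t \<in> carrier (msec Y V).
           \<phi> W (mres Y V W t) = mres X (preim X f V) (preim X f W) (\<phi> V t))) \<and>
     (\<forall>x \<in> topspace (mtop X). local_hom (stalk Y (f x)) (stalk X x) (stalk_map X f \<phi> x))"

definition mspace_isomorphic :: "('x, 's) mspace \<Rightarrow> ('y, 't) mspace \<Rightarrow> bool" where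
  "mspace_isomorphic X Y \<longleftrightarrow>
     (\<exists>f \<phi>. mspace_morphism X Y f \<phi> \<and> homeomorphic_map (mtop X) (mtop Y) f \<and>
        (\<forall>V. openin (mtop Y) V \<longrightarrow> \<phi> V \<in> pm_iso (msec Y V) (msec X (preim X f V))))"

definition open_subspace :: "('x, 's) mspace \<Rightarrow> 'x set \<Rightarrow> ('x, 's) mspace" where
  "open_subspace X U = X\<lparr>mtop := subtopology (mtop X) U\<rparr>"


section \<open>Spectra and monoid schemes\<close>

definition pm_ideal :: "'a pmonoid \<Rightarrow> 'a set \<Rightarrow> bool" where
  "pm_ideal A I \<longleftrightarrow> I \<subseteq> carrier A \<and> pzero A \<in> I \<and> (\<forall>a \<in> carrier A. \<forall>x \<in> I. a \<otimes>\<^bsub>A\<^esub> x \<in> I)"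

definition pm_prime :: "'a pmonoid \<Rightarrow> 'a set \<Rightarrow> bool" where
  "pm_prime A P \<longleftrightarrow> pm_ideal A P \<and> P \<noteq> carrier A \<and>
     (\<forall>a \<in> carrier A. \<forall>b \<in> carrier A. a \<otimes>\<^bsub>A\<^esub> b \<in> P \<longrightarrow> a \<in> P \<or> b \<in> P)"

definition basic_open :: "'a pmonoid \<Rightarrow> 'a \<Rightarrow> 'a set set" where
  "basic_open A h = {P. pm_prime A P \<and> h \<notin> P}"

definition mspec_top :: "'a pmonoid \<Rightarrow> 'a set topology" where
  "mspec_top A = topology_generated_by {basic_open A h | h. h \<in> carrier A}"

text \<open>Sections over \<open>U\<close> are the families of elements of the localizations at the primes in \<open>U\<close>
  that are locally given by one fraction. That this is the sheaf whose sections over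
  \<open>basic_open A h\<close> are the localization of \<open>A\<close> at \<open>h\<close> is shown in \<open>mspec_sec_basic_open\<close> below.\<close>

definition mspec_sec_carrier :: "'a pmonoid \<Rightarrow> 'a set set \<Rightarrow> ('a set \<Rightarrow> ('a \<times> 'a) set) set" where
  "mspec_sec_carrier A U =
     {s \<in> \<Pi>\<^sub>E P \<in> U. carrier (localization A (carrier A - P)).
        \<forall>P \<in> U. \<exists>V a g. openin (mspec_top A) V \<and> P \<in> V \<and> V \<subseteq> U \<and> a \<in> carrier A \<and> g \<in> carrier A \<and>
          (\<forall>Q \<in> V. g \<notin> Q \<and> s Q = fraction A (carrier A - Q) a g)}"

definition mspec_sec :: "'a pmonoid \<Rightarrow> 'a set set \<Rightarrow> ('a set \<Rightarrow> ('a \<times> 'a) set) pmonoid" where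
  "mspec_sec A U =
     \<lparr>carrier = mspec_sec_carrier A U,
      mult = (\<lambda>s t. \<lambda>P \<in> U. s P \<otimes>\<^bsub>localization A (carrier A - P)\<^esub> t P),
      one = (\<lambda>P \<in> U. \<one>\<^bsub>localization A (carrier A - P)\<^esub>),
      pzero = (\<lambda>P \<in> U. pzero (localization A (carrier A - P)))\<rparr>"

definition mspec :: "'a pmonoid \<Rightarrow> ('a set, 'a set \<Rightarrow> ('a \<times> 'a) set) mspace" where
  "mspec A = \<lparr>mtop = mspec_top A, msec = mspec_sec A, mres = (\<lambda>U V s. restrict s V)\<rparr>"

text \<open>As \<open>A\<close> is isomorphic to the global sections of its spectrum, a pointed monoid whose spectrum
  is isomorphic to \<open>U\<close> can always be taken over the type of the sections of \<open>X\<close>.\<close>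

definition affine_open :: "('x, 's) mspace \<Rightarrow> 'x set \<Rightarrow> bool" where
  "affine_open X U \<longleftrightarrow> openin (mtop X) U \<and>
     (\<exists>A :: 's pmonoid. pointed_monoid A \<and> mspace_isomorphic (open_subspace X U) (mspec A))"

definition monoid_scheme :: "('x, 's) mspace \<Rightarrow> bool" where
  "monoid_scheme X \<longleftrightarrow> sheaf X \<and> (\<forall>x \<in> topspace (mtop X). \<exists>U. affine_open X U \<and> x \<in> U)"

definition k_scheme :: "'k pmonoid \<Rightarrow> ('x, 's) mspace \<Rightarrow> ('x \<Rightarrow> 'k set) \<Rightarrow>
    ('k set set \<Rightarrow> ('k set \<Rightarrow> ('k \<times> 'k) set) \<Rightarrow> 's) \<Rightarrow> bool" where
  "k_scheme k X f \<phi> \<longleftrightarrow> monoid_scheme X \<and> mspace_morphism X (mspec k) f \<phi>"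

definition locally_of_finite_type :: "('x, 's) mspace \<Rightarrow> ('y, 't) mspace \<Rightarrow>
    ('x \<Rightarrow> 'y) \<Rightarrow> ('y set \<Rightarrow> 't \<Rightarrow> 's) \<Rightarrow> bool" where
  "locally_of_finite_type X Y f \<phi> \<longleftrightarrow>
     (\<forall>x \<in> topspace (mtop X). \<exists>U V.
        affine_open X U \<and> x \<in> U \<and> affine_open Y V \<and> f x \<in> V \<and> f ` U \<subseteq> V \<and>
        fin_gen_algebra (msec Y V) (msec X U) (\<lambda>t. mres X (preim X f V) U (\<phi> V t)))"


section \<open>The strong congruence space of a scheme\<close>

text \<open>The structure map of the \<open>k\<close>-algebra of sections over \<open>U\<close>, namely the composite
  \<open>k \<rightarrow> \<Gamma>(MSpec k) \<rightarrow> \<Gamma> X \<rightarrow> \<Gamma> U\<close>.\<close>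

definition structure_map :: "'k pmonoid \<Rightarrow> ('x, 's) mspace \<Rightarrow>
    ('k set set \<Rightarrow> ('k set \<Rightarrow> ('k \<times> 'k) set) \<Rightarrow> 's) \<Rightarrow> 'x set \<Rightarrow> 'k \<Rightarrow> 's" where
  "structure_map k X \<phi> U l =
     mres X (topspace (mtop X)) U
       (\<phi> (topspace (mspec_top k))
          (\<lambda>P \<in> topspace (mspec_top k). fraction k (carrier k - P) l \<one>\<^bsub>k\<^esub>))"

definition pullback :: "'a pmonoid \<Rightarrow> ('a \<Rightarrow> 'b) \<Rightarrow> ('b \<times> 'b) set \<Rightarrow> ('a \<times> 'a) set" where
  "pullback A r c = {(a, b). a \<in> carrier A \<and> b \<in> carrier A \<and> (r a, r b) \<in> c}"

definition quotient_topology :: "'a topology \<Rightarrow> ('a \<Rightarrow> 'b) \<Rightarrow> 'b topology" where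
  "quotient_topology T q =
     topology (\<lambda>W. W \<subseteq> q ` topspace T \<and> openin T {x \<in> topspace T. q x \<in> W})"

definition scong_sum :: "'k pmonoid \<Rightarrow> ('x, 's) mspace \<Rightarrow>
    ('k set set \<Rightarrow> ('k set \<Rightarrow> ('k \<times> 'k) set) \<Rightarrow> 's) \<Rightarrow> ('x set \<times> ('s \<times> 's) set) topology" where
  "scong_sum k X \<phi> =
     sum_topology (\<lambda>U. scong k (msec X U) (structure_map k X \<phi> U)) {U. affine_open X U}"

definition scong_glue :: "'k pmonoid \<Rightarrow> ('x, 's) mspace \<Rightarrow>
    ('k set set \<Rightarrow> ('k set \<Rightarrow> ('k \<times> 'k) set) \<Rightarrow> 's) \<Rightarrow>
    (('x set \<times> ('s \<times> 's) set) \<times> ('x set \<times> ('s \<times> 's) set)) set" where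
  "scong_glue k X \<phi> =
     {((U, c), (V, pullback (msec X V) (mres X V U) c)) | U V c.
        affine_open X U \<and> affine_open X V \<and> U \<subseteq> V \<and>
        k_congruence k (msec X U) (structure_map k X \<phi> U) c}"

text \<open>The colimit in topological spaces is the quotient of the disjoint union by the equivalence
  relation generated by the transition maps.\<close>

definition scong_scheme :: "'k pmonoid \<Rightarrow> ('x, 's) mspace \<Rightarrow>
    ('k set set \<Rightarrow> ('k set \<Rightarrow> ('k \<times> 'k) set) \<Rightarrow> 's) \<Rightarrow>
    ('x set \<times> ('s \<times> 's) set) set topology" where
  "scong_scheme k X \<phi> = quotient_topology (scong_sum k X \<phi>)
     (\<lambda>p. (scong_glue k X \<phi> \<union> (scong_glue k X \<phi>)\<inverse>)\<^sup>* `` {p})"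


section \<open>Sober spaces\<close>

definition irreducible_closed :: "'a topology \<Rightarrow> 'a set \<Rightarrow> bool" where
  "irreducible_closed T Z \<longleftrightarrow> closedin T Z \<and> Z \<noteq> {} \<and>
     (\<forall>C D. closedin T C \<and> closedin T D \<and> Z = C \<union> D \<longrightarrow> Z = C \<or> Z = D)"

definition sober_space :: "'a topology \<Rightarrow> bool" where
  "sober_space T \<longleftrightarrow>
     (\<forall>Z. irreducible_closed T Z \<longrightarrow> (\<exists>!x. x \<in> topspace T \<and> T closure_of {x} = Z))"


section \<open>Facts justifying the encodings\<close>

lemma openin_quotient_topology:
  "openin (quotient_topology T q) W \<longleftrightarrow>
     W \<subseteq> q ` topspace T \<and> openin T {x \<in> topspace T. q x \<in> W}"
proof -
  have "istopology (\<lambda>W. W \<subseteq> q ` topspace T \<and> openin T {x \<in> topspace T. q x \<in> W})"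
    unfolding istopology_def
  proof (intro conjI allI impI)
    fix S S' assume S: "S \<subseteq> q ` topspace T \<and> openin T {x \<in> topspace T. q x \<in> S}"
      "S' \<subseteq> q ` topspace T \<and> openin T {x \<in> topspace T. q x \<in> S'}"
    then show "S \<inter> S' \<subseteq> q ` topspace T" by blast
    have "{x \<in> topspace T. q x \<in> S \<inter> S'} = {x \<in> topspace T. q x \<in> S} \<inter> {x \<in> topspace T. q x \<in> S'}"
      by blast
    then show "openin T {x \<in> topspace T. q x \<in> S \<inter> S'}" using S by auto
  next
    fix \<K> assume K: "\<forall>K \<in> \<K>. K \<subseteq> q ` topspace T \<and> openin T {x \<in> topspace T. q x \<in> K}"
    then show "\<Union>\<K> \<subseteq> q ` topspace T" by blast
    have "{x \<in> topspace T. q x \<in> \<Union>\<K>} = (\<Union>K \<in> \<K>. {x \<in> topspace T. q x \<in> K})" by blast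
    then show "openin T {x \<in> topspace T. q x \<in> \<Union>\<K>}" using K by auto
  qed
  then show ?thesis by (simp add: quotient_topology_def)
qed

lemma quotient_map_quotient_topology: "quotient_map T (quotient_topology T q) q"
proof -
  have "topspace (quotient_topology T q) = q ` topspace T"
  proof
    show "topspace (quotient_topology T q) \<subseteq> q ` topspace T"
      using openin_topspace[of "quotient_topology T q"] by (simp only: openin_quotient_topology)
    have "{x \<in> topspace T. q x \<in> q ` topspace T} = topspace T" by blast
    then have "openin (quotient_topology T q) (q ` topspace T)"
      by (simp add: openin_quotient_topology)
    then show "q ` topspace T \<subseteq> topspace (quotient_topology T q)" by (rule openin_subset)
  qed
  then show ?thesis by (simp add: quotient_map_def openin_quotient_topology)
qed

lemma topspace_scong: "topspace (scong k A \<phi>) = {c. k_congruence k A \<phi> c}"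
  unfolding scong_def topology_generated_by_topspace by blast

lemma (in field) fractions_subfield:
  assumes R: "subring S R"
  shows "subfield {a \<otimes> inv b | a b. a \<in> S \<and> b \<in> S - {\<zero>}} R" (is "subfield ?F R")
proof (rule subfieldI')
  have SR: "\<And>x. x \<in> S \<Longrightarrow> x \<in> carrier R" using subringE(1)[OF R] by auto
  have I: "inv b \<in> carrier R" "b \<otimes> inv b = \<one>" if "b \<in> S - {\<zero>}" for b
    using that SR field_Units by auto
  have IM: "inv (b \<otimes> d) = inv b \<otimes> inv d" if "b \<in> S - {\<zero>}" "d \<in> S - {\<zero>}" for b d
  proof (rule comm_inv_char)
    show "b \<otimes> d \<otimes> (inv b \<otimes> inv d) = \<one>"
    proof -
      have "b \<otimes> d \<otimes> (inv b \<otimes> inv d) = (b \<otimes> inv b) \<otimes> (d \<otimes> inv d)"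
        using I(1) that SR by (simp add: m_ac)
      then show ?thesis using I that by simp
    qed
  qed (use I that SR in auto)
  have NZ: "b \<otimes> d \<in> S - {\<zero>}" if "b \<in> S - {\<zero>}" "d \<in> S - {\<zero>}" for b d
    using that subringE(6)[OF R, of b d] SR integral[of b d] by auto
  have one: "\<one> \<in> S - {\<zero>}" using subringE(3)[OF R] by auto
  have F: "x \<in> ?F" if "x = a \<otimes> inv b" "a \<in> S" "b \<in> S - {\<zero>}" for x a b
    using that by blast
  show "subring ?F R"
  proof (rule subringI)
    show "?F \<subseteq> carrier R" using SR I by auto
    have "\<one> = \<one> \<otimes> inv \<one>" by simp
    then show "\<one> \<in> ?F" using one by blast
    show "\<ominus> h \<in> ?F" if hF: "h \<in> ?F" for h
    proof -
      obtain a b where h: "h = a \<otimes> inv b" "a \<in> S" "b \<in> S - {\<zero>}" using hF by blast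
      have "\<ominus> h = (\<ominus> a) \<otimes> inv b" using h SR I by (simp add: l_minus)
      then show ?thesis by (rule F) (use h subringE(5)[OF R] in auto)
    qed
    show "h \<otimes> h' \<in> ?F" if hF: "h \<in> ?F" "h' \<in> ?F" for h h'
    proof -
      obtain a b where h: "h = a \<otimes> inv b" "a \<in> S" "b \<in> S - {\<zero>}" using hF by blast
      obtain c d where h': "h' = c \<otimes> inv d" "c \<in> S" "d \<in> S - {\<zero>}" using hF by blast
      have "h \<otimes> h' = (a \<otimes> c) \<otimes> inv (b \<otimes> d)"
        unfolding IM[OF h(3) h'(3)] using h h' SR I by (simp add: m_ac)
      then show ?thesis by (rule F) (use h h' subringE(6)[OF R] NZ in auto)
    qed
    show "h \<oplus> h' \<in> ?F" if hF: "h \<in> ?F" "h' \<in> ?F" for h h'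
    proof -
      obtain a b where h: "h = a \<otimes> inv b" "a \<in> S" "b \<in> S - {\<zero>}" using hF by blast
      obtain c d where h': "h' = c \<otimes> inv d" "c \<in> S" "d \<in> S - {\<zero>}" using hF by blast
      have "(a \<otimes> d \<oplus> c \<otimes> b) \<otimes> (inv b \<otimes> inv d)
          = (a \<otimes> inv b) \<otimes> (d \<otimes> inv d) \<oplus> (c \<otimes> inv d) \<otimes> (b \<otimes> inv b)"
        using h(2,3) h'(2,3) SR I(1)[OF h(3)] I(1)[OF h'(3)] by (simp add: l_distr r_distr m_ac)
      then have "h \<oplus> h' = (a \<otimes> d \<oplus> c \<otimes> b) \<otimes> inv (b \<otimes> d)"
        unfolding IM[OF h(3) h'(3)] using h h' SR I by simp
      then show ?thesis by (rule F) (use h h' subringE(6,7)[OF R] NZ in auto)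
    qed
  qed
  show "inv h \<in> ?F" if hF: "h \<in> ?F - {\<zero>}" for h
  proof -
    obtain a b where h: "h = a \<otimes> inv b" "a \<in> S" "b \<in> S - {\<zero>}" using hF by blast
    then have a: "a \<in> S - {\<zero>}" using hF I by auto
    have "inv h = b \<otimes> inv a"
    proof (rule comm_inv_char)
      have "h \<otimes> (b \<otimes> inv a) = (a \<otimes> inv a) \<otimes> (b \<otimes> inv b)"
        using h a SR I(1) by (simp add: m_ac)
      then show "h \<otimes> (b \<otimes> inv a) = \<one>" using I a h by simp
    qed (use h a SR I in auto)
    then show ?thesis by (rule F) (use h a in auto)
  qed
qed

lemma (in cring) diff_mult_diff:
  assumes "p \<in> carrier R" "n \<in> carrier R" "p' \<in> carrier R" "n' \<in> carrier R"
  shows "(p \<otimes> p' \<oplus> n \<otimes> n') \<ominus> (p \<otimes> n' \<oplus> n \<otimes> p') = (p \<ominus> n) \<otimes> (p' \<ominus> n')"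
  using assms by algebra

lemma (in cring) diff_add_diff:
  assumes "p \<in> carrier R" "n \<in> carrier R" "p' \<in> carrier R" "n' \<in> carrier R"
  shows "(p \<oplus> p') \<ominus> (n \<oplus> n') = (p \<ominus> n) \<oplus> (p' \<ominus> n')"
  using assms by algebra

lemma (in cring) minus_diff:
  assumes "p \<in> carrier R" "n \<in> carrier R"
  shows "\<ominus> (p \<ominus> n) = n \<ominus> p"
  using assms by algebra

lemma pm_domainI:
  fixes K :: "'f ring"
  assumes A: "pointed_monoid A" and K: "field K"
    and g: "g \<in> pm_hom A (mult_pm K)" and inj: "inj_on g (carrier A)"
  shows "pm_domain A"
proof -
  interpret A: pointed_monoid A by fact
  interpret K: field K by fact
  have g1: "\<And>x. x \<in> carrier A \<Longrightarrow> g x \<in> carrier K"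
    and gm: "\<And>x y. x \<in> carrier A \<Longrightarrow> y \<in> carrier A \<Longrightarrow> g (x \<otimes>\<^bsub>A\<^esub> y) = g x \<otimes>\<^bsub>K\<^esub> g y"
    and g11: "g \<one>\<^bsub>A\<^esub> = \<one>\<^bsub>K\<^esub>" and g0: "g (pzero A) = \<zero>\<^bsub>K\<^esub>"
    using g by (auto simp: pm_hom_def hom_def mult_pm_def)
  let ?L = "lists (carrier A)"
  define sm where "sm xs = foldr (\<lambda>x y. g x \<oplus>\<^bsub>K\<^esub> y) xs \<zero>\<^bsub>K\<^esub>" for xs
  have sm_simps [simp]: "sm [] = \<zero>\<^bsub>K\<^esub>" "\<And>x xs. sm (x # xs) = g x \<oplus>\<^bsub>K\<^esub> sm xs"
    by (auto simp: sm_def)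
  have smK [simp]: "sm xs \<in> carrier K" if "xs \<in> ?L" for xs
    using that by (induction xs) (auto simp: g1)
  have sm_app: "sm (xs @ ys) = sm xs \<oplus>\<^bsub>K\<^esub> sm ys" if "xs \<in> ?L" "ys \<in> ?L" for xs ys
    using that by (induction xs) (auto simp: g1 K.a_assoc)
  have sm_map: "sm (map (\<lambda>y. x \<otimes>\<^bsub>A\<^esub> y) ys) = g x \<otimes>\<^bsub>K\<^esub> sm ys" if "x \<in> carrier A" "ys \<in> ?L" for x ys
    using that by (induction ys) (auto simp: g1 gm K.r_distr)
  have sm_mult: "\<exists>zs \<in> ?L. sm zs = sm xs \<otimes>\<^bsub>K\<^esub> sm ys" if "xs \<in> ?L" "ys \<in> ?L" for xs ys
    using that
  proof (induction xs)
    case Nil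
    then show ?case by (intro bexI[of _ "[]"]) auto
  next
    case (Cons x xs)
    then obtain zs where zs: "zs \<in> ?L" "sm zs = sm xs \<otimes>\<^bsub>K\<^esub> sm ys" by auto
    let ?m = "map (\<lambda>y. x \<otimes>\<^bsub>A\<^esub> y) ys"
    have m: "?m \<in> ?L" using Cons by auto
    have "sm (?m @ zs) = sm (x # xs) \<otimes>\<^bsub>K\<^esub> sm ys"
      using sm_app[OF m zs(1)] sm_map[of x ys] Cons zs g1 by (simp add: K.l_distr)
    moreover have "?m @ zs \<in> ?L" using m zs by auto
    ultimately show ?case by blast
  qed
  define L where "L = lists (carrier A)"
  note smK = smK[folded L_def] and sm_app = sm_app[folded L_def] and sm_mult = sm_mult[folded L_def]
  have app_L: "xs @ ys \<in> L" if "xs \<in> L" "ys \<in> L" for xs ys using that by (auto simp: L_def)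
  have nil_L: "[] \<in> L" and sing_L: "\<And>x. x \<in> carrier A \<Longrightarrow> [x] \<in> L" by (auto simp: L_def)
  define R where "R = {sm ps \<ominus>\<^bsub>K\<^esub> sm ns | ps ns. ps \<in> L \<and> ns \<in> L}"
  have R_mem: "sm p \<ominus>\<^bsub>K\<^esub> sm n \<in> R" if "p \<in> L" "n \<in> L" for p n
    unfolding R_def using that by blast
  have R: "subring R K"
  proof (rule K.subringI)
    show "R \<subseteq> carrier K" using smK K.minus_closed unfolding R_def by blast
    have "\<one>\<^bsub>K\<^esub> = sm [\<one>\<^bsub>A\<^esub>] \<ominus>\<^bsub>K\<^esub> sm []" by (simp add: g11 K.minus_eq)
    then show "\<one>\<^bsub>K\<^esub> \<in> R" unfolding R_def using nil_L sing_L[OF A.one_closed] by blast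
    show "\<ominus>\<^bsub>K\<^esub> h \<in> R" if h: "h \<in> R" for h
    proof -
      obtain p n where *: "h = sm p \<ominus>\<^bsub>K\<^esub> sm n" "p \<in> L" "n \<in> L" using h R_def by auto
      then have "\<ominus>\<^bsub>K\<^esub> h = sm n \<ominus>\<^bsub>K\<^esub> sm p"
        using K.minus_diff[OF smK smK] by simp
      then show ?thesis using R_mem[OF *(3) *(2)] by simp
    qed
    show "h \<otimes>\<^bsub>K\<^esub> h' \<in> R" if h: "h \<in> R" "h' \<in> R" for h h'
    proof -
      obtain p n where *: "h = sm p \<ominus>\<^bsub>K\<^esub> sm n" "p \<in> L" "n \<in> L" using h R_def by auto
      obtain p' n' where **: "h' = sm p' \<ominus>\<^bsub>K\<^esub> sm n'" "p' \<in> L" "n' \<in> L" using h R_def by auto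
      obtain a b c d where abcd: "a \<in> L" "b \<in> L" "c \<in> L" "d \<in> L"
        "sm a = sm p \<otimes>\<^bsub>K\<^esub> sm p'" "sm b = sm n \<otimes>\<^bsub>K\<^esub> sm n'"
        "sm c = sm p \<otimes>\<^bsub>K\<^esub> sm n'" "sm d = sm n \<otimes>\<^bsub>K\<^esub> sm p'"
        using sm_mult * ** by metis
      have "sm (a @ b) \<ominus>\<^bsub>K\<^esub> sm (c @ d) = h \<otimes>\<^bsub>K\<^esub> h'"
        unfolding sm_app[OF abcd(1,2)] sm_app[OF abcd(3,4)] abcd(5-8) *(1) **(1)
        by (rule K.diff_mult_diff) (use *(2,3) **(2,3) smK in auto)
      then show ?thesis using R_mem[OF app_L[OF abcd(1,2)] app_L[OF abcd(3,4)]] by simp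
    qed
    show "h \<oplus>\<^bsub>K\<^esub> h' \<in> R" if h: "h \<in> R" "h' \<in> R" for h h'
    proof -
      obtain p n where *: "h = sm p \<ominus>\<^bsub>K\<^esub> sm n" "p \<in> L" "n \<in> L" using h R_def by auto
      obtain p' n' where **: "h' = sm p' \<ominus>\<^bsub>K\<^esub> sm n'" "p' \<in> L" "n' \<in> L" using h R_def by auto
      have "sm (p @ p') \<ominus>\<^bsub>K\<^esub> sm (n @ n') = h \<oplus>\<^bsub>K\<^esub> h'"
        unfolding sm_app[OF *(2) **(2)] sm_app[OF *(3) **(3)] *(1) **(1)
        by (rule K.diff_add_diff) (use *(2,3) **(2,3) smK in auto)
      then show ?thesis using R_mem[OF app_L[OF *(2) **(2)] app_L[OF *(3) **(3)]] by simp
    qed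
  qed
  define F where "F = {a \<otimes>\<^bsub>K\<^esub> inv\<^bsub>K\<^esub> b | a b. a \<in> R \<and> b \<in> R - {\<zero>\<^bsub>K\<^esub>}}"
  have F: "subfield F K" unfolding F_def by (rule K.fractions_subfield[OF R])
  have RF: "R \<subseteq> F"
  proof
    fix r assume r: "r \<in> R"
    have "r = r \<otimes>\<^bsub>K\<^esub> inv\<^bsub>K\<^esub> \<one>\<^bsub>K\<^esub>" using r subringE(1)[OF R] by auto
    moreover have "\<one>\<^bsub>K\<^esub> \<in> R - {\<zero>\<^bsub>K\<^esub>}" using subringE(3)[OF R] by simp
    ultimately show "r \<in> F" unfolding F_def using r by blast
  qed
  have gF: "g x \<in> F" if "x \<in> carrier A" for x
  proof -
    have "g x = sm [x] \<ominus>\<^bsub>K\<^esub> sm []" using that g1 by (simp add: K.minus_eq)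
    moreover have "[x] \<in> L" "[] \<in> L" using that nil_L sing_L by auto
    ultimately show ?thesis using RF unfolding R_def by blast
  qed
  define dec where "dec l = (sm (l ! 0) \<ominus>\<^bsub>K\<^esub> sm (l ! 1)) \<otimes>\<^bsub>K\<^esub> inv\<^bsub>K\<^esub> (sm (l ! 2) \<ominus>\<^bsub>K\<^esub> sm (l ! 3))" for l
  have ex: "\<exists>l. dec l = x" if x: "x \<in> F" for x
  proof -
    obtain a b c d where "x = (sm a \<ominus>\<^bsub>K\<^esub> sm b) \<otimes>\<^bsub>K\<^esub> inv\<^bsub>K\<^esub> (sm c \<ominus>\<^bsub>K\<^esub> sm d)"
      using x unfolding F_def R_def by blast
    then have "dec [a, b, c, d] = x" by (simp add: dec_def eval_nat_numeral)
    then show ?thesis by blast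
  qed
  define e where "e x = (SOME l. dec l = x)" for x
  have e: "dec (e x) = x" if "x \<in> F" for x unfolding e_def using ex[OF that] by (rule someI_ex)
  have injF: "inj_on e F" using e by (rule inj_on_inverseI)
  let ?KF = "K\<lparr>carrier := F\<rparr>"
  interpret KF: field ?KF using K.subfield_iff(2)[OF F] .
  have fld: "field (image_ring e ?KF)"
    by (rule KF.inj_imp_image_ring_is_field) (use injF in simp)
  let ?K' = "image_ring e ?KF" and ?f = "e \<circ> g"
  let ?S = "?f ` carrier A"
  have ii: "inv_into F e (e (g x)) = g x" if "x \<in> carrier A" for x
    using injF gF[OF that] by simp
  have mul: "e (g x) \<otimes>\<^bsub>?K'\<^esub> e (g y) = e (g (x \<otimes>\<^bsub>A\<^esub> y))" if "x \<in> carrier A" "y \<in> carrier A" for x y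
    using that by (simp add: image_ring_def image_group_def monoid.defs ii gm)
  have K'1: "\<one>\<^bsub>?K'\<^esub> = e (g \<one>\<^bsub>A\<^esub>)" "\<zero>\<^bsub>?K'\<^esub> = e (g (pzero A))" "carrier ?K' = e ` F"
    by (auto simp: image_ring_def image_group_def monoid.defs g11 g0)
  have sub: "pm_submonoid ?S (mult_pm ?K')"
    unfolding pm_submonoid_def submonoid_def mult_pm_def using gF mul K'1 by (force simp: A.m_closed)
  have "?f \<in> pm_iso A ((mult_pm ?K')\<lparr>carrier := ?S\<rparr>)"
    unfolding pm_iso_def pm_hom_def hom_def mult_pm_def using mul K'1 inj injF gF
    by (auto simp: bij_betw_def inj_on_def)
  then show ?thesis unfolding pm_domain_def using A fld sub by blast
qed

context pointed_monoid
begin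

lemma loc_rel_equiv:
  assumes S: "submonoid S A"
  shows "equiv (carrier A \<times> S) (loc_rel A S)"
proof (rule equivI)
  note SA = submonoid.mem_carrier[OF S] and SM = submonoid.m_closed[OF S]
    and S1 = submonoid.one_closed[OF S]
  show "loc_rel A S \<subseteq> (carrier A \<times> S) \<times> carrier A \<times> S" by (auto simp: loc_rel_def)
  show "refl_on (carrier A \<times> S) (loc_rel A S)"
    using S1 by (auto simp: refl_on_def loc_rel_def)
  show "sym (loc_rel A S)" by (auto simp: sym_def loc_rel_def) (metis)
  show "trans (loc_rel A S)"
  proof (rule transI)
    fix x y z assume "(x, y) \<in> loc_rel A S" "(y, z) \<in> loc_rel A S"
    then obtain a s b t c r u v where *: "x = (a, s)" "y = (b, t)" "z = (c, r)"
      "a \<in> carrier A" "s \<in> S" "b \<in> carrier A" "t \<in> S" "c \<in> carrier A" "r \<in> S" "u \<in> S" "v \<in> S"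
      "u \<otimes> (t \<otimes> a) = u \<otimes> (s \<otimes> b)" "v \<otimes> (r \<otimes> b) = v \<otimes> (t \<otimes> c)"
      by (auto simp: loc_rel_def)
    note car = *(4,6,8) SA[OF *(5)] SA[OF *(7)] SA[OF *(9)] SA[OF *(10)] SA[OF *(11)]
    have "(u \<otimes> v \<otimes> t) \<otimes> (r \<otimes> a) = (v \<otimes> r) \<otimes> (u \<otimes> (t \<otimes> a))" using car by (simp add: m_ac)
    also have "\<dots> = (u \<otimes> s) \<otimes> (v \<otimes> (r \<otimes> b))" unfolding *(12) using car by (simp add: m_ac)
    also have "\<dots> = (u \<otimes> v \<otimes> t) \<otimes> (s \<otimes> c)" unfolding *(13) using car by (simp add: m_ac)
    finally show "(x, z) \<in> loc_rel A S" unfolding loc_rel_def using * SM[OF SM[OF *(10,11)] *(7)] by auto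
  qed
qed

lemma fraction_eq_iff:
  assumes "submonoid S A" "a \<in> carrier A" "s \<in> S" "b \<in> carrier A" "t \<in> S"
  shows "fraction A S a s = fraction A S b t \<longleftrightarrow> (\<exists>u \<in> S. u \<otimes> (t \<otimes> a) = u \<otimes> (s \<otimes> b))"
proof -
  have "fraction A S a s = fraction A S b t \<longleftrightarrow> ((a, s), (b, t)) \<in> loc_rel A S"
    unfolding fraction_def
    by (rule eq_equiv_class_iff[OF loc_rel_equiv[OF assms(1)]]) (use assms in simp_all)
  then show ?thesis using assms by (simp add: loc_rel_def)
qed

lemma fraction_self:
  assumes "submonoid S A" "a \<in> carrier A" "s \<in> S"
  shows "(a, s) \<in> fraction A S a s"
  unfolding fraction_def by (rule equiv_class_self[OF loc_rel_equiv[OF assms(1)]]) (use assms in simp)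

lemma carrier_localization:
  "carrier (localization A S) = {fraction A S a s | a s. a \<in> carrier A \<and> s \<in> S}"
  by (auto simp: localization_def quotient_def fraction_def)

lemma fraction_mult:
  assumes S: "submonoid S A" and "a \<in> carrier A" "s \<in> S" "b \<in> carrier A" "t \<in> S"
  shows "fraction A S a s \<otimes>\<^bsub>localization A S\<^esub> fraction A S b t = fraction A S (a \<otimes> b) (s \<otimes> t)"
proof -
  note SA = submonoid.mem_carrier[OF S] and SM = submonoid.m_closed[OF S]
  note E = loc_rel_equiv[OF S]
  have *: "fraction A S (a' \<otimes> b') (s' \<otimes> t') = fraction A S (a \<otimes> b) (s \<otimes> t)"
    if 1: "(a', s') \<in> fraction A S a s" and 2: "(b', t') \<in> fraction A S b t" for a' s' b' t'
  proof -
    obtain u v where u: "u \<in> S" "a' \<in> carrier A" "s' \<in> S" "u \<otimes> (s' \<otimes> a) = u \<otimes> (s \<otimes> a')"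
      and v: "v \<in> S" "b' \<in> carrier A" "t' \<in> S" "v \<otimes> (t' \<otimes> b) = v \<otimes> (t \<otimes> b')"
      using 1 2 by (auto simp: fraction_def loc_rel_def)
    note car = assms(2,4) u(2) v(2) SA[OF assms(3)] SA[OF assms(5)] SA[OF u(1)] SA[OF v(1)]
      SA[OF u(3)] SA[OF v(3)]
    have "(u \<otimes> v) \<otimes> ((s \<otimes> t) \<otimes> (a' \<otimes> b')) = (u \<otimes> (s \<otimes> a')) \<otimes> (v \<otimes> (t \<otimes> b'))"
      using car by (simp add: m_ac)
    also have "\<dots> = (u \<otimes> (s' \<otimes> a)) \<otimes> (v \<otimes> (t' \<otimes> b))" using u v by simp
    also have "\<dots> = (u \<otimes> v) \<otimes> ((s' \<otimes> t') \<otimes> (a \<otimes> b))" using car by (simp add: m_ac)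
    finally show ?thesis
      using fraction_eq_iff[OF S, of "a' \<otimes> b'" "s' \<otimes> t'" "a \<otimes> b" "s \<otimes> t"] car SM u v assms by blast
  qed
  have UN2: "(\<Union>p \<in> X. \<Union>q \<in> Y. g p q) = C"
    if "x \<in> X" "y \<in> Y" "\<And>p q. p \<in> X \<Longrightarrow> q \<in> Y \<Longrightarrow> g p q = C"
    for X Y :: "('a \<times> 'a) set" and x y and g :: "_ \<Rightarrow> _ \<Rightarrow> ('a \<times> 'a) set" and C
    using that by auto
  show ?thesis unfolding localization_def monoid.simps case_prod_unfold
    by (rule UN2[OF fraction_self[OF S assms(2,3)] fraction_self[OF S assms(4,5)]]) (use * in auto)
qed

lemma pointed_monoid_localization:
  assumes S: "submonoid S A"
  shows "pointed_monoid (localization A S)"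
proof -
  note SA = submonoid.mem_carrier[OF S] and SM = submonoid.m_closed[OF S]
    and S1 = submonoid.one_closed[OF S]
  let ?L = "localization A S"
  have one: "\<one>\<^bsub>?L\<^esub> = fraction A S \<one> \<one>" and zero: "pzero ?L = fraction A S (pzero A) \<one>"
    by (simp_all add: localization_def)
  have z: "fraction A S (pzero A) s = fraction A S (pzero A) \<one>" if "s \<in> S" for s
    using fraction_eq_iff[OF S, of "pzero A" s "pzero A" \<one>] that S1 SA[OF that] m_comm[of s "pzero A"]
    by auto
  have memE: "\<exists>a s. x = fraction A S a s \<and> a \<in> carrier A \<and> s \<in> S" if "x \<in> carrier ?L" for x
    using that by (auto simp: carrier_localization)
  have mem: "fraction A S a s \<in> carrier ?L" if "a \<in> carrier A" "s \<in> S" for a s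
    using that by (auto simp: carrier_localization)
  note mult = fraction_mult[OF S]
  have "comm_monoid ?L"
  proof (rule comm_monoidI)
    fix x y z assume xyz: "x \<in> carrier ?L" "y \<in> carrier ?L" "z \<in> carrier ?L"
    obtain a s b t c r where *: "x = fraction A S a s" "a \<in> carrier A" "s \<in> S"
      "y = fraction A S b t" "b \<in> carrier A" "t \<in> S" "z = fraction A S c r" "c \<in> carrier A" "r \<in> S"
      using memE[OF xyz(1)] memE[OF xyz(2)] memE[OF xyz(3)] by blast
    show "x \<otimes>\<^bsub>?L\<^esub> y \<otimes>\<^bsub>?L\<^esub> z = x \<otimes>\<^bsub>?L\<^esub> (y \<otimes>\<^bsub>?L\<^esub> z)"
      using * by (simp add: mult SM SA m_assoc)
  next
    fix x y assume xy: "x \<in> carrier ?L" "y \<in> carrier ?L"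
    obtain a s b t where *: "x = fraction A S a s" "a \<in> carrier A" "s \<in> S"
      "y = fraction A S b t" "b \<in> carrier A" "t \<in> S"
      using memE[OF xy(1)] memE[OF xy(2)] by blast
    show "x \<otimes>\<^bsub>?L\<^esub> y \<in> carrier ?L" using * by (simp add: mult SM mem)
    show "x \<otimes>\<^bsub>?L\<^esub> y = y \<otimes>\<^bsub>?L\<^esub> x" using * by (simp add: mult SA m_comm)
  next
    show "\<one>\<^bsub>?L\<^esub> \<in> carrier ?L" unfolding one using S1 by (simp add: mem)
    fix x assume "x \<in> carrier ?L"
    then obtain a s where *: "x = fraction A S a s" "a \<in> carrier A" "s \<in> S" using memE by blast
    then show "\<one>\<^bsub>?L\<^esub> \<otimes>\<^bsub>?L\<^esub> x = x" using S1 SA by (simp add: one mult)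
  qed
  moreover have "pzero ?L \<otimes>\<^bsub>?L\<^esub> x = pzero ?L" if x: "x \<in> carrier ?L" for x
  proof -
    obtain a s where *: "x = fraction A S a s" "a \<in> carrier A" "s \<in> S" using memE[OF x] by blast
    then show ?thesis using S1 SA by (simp add: zero mult z[OF *(3)])
  qed
  moreover have "pzero ?L \<in> carrier ?L" unfolding zero using S1 by (simp add: mem)
  ultimately show ?thesis
    by (simp add: pointed_monoid_def pointed_monoid_axioms_def)
qed

lemma submonoid_prime: "pm_prime A P \<Longrightarrow> submonoid (carrier A - P) A"
proof (rule submonoid.intro)
  assume P: "pm_prime A P"
  show "\<one> \<in> carrier A - P"
  proof (rule ccontr)
    assume "\<not> ?thesis"
    then have "\<one> \<in> P" by simp
    then have "a \<in> P" if "a \<in> carrier A" for a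
      using P that unfolding pm_prime_def pm_ideal_def by (metis r_one)
    then show False using P unfolding pm_prime_def pm_ideal_def by blast
  qed
qed (auto simp: pm_prime_def)

lemma submonoid_powers: "h \<in> carrier A \<Longrightarrow> submonoid (powers A h) A"
proof (rule submonoid.intro)
  assume h: "h \<in> carrier A"
  show "\<one> \<in> powers A h" unfolding powers_def by (rule CollectI, rule exI[of _ 0]) simp
  show "x \<otimes> y \<in> powers A h" if "x \<in> powers A h" "y \<in> powers A h" for x y
    using that h by (auto simp: powers_def nat_pow_mult)
qed (auto simp: powers_def)

lemma topspace_mspec: "topspace (mspec_top A) = {P. pm_prime A P}"
proof -
  have "{P. pm_prime A P} = basic_open A \<one>"
    using submonoid_prime submonoid.one_closed by (fastforce simp: basic_open_def)
  then show ?thesis unfolding mspec_top_def topology_generated_by_topspace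
    by (auto simp: basic_open_def)
qed

lemma openin_basic: "h \<in> carrier A \<Longrightarrow> openin (mspec_top A) (basic_open A h)"
  unfolding mspec_top_def by (rule topology_generated_by_Basis) auto

lemma prime_mult_iff:
  assumes P: "pm_prime A P" and gh: "g \<in> carrier A" "h \<in> carrier A"
  shows "g \<otimes> h \<in> P \<longleftrightarrow> g \<in> P \<or> h \<in> P"
proof -
  have "x \<otimes> y \<in> P" if "x \<in> carrier A" "y \<in> P" for x y
    using P that by (simp add: pm_prime_def pm_ideal_def)
  from this[of g h] this[of h g] have "g \<in> P \<or> h \<in> P \<Longrightarrow> g \<otimes> h \<in> P"
    using gh unfolding m_comm[OF gh(2,1)] by blast
  moreover have "g \<otimes> h \<in> P \<Longrightarrow> g \<in> P \<or> h \<in> P" using P gh by (simp add: pm_prime_def)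
  ultimately show ?thesis by blast
qed

lemma basic_open_Int:
  assumes "g \<in> carrier A" "h \<in> carrier A"
  shows "basic_open A g \<inter> basic_open A h = basic_open A (g \<otimes> h)"
  using prime_mult_iff[OF _ assms] by (auto simp: basic_open_def)

lemma openin_mspecE:
  assumes "openin (mspec_top A) V" "P \<in> V"
  obtains h where "h \<in> carrier A" "P \<in> basic_open A h" "basic_open A h \<subseteq> V"
proof -
  have "generate_topology_on {basic_open A h | h. h \<in> carrier A} V"
    using assms(1) unfolding mspec_top_def by (rule openin_topology_generated_by)
  then have "\<exists>h \<in> carrier A. P \<in> basic_open A h \<and> basic_open A h \<subseteq> V" using assms(2)
  proof induction
    case (Int a b)
    then obtain g h where "g \<in> carrier A" "P \<in> basic_open A g" "basic_open A g \<subseteq> a"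
      "h \<in> carrier A" "P \<in> basic_open A h" "basic_open A h \<subseteq> b" by blast
    then show ?case using basic_open_Int[of g h] by (intro bexI[of _ "g \<otimes> h"]) auto
  qed blast+
  then show ?thesis using that by blast
qed

lemma largest_prime:
  assumes h: "h \<in> carrier A" and z: "pzero A \<notin> powers A h"
  shows "{f \<in> carrier A. \<forall>c \<in> carrier A. f \<otimes> c \<notin> powers A h} \<in> basic_open A h" (is "?P \<in> _")
proof -
  have hH: "h \<otimes> \<one> \<in> powers A h"
    unfolding powers_def using h by (intro CollectI exI[of _ "1 :: nat"]) simp
  have "pm_ideal A ?P"
    unfolding pm_ideal_def
  proof (intro conjI ballI)
    show "a \<otimes> x \<in> ?P" if a: "a \<in> carrier A" and x: "x \<in> ?P" for a x
    proof -
      have "(a \<otimes> x) \<otimes> c = x \<otimes> (a \<otimes> c)" if "c \<in> carrier A" for c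
        using that a x by (simp add: m_ac)
      then show ?thesis using a x by auto
    qed
  qed (use z in auto)
  moreover have "f \<in> ?P \<or> g \<in> ?P" if fg: "f \<in> carrier A" "g \<in> carrier A" "f \<otimes> g \<in> ?P" for f g
  proof (rule ccontr)
    assume "\<not> ?thesis"
    then obtain c d where c: "c \<in> carrier A" "f \<otimes> c \<in> powers A h"
      and d: "d \<in> carrier A" "g \<otimes> d \<in> powers A h" using fg by auto
    have "(f \<otimes> g) \<otimes> (c \<otimes> d) = (f \<otimes> c) \<otimes> (g \<otimes> d)"
      using fg(1,2) c d by (simp add: m_ac)
    then have "(f \<otimes> g) \<otimes> (c \<otimes> d) \<in> powers A h"
      using submonoid.m_closed[OF submonoid_powers[OF h] c(2) d(2)] by simp
    then show False using fg(3) c(1) d(1) by auto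
  qed
  moreover have "h \<notin> ?P" using hH one_closed by blast
  ultimately show ?thesis
    unfolding basic_open_def pm_prime_def using h by blast
qed

lemma mspec_sec_basic_open:
  assumes h: "h \<in> carrier A"
  shows "(\<lambda>x. \<lambda>P \<in> basic_open A h. \<Union>(a, s) \<in> x. fraction A (carrier A - P) a s)
           \<in> pm_iso (localization A (powers A h)) (msec (mspec A) (basic_open A h))" (is "?F \<in> _")
proof -
  let ?U = "basic_open A h" and ?H = "powers A h"
  have H: "submonoid ?H A" by (rule submonoid_powers[OF h])
  note HA = submonoid.mem_carrier[OF H] and H1 = submonoid.one_closed[OF H]
  have S: "submonoid (carrier A - P) A" if "P \<in> ?U" for P
    using that submonoid_prime by (simp add: basic_open_def)
  have HS: "s \<in> carrier A - P" if "P \<in> ?U" "s \<in> ?H" for s P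
  proof -
    have "h [^] n \<in> carrier A - P" for n :: nat
      using that(1) h submonoid.m_closed[OF S[OF that(1)]] submonoid.one_closed[OF S[OF that(1)]]
      by (induction n) (auto simp: basic_open_def)
    then show ?thesis using that(2) by (auto simp: powers_def)
  qed
  have F: "?F (fraction A ?H a s) = (\<lambda>P \<in> ?U. fraction A (carrier A - P) a s)"
    if a: "a \<in> carrier A" and s: "s \<in> ?H" for a s
  proof (rule restrict_ext)
    fix P assume P: "P \<in> ?U"
    have "fraction A (carrier A - P) b t = fraction A (carrier A - P) a s" if "(b, t) \<in> fraction A ?H a s" for b t
    proof -
      obtain u where "u \<in> ?H" "b \<in> carrier A" "t \<in> ?H" "u \<otimes> (t \<otimes> a) = u \<otimes> (s \<otimes> b)"
        using \<open>(b, t) \<in> fraction A ?H a s\<close> by (auto simp: fraction_def loc_rel_def)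
      then show ?thesis using fraction_eq_iff[OF S[OF P]] HS[OF P] a s by metis
    qed
    moreover note fraction_self[OF H a s]
    ultimately show "(\<Union>(b, t) \<in> fraction A ?H a s. fraction A (carrier A - P) b t) = fraction A (carrier A - P) a s"
      by fast
  qed
  have closed: "(\<lambda>P \<in> ?U. fraction A (carrier A - P) a s) \<in> mspec_sec_carrier A ?U"
    if "a \<in> carrier A" "s \<in> ?H" for a s
    unfolding mspec_sec_carrier_def
  proof (rule CollectI, intro conjI ballI)
    show "(\<lambda>P \<in> ?U. fraction A (carrier A - P) a s) \<in> (\<Pi>\<^sub>E P \<in> ?U. carrier (localization A (carrier A - P)))"
      using that HS by (auto simp: carrier_localization)
    show "\<exists>V b g. openin (mspec_top A) V \<and> P \<in> V \<and> V \<subseteq> ?U \<and> b \<in> carrier A \<and> g \<in> carrier A \<and>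
          (\<forall>Q \<in> V. g \<notin> Q \<and> (\<lambda>P \<in> ?U. fraction A (carrier A - P) a s) Q = fraction A (carrier A - Q) b g)"
      if "P \<in> ?U" for P
      by (intro exI[of _ ?U] exI[of _ a] exI[of _ s])
        (use that \<open>a \<in> carrier A\<close> \<open>s \<in> ?H\<close> HA HS openin_basic[OF h] in auto)
  qed
  let ?P = "{f \<in> carrier A. \<forall>c \<in> carrier A. f \<otimes> c \<notin> ?H}"
  have P0: "?P \<in> ?U" if ne: "?U \<noteq> {}"
  proof (rule largest_prime[OF h])
    obtain Q where Q: "Q \<in> ?U" using ne by blast
    then show "pzero A \<notin> ?H" using HS[OF Q] by (auto simp: basic_open_def pm_prime_def pm_ideal_def)
  qed
  have inj: "fraction A ?H a s = fraction A ?H b t"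
    if ab: "a \<in> carrier A" "s \<in> ?H" "b \<in> carrier A" "t \<in> ?H"
      and eq: "(\<lambda>P \<in> ?U. fraction A (carrier A - P) a s) = (\<lambda>P \<in> ?U. fraction A (carrier A - P) b t)" for a s b t
  proof (cases "?U = {}")
    case True
    show ?thesis
    proof (cases "pzero A \<in> ?H")
      case True
      moreover have "pzero A \<otimes> (t \<otimes> a) = pzero A \<otimes> (s \<otimes> b)" using ab HA by simp
      ultimately show ?thesis unfolding fraction_eq_iff[OF H ab] by blast
    next
      case False
      then show ?thesis using True largest_prime[OF h] by blast
    qed
  next
    case False
    have "fraction A (carrier A - ?P) a s = fraction A (carrier A - ?P) b t"
      using fun_cong[OF eq, of ?P] P0[OF False] by simp
    then obtain u where u: "u \<in> carrier A - ?P" "u \<otimes> (t \<otimes> a) = u \<otimes> (s \<otimes> b)"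
      using fraction_eq_iff[OF S[OF P0[OF False]], of a s b t] HS[OF P0[OF False]] ab by blast
    then obtain c where c: "c \<in> carrier A" "u \<otimes> c \<in> ?H" by blast
    have "(u \<otimes> c) \<otimes> (t \<otimes> a) = c \<otimes> (u \<otimes> (t \<otimes> a))" using u(1) c ab HA by (simp add: m_ac)
    also have "\<dots> = (u \<otimes> c) \<otimes> (s \<otimes> b)" unfolding u(2) using u(1) c ab HA by (simp add: m_ac)
    finally show ?thesis using fraction_eq_iff[OF H ab] c(2) by blast
  qed
  have surj: "\<exists>a \<in> carrier A. \<exists>t \<in> ?H. s = (\<lambda>P \<in> ?U. fraction A (carrier A - P) a t)"
    if s: "s \<in> mspec_sec_carrier A ?U" for s
  proof (cases "?U = {}")
    case True
    then show ?thesis using s H1 by (intro bexI[of _ \<one>]) (auto simp: mspec_sec_carrier_def)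
  next
    case False
    then obtain V a g where V: "openin (mspec_top A) V" "?P \<in> V" "V \<subseteq> ?U" "a \<in> carrier A" "g \<in> carrier A"
      "\<forall>Q \<in> V. g \<notin> Q \<and> s Q = fraction A (carrier A - Q) a g"
      using s P0[OF False] unfolding mspec_sec_carrier_def by blast
    obtain f where f: "f \<in> carrier A" "?P \<in> basic_open A f" "basic_open A f \<subseteq> V"
      using openin_mspecE[OF V(1,2)] .
    then obtain d where d: "d \<in> carrier A" "f \<otimes> d \<in> ?H" by (auto simp: basic_open_def)
    have "?U \<subseteq> basic_open A f"
    proof
      fix Q assume Q: "Q \<in> ?U"
      then have "f \<otimes> d \<notin> Q" using HS[OF Q] d by blast
      then have "f \<notin> Q" using Q prime_mult_iff[OF _ f(1) d(1)] by (auto simp: basic_open_def)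
      then show "Q \<in> basic_open A f" using Q by (simp add: basic_open_def)
    qed
    then have UV: "V = ?U" using f V by blast
    have "g \<notin> ?P" using bspec[OF V(6) V(2)] by (rule conjunct1)
    then obtain c where c: "c \<in> carrier A" "g \<otimes> c \<in> ?H" using V(5) by auto
    have "s = (\<lambda>P \<in> ?U. fraction A (carrier A - P) (a \<otimes> c) (g \<otimes> c))"
    proof
      fix Q
      show "s Q = (\<lambda>P \<in> ?U. fraction A (carrier A - P) (a \<otimes> c) (g \<otimes> c)) Q"
      proof (cases "Q \<in> ?U")
        case True
        have gQ: "g \<in> carrier A - Q" and ac: "a \<otimes> c \<in> carrier A"
          using V(4,5,6) True UV c(1) by auto
        have "\<one> \<otimes> ((g \<otimes> c) \<otimes> a) = \<one> \<otimes> (g \<otimes> (a \<otimes> c))" using V c by (simp add: m_ac)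
        then have "fraction A (carrier A - Q) a g = fraction A (carrier A - Q) (a \<otimes> c) (g \<otimes> c)"
          using fraction_eq_iff[OF S[OF True] V(4) gQ ac HS[OF True c(2)]]
            submonoid.one_closed[OF S[OF True]] by blast
        then show ?thesis using True V(6) UV by simp
      next
        case False
        then show ?thesis using s by (auto simp: mspec_sec_carrier_def)
      qed
    qed
    then show ?thesis using c V(4) by (intro bexI[of _ "a \<otimes> c"] bexI[of _ "g \<otimes> c"]) auto
  qed
  have hom: "?F (x \<otimes>\<^bsub>localization A ?H\<^esub> y) = ?F x \<otimes>\<^bsub>mspec_sec A ?U\<^esub> ?F y"
    if "x \<in> carrier (localization A ?H)" "y \<in> carrier (localization A ?H)" for x y
  proof -
    obtain a s b t where *: "x = fraction A ?H a s" "y = fraction A ?H b t"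
      "a \<in> carrier A" "s \<in> ?H" "b \<in> carrier A" "t \<in> ?H"
      using \<open>x \<in> _\<close> \<open>y \<in> _\<close> by (auto simp: carrier_localization)
    have "?F (x \<otimes>\<^bsub>localization A ?H\<^esub> y) = (\<lambda>P \<in> ?U. fraction A (carrier A - P) (a \<otimes> b) (s \<otimes> t))"
      unfolding *(1,2) fraction_mult[OF H *(3-6)]
      by (rule F) (use * submonoid.m_closed[OF H] in auto)
    also have "\<dots> = (\<lambda>P \<in> ?U. fraction A (carrier A - P) a s \<otimes>\<^bsub>localization A (carrier A - P)\<^esub> fraction A (carrier A - P) b t)"
      by (rule restrict_ext) (use fraction_mult[OF S] HS * in simp)
    also have "\<dots> = ?F x \<otimes>\<^bsub>mspec_sec A ?U\<^esub> ?F y"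
      unfolding *(1,2) F[OF *(3,4)] F[OF *(5,6)] by (auto simp: mspec_sec_def intro!: restrict_ext)
    finally show ?thesis .
  qed
  have one: "?F \<one>\<^bsub>localization A ?H\<^esub> = \<one>\<^bsub>mspec_sec A ?U\<^esub>"
    and zero: "?F (pzero (localization A ?H)) = pzero (mspec_sec A ?U)"
    using F[OF one_closed H1] F[OF pzero_closed H1] by (simp_all add: localization_def mspec_sec_def)
  have bij: "bij_betw ?F (carrier (localization A ?H)) (mspec_sec_carrier A ?U)"
    unfolding bij_betw_def
  proof
    show "inj_on ?F (carrier (localization A ?H))"
    proof (rule inj_onI)
      fix x y assume x: "x \<in> carrier (localization A ?H)" and y: "y \<in> carrier (localization A ?H)"
        and eq: "?F x = ?F y"
      obtain a s b t where *: "x = fraction A ?H a s" "y = fraction A ?H b t"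
        "a \<in> carrier A" "s \<in> ?H" "b \<in> carrier A" "t \<in> ?H"
        using x y by (auto simp: carrier_localization)
      show "x = y" using eq inj[OF *(3-6)] unfolding *(1,2) F[OF *(3,4)] F[OF *(5,6)] by blast
    qed
    show "?F ` carrier (localization A ?H) = mspec_sec_carrier A ?U"
    proof
      show "?F ` carrier (localization A ?H) \<subseteq> mspec_sec_carrier A ?U"
        using F closed by (auto simp: carrier_localization simp del: restrict_apply)
      show "mspec_sec_carrier A ?U \<subseteq> ?F ` carrier (localization A ?H)"
      proof
        fix s assume "s \<in> mspec_sec_carrier A ?U"
        then obtain a t where "a \<in> carrier A" "t \<in> ?H" "s = (\<lambda>P \<in> ?U. fraction A (carrier A - P) a t)"
          using surj by blast
        then have "s = ?F (fraction A ?H a t)" "fraction A ?H a t \<in> carrier (localization A ?H)"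
          using F by (auto simp: carrier_localization)
        then show "s \<in> ?F ` carrier (localization A ?H)" by (rule image_eqI)
      qed
    qed
  qed
  have sec: "msec (mspec A) = mspec_sec A" by (simp add: mspec_def)
  have car: "carrier (mspec_sec A ?U) = mspec_sec_carrier A ?U" by (simp add: mspec_sec_def)
  show ?thesis
    unfolding sec pm_iso_def pm_hom_def hom_def car
    using hom one zero bij bij_betw_imp_funcset[OF bij] by blast
qed

end

end

theory Submission
  imports Defs
begin

text \<open>
  The generic point of an irreducible closed set \<open>Z\<close> of \<open>k\<close>-congruences on a pointed monoid is the
  intersection of \<open>Z\<close>. It is a \<open>k\<close>-congruence because the quotient by it embeds into an
  ultraproduct-like field: as \<open>Z\<close> is irreducible, its nonempty open subsets form a filter base,
  and the product of the fields belonging to the members of \<open>Z\<close> is divided by a maximal ideal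
  that contains all families vanishing on such an open subset.

  If \<open>U \<subseteq> V\<close> are affine open and the sections over \<open>U\<close> are not trivial, then \<open>U\<close> is a basic open
  subset of \<open>V\<close>, because a neighbourhood of the closed point of \<open>U\<close> is all of \<open>U\<close>. Hence
  restriction is a localization, and the transition map of the congruence spaces is an open
  embedding. So the canonical maps into the colimit are open and continuous. They are injective as
  well, since every congruence is determined by the congruence that it induces on germs of sections
  at the point of its zero class, and this datum is not changed by the transition maps.
  Thus the colimit is locally sober, and this suffices.
\<close>

section \<open>Sober spaces\<close>

text \<open>Why the intersection: a subbasic open set demands that a pair be absent, so open sets
  are stable under passing to smaller congruences, and the closure of \<open>{c}\<close> consists of
  the congruences containing \<open>c\<close>. The obstacle is that the quotient by an intersection
  embeds at first only into a product of fields, which has zero divisors. Irreducibility removes it: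
  a pair outside \<open>\<Inter>Z\<close> is separated throughout a nonempty open part of
  \<open>Z\<close>, any two such parts meet, and so a single field quotient of the product can keep
  all these pairs apart at once. On the side of schemes, affine inclusions are simple because every
  nontrivial pointed monoid is local: its nonunits form a prime ideal. For rings, an affine open
  subset of an affine scheme need not be basic. The affine open sets need not form a filtered
  system, so two points of one chart may be linked by a zigzag of inclusions in both directions.
  Zigzags are not straightened; a congruence is given a datum indexed by arbitrary open
  neighbourhoods, not by the affine set that carries it.\<close>

lemma irreducible_closed_meets:
  assumes Z: "irreducible_closed T Z" and O: "openin T O1" "openin T O2"
    and ne: "O1 \<inter> Z \<noteq> {}" "O2 \<inter> Z \<noteq> {}"
  shows "O1 \<inter> O2 \<inter> Z \<noteq> {}"
proof
  assume e: "O1 \<inter> O2 \<inter> Z = {}"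
  have cl: "closedin T (Z - O1)" "closedin T (Z - O2)"
    using Z O by (auto simp: irreducible_closed_def intro: closedin_diff)
  moreover have "Z = (Z - O1) \<union> (Z - O2)" using e by blast
  ultimately have "Z = Z - O1 \<or> Z = Z - O2" using Z unfolding irreducible_closed_def by blast
  then show False using ne by blast
qed

lemma irreducible_closedI:
  assumes Z: "closedin T Z" "Z \<noteq> {}"
    and meets: "\<And>O1 O2. openin T O1 \<Longrightarrow> openin T O2 \<Longrightarrow> O1 \<inter> Z \<noteq> {} \<Longrightarrow> O2 \<inter> Z \<noteq> {} \<Longrightarrow>
      O1 \<inter> O2 \<inter> Z \<noteq> {}"
  shows "irreducible_closed T Z"
  unfolding irreducible_closed_def
proof (intro conjI allI impI Z)
  fix C D assume CD: "closedin T C \<and> closedin T D \<and> Z = C \<union> D"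
  have Zt: "Z \<subseteq> topspace T" using Z(1) by (rule closedin_subset)
  show "Z = C \<or> Z = D"
  proof (rule ccontr)
    assume n: "\<not> ?thesis"
    have "(topspace T - C) \<inter> (topspace T - D) \<inter> Z \<noteq> {}"
      by (rule meets) (use CD n Zt in \<open>auto intro: openin_diff\<close>)
    then show False using CD by blast
  qed
qed

lemma irreducible_closed_closure_of_singleton:
  assumes "x \<in> topspace T"
  shows "irreducible_closed T (T closure_of {x})"
proof (rule irreducible_closedI)
  have x: "x \<in> T closure_of {x}" using assms by (auto simp: in_closure_of)
  then show "T closure_of {x} \<noteq> {}" by blast
  show "O1 \<inter> O2 \<inter> T closure_of {x} \<noteq> {}"
    if "openin T O1" "openin T O2" "O1 \<inter> T closure_of {x} \<noteq> {}" "O2 \<inter> T closure_of {x} \<noteq> {}" for O1 O2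
  proof -
    have "x \<in> O'" if "openin T O'" "O' \<inter> T closure_of {x} \<noteq> {}" for O'
      using that by (auto simp: in_closure_of)
    from this[of O1] this[of O2] show ?thesis using that x by blast
  qed
qed simp

text \<open>Each \<open>e\<close> is an open embedding, so \<open>T\<close> is covered by open sober
  subspaces. A chart meeting \<open>Z\<close> is dense in it by irreducibility; hence the generic
  point of the trace of \<open>Z\<close> on that chart is generic for \<open>Z\<close>. Uniqueness
  is local too, since points with equal closures lie in the same open sets and so in a common
  chart.\<close>

lemma sober_space_local:
  assumes chart: "\<And>x. x \<in> topspace T \<Longrightarrow> \<exists>(S :: 'b topology) e. sober_space S \<and> continuous_map S T e \<and>
      open_map S T e \<and> inj_on e (topspace S) \<and> x \<in> e ` topspace S"
  shows "sober_space T"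
  unfolding sober_space_def
proof (intro allI impI)
  fix Z assume Z: "irreducible_closed T Z"
  have Zc: "closedin T Z" and Zne: "Z \<noteq> {}" using Z by (auto simp: irreducible_closed_def)
  have ZT: "Z \<subseteq> topspace T" using Zc by (rule closedin_subset)
  obtain z where z: "z \<in> Z" using Zne by blast
  obtain S :: "'b topology" and e where S: "sober_space S" and ce: "continuous_map S T e"
    and oe: "open_map S T e" and ie: "inj_on e (topspace S)" and ze: "z \<in> e ` topspace S"
    using chart[of z] z ZT by blast
  have pre: "openin S {s \<in> topspace S. e s \<in> W}" if "openin T W" for W
    using ce that by (rule openin_continuous_map_preimage)
  have img: "openin T (e ` W)" if "openin S W" for W using oe that by (auto simp: open_map_def)
  let ?Z = "{s \<in> topspace S. e s \<in> Z}"
  have "irreducible_closed S ?Z"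
  proof (rule irreducible_closedI)
    show "closedin S ?Z" using ce Zc by (rule closedin_continuous_map_preimage)
    show "?Z \<noteq> {}" using z ze by blast
    fix O1 O2 assume O: "openin S O1" "openin S O2" "O1 \<inter> ?Z \<noteq> {}" "O2 \<inter> ?Z \<noteq> {}"
    have sub: "O1 \<subseteq> topspace S" "O2 \<subseteq> topspace S" using O(1,2) by (auto dest: openin_subset)
    have "e ` O1 \<inter> e ` O2 \<inter> Z \<noteq> {}"
      by (rule irreducible_closed_meets[OF Z img[OF O(1)] img[OF O(2)]]) (use O in auto)
    then obtain a b where "a \<in> O1" "b \<in> O2" "e a = e b" "e a \<in> Z" by auto
    moreover from this have "a = b" using sub ie by (meson inj_onD subsetD)
    ultimately show "O1 \<inter> O2 \<inter> ?Z \<noteq> {}" using sub by blast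
  qed
  then obtain s where s: "s \<in> topspace S" "S closure_of {s} = ?Z"
    using S unfolding sober_space_def by blast
  have "s \<in> S closure_of {s}" using s(1) by (simp add: in_closure_of)
  then have es: "e s \<in> Z" using s(2) by blast
  have "T closure_of {e s} = Z"
  proof
    show "T closure_of {e s} \<subseteq> Z" using es Zc by (simp add: closure_of_minimal)
    show "Z \<subseteq> T closure_of {e s}"
    proof
      fix y assume y: "y \<in> Z"
      have "e s \<in> W" if W: "openin T W" "y \<in> W" for W
      proof -
        \<comment> \<open>Two open sets that meet \<open>Z\<close>, at \<open>y\<close> and at
          \<open>z\<close>, meet inside \<open>Z\<close>; the common point comes from the chart,
          where \<open>s\<close> is generic.\<close>
        have "W \<inter> e ` topspace S \<inter> Z \<noteq> {}"
          by (rule irreducible_closed_meets[OF Z W(1) img]) (use W y z ze in auto)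
        then obtain t where t: "t \<in> topspace S" "e t \<in> W" "e t \<in> Z" by auto
        then have "t \<in> S closure_of {s}" using s by simp
        then have "\<And>V. t \<in> V \<Longrightarrow> openin S V \<Longrightarrow> s \<in> V" by (simp add: in_closure_of)
        from this[OF _ pre[OF W(1)]] show ?thesis using t by blast
      qed
      then show "y \<in> T closure_of {e s}" using y ZT by (auto simp: in_closure_of)
    qed
  qed
  moreover have "x = y"
    if x: "x \<in> topspace T" "T closure_of {x} = Z" and y: "y \<in> topspace T" "T closure_of {y} = Z" for x y
  proof -
    have xy: "x \<in> W \<longleftrightarrow> y \<in> W" if "openin T W" for W
    proof -
      have "x \<in> T closure_of {y}" "y \<in> T closure_of {x}"
        using x y by (metis closure_of_subset insert_subset empty_subsetI)+
      then show ?thesis using that by (auto simp: in_closure_of)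
    qed
    obtain S :: "'b topology" and e where S: "sober_space S" and oe: "open_map S T e"
      and ce: "continuous_map S T e" and ie: "inj_on e (topspace S)" and xe: "x \<in> e ` topspace S"
      using chart[OF x(1)] by blast
    have img: "openin T (e ` W)" if "openin S W" for W using oe that by (auto simp: open_map_def)
    have "y \<in> e ` topspace S" using xe xy[OF img[of "topspace S"]] by simp
    then obtain s t where st: "s \<in> topspace S" "e s = x" "t \<in> topspace S" "e t = y" using xe by blast
    have "s \<in> W \<longleftrightarrow> t \<in> W" if W: "openin S W" for W
    proof -
      have "W \<subseteq> topspace S" using W by (rule openin_subset)
      then have "s \<in> W \<longleftrightarrow> x \<in> e ` W" "t \<in> W \<longleftrightarrow> y \<in> e ` W"
        using ie st by (auto simp: inj_on_def)
      then show ?thesis using xy[OF img[OF W]] by simp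
    qed
    then have "S closure_of {s} = S closure_of {t}" by (auto simp: closure_of_def)
    then have "s = t"
      using S irreducible_closed_closure_of_singleton[OF st(1)] st(1,3) unfolding sober_space_def by metis
    then show ?thesis using st by simp
  qed
  moreover have "e s \<in> topspace T" using es ZT by blast
  ultimately show "\<exists>!x. x \<in> topspace T \<and> T closure_of {x} = Z" by blast
qed

section \<open>Spaces of congruences\<close>

lemma (in cring) ideal_criterion:
  assumes J: "J \<subseteq> carrier R" "J \<noteq> {}"
    and add: "\<And>a b. a \<in> J \<Longrightarrow> b \<in> J \<Longrightarrow> a \<oplus> b \<in> J"
    and mult: "\<And>a x. a \<in> J \<Longrightarrow> x \<in> carrier R \<Longrightarrow> x \<otimes> a \<in> J"
  shows "ideal J R"
proof (rule idealI[OF ring_axioms])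
  have neg: "\<ominus> a \<in> J" if "a \<in> J" for a
  proof -
    have "\<ominus> a = (\<ominus> \<one>) \<otimes> a" using that J by (auto simp: l_minus)
    then show ?thesis using mult[OF that, of "\<ominus> \<one>"] by simp
  qed
  show "subgroup J (add_monoid R)"
    by (rule group.subgroupI[OF a_group]) (use J add neg in \<open>auto simp: a_inv_def\<close>)
  show "a \<otimes> x \<in> J" if "a \<in> J" "x \<in> carrier R" for a x
    using mult[OF that] that J m_comm[of a x] by auto
qed (rule mult)

text \<open>Krull's theorem by Zorn's lemma. Comparability in a chain puts two summands into one
  common ideal, and properness survives unions because it is expressed by the absence of
  \<open>\<one>\<close>.\<close>

lemma (in cring) exists_maximalideal:
  assumes I: "ideal I R" and one: "\<one> \<notin> I"
  shows "\<exists>M. maximalideal M R \<and> I \<subseteq> M"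
proof -
  let ?A = "{J. ideal J R \<and> I \<subseteq> J \<and> \<one> \<notin> J}"
  have "\<exists>M \<in> ?A. \<forall>X \<in> ?A. M \<subseteq> X \<longrightarrow> X = M"
  proof (rule subset_Zorn_nonempty)
    show "?A \<noteq> {}" using assms by blast
    fix C assume C: "C \<noteq> {}" "subset.chain ?A C"
    then have CA: "\<And>J. J \<in> C \<Longrightarrow> ideal J R" "\<And>J. J \<in> C \<Longrightarrow> I \<subseteq> J" "\<And>J. J \<in> C \<Longrightarrow> \<one> \<notin> J"
      by (auto simp: subset.chain_def)
    have lin: "J \<subseteq> J' \<or> J' \<subseteq> J" if "J \<in> C" "J' \<in> C" for J J'
      using C(2) that by (auto simp: subset.chain_def)
    have "ideal (\<Union>C) R"
    proof (rule ideal_criterion)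
      show "\<Union>C \<subseteq> carrier R" using CA(1) ideal.Icarr by fast
      have "I \<noteq> {}" using additive_subgroup.zero_closed[OF ideal.axioms(1)[OF I]] by blast
      then show "\<Union>C \<noteq> {}" using C(1) CA(2) by blast
      show "a \<oplus> b \<in> \<Union>C" if ab: "a \<in> \<Union>C" "b \<in> \<Union>C" for a b
      proof -
        obtain J' J'' where "J' \<in> C" "J'' \<in> C" "a \<in> J'" "b \<in> J''" using ab by blast
        then obtain J where "J \<in> C" "a \<in> J" "b \<in> J" using lin[of J' J''] by blast
        then show ?thesis using additive_subgroup.a_closed[OF ideal.axioms(1)[OF CA(1)]] by blast
      qed
      show "x \<otimes> a \<in> \<Union>C" if "a \<in> \<Union>C" "x \<in> carrier R" for a x
        using that ideal.I_l_closed[OF CA(1)] by blast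
    qed
    then show "\<Union>C \<in> ?A" using C(1) CA by blast
  qed
  then obtain M where MA: "M \<in> ?A" and max: "\<forall>X \<in> ?A. M \<subseteq> X \<longrightarrow> X = M" by (rule bexE)
  then have M: "ideal M R" "I \<subseteq> M" "\<one> \<notin> M" by auto
  have "maximalideal M R"
  proof (rule maximalidealI[OF M(1)])
    show "carrier R \<noteq> M" using M(3) by blast
    show "J = M \<or> J = carrier R" if J: "ideal J R" "M \<subseteq> J" "J \<subseteq> carrier R" for J
    proof (cases "\<one> \<in> J")
      case False
      then have "J \<in> ?A" using J M(2) by auto
      then show ?thesis using max J(2) by blast
    qed (use ideal.one_imp_carrier[OF J(1)] in blast)
  qed
  then show ?thesis using M(2) by blast
qed

definition prod_ring :: "'i set \<Rightarrow> ('i \<Rightarrow> 'e ring) \<Rightarrow> ('i \<Rightarrow> 'e) ring" where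
  "prod_ring I K =
     \<lparr>carrier = (\<Pi>\<^sub>E i \<in> I. carrier (K i)),
      mult = (\<lambda>f g. \<lambda>i \<in> I. f i \<otimes>\<^bsub>K i\<^esub> g i),
      one = (\<lambda>i \<in> I. \<one>\<^bsub>K i\<^esub>),
      zero = (\<lambda>i \<in> I. \<zero>\<^bsub>K i\<^esub>),
      add = (\<lambda>f g. \<lambda>i \<in> I. f i \<oplus>\<^bsub>K i\<^esub> g i)\<rparr>"

lemma prod_ring_simps:
  "carrier (prod_ring I K) = (\<Pi>\<^sub>E i \<in> I. carrier (K i))"
  "f \<otimes>\<^bsub>prod_ring I K\<^esub> g = (\<lambda>i \<in> I. f i \<otimes>\<^bsub>K i\<^esub> g i)"
  "f \<oplus>\<^bsub>prod_ring I K\<^esub> g = (\<lambda>i \<in> I. f i \<oplus>\<^bsub>K i\<^esub> g i)"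
  "\<one>\<^bsub>prod_ring I K\<^esub> = (\<lambda>i \<in> I. \<one>\<^bsub>K i\<^esub>)"
  "\<zero>\<^bsub>prod_ring I K\<^esub> = (\<lambda>i \<in> I. \<zero>\<^bsub>K i\<^esub>)"
  by (simp_all add: prod_ring_def)

lemma cring_prod_ring:
  assumes K: "\<And>i. i \<in> I \<Longrightarrow> cring (K i)"
  shows "cring (prod_ring I K)"
proof (rule cringI)
  note [simp] = prod_ring_simps
  note R = cring.cring_simprules[OF K]
  show "abelian_group (prod_ring I K)"
  proof (rule abelian_groupI)
    fix f assume f: "f \<in> carrier (prod_ring I K)"
    then have "(\<lambda>i \<in> I. \<ominus>\<^bsub>K i\<^esub> f i) \<in> carrier (prod_ring I K)"
      and "(\<lambda>i \<in> I. \<ominus>\<^bsub>K i\<^esub> f i) \<oplus>\<^bsub>prod_ring I K\<^esub> f = \<zero>\<^bsub>prod_ring I K\<^esub>"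
      using R(3,9) by (auto intro!: restrict_ext simp: PiE_iff)
    then show "\<exists>g \<in> carrier (prod_ring I K). g \<oplus>\<^bsub>prod_ring I K\<^esub> f = \<zero>\<^bsub>prod_ring I K\<^esub>" by blast
  next
    fix f assume "f \<in> carrier (prod_ring I K)"
    then show "\<zero>\<^bsub>prod_ring I K\<^esub> \<oplus>\<^bsub>prod_ring I K\<^esub> f = f"
      using R(8) by (auto simp: PiE_iff fun_eq_iff extensional_def)
  qed (use R(1,2,7,10) in \<open>auto intro!: restrict_ext simp: PiE_iff\<close>)
  show "comm_monoid (prod_ring I K)"
  proof (rule comm_monoidI)
    fix f assume "f \<in> carrier (prod_ring I K)"
    then show "\<one>\<^bsub>prod_ring I K\<^esub> \<otimes>\<^bsub>prod_ring I K\<^esub> f = f"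
      using R(12) by (auto simp: PiE_iff fun_eq_iff extensional_def)
  qed (use R(5,6,11,14) in \<open>auto intro!: restrict_ext simp: PiE_iff\<close>)
qed (use cring.cring_simprules(13)[OF K] in \<open>auto intro!: restrict_ext simp: prod_ring_simps PiE_iff\<close>)

text \<open>A reduced product in which a maximal ideal takes the place of an ultrafilter.
  \<open>J\<close> consists of the families vanishing on a member of \<open>\<F>\<close>; it is
  closed under addition because \<open>\<F>\<close> is closed under intersection, and proper because
  no member is empty. Families that differ throughout some \<open>S\<close> in \<open>\<F>\<close>
  have a difference invertible modulo \<open>J\<close>, so no proper ideal above \<open>J\<close>
  identifies them.\<close>

lemma filter_product_field:
  fixes I :: "'i set" and K :: "'i \<Rightarrow> 'e ring"
  assumes K: "\<And>i. i \<in> I \<Longrightarrow> field (K i)"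
    and F: "\<F> \<noteq> {}" "{} \<notin> \<F>" "\<And>S. S \<in> \<F> \<Longrightarrow> S \<subseteq> I" "\<And>S T. S \<in> \<F> \<Longrightarrow> T \<in> \<F> \<Longrightarrow> S \<inter> T \<in> \<F>"
  obtains L :: "('i \<Rightarrow> 'e) set ring" and p where "field L" "p \<in> ring_hom (prod_ring I K) L"
    "\<forall>f \<in> carrier (prod_ring I K). \<forall>g \<in> carrier (prod_ring I K). \<forall>S \<in> \<F>.
       (\<forall>i \<in> S. f i \<noteq> g i) \<longrightarrow> p f \<noteq> p g"
proof -
  let ?R = "prod_ring I K"
  note [simp] = prod_ring_simps
  note fld = field.axioms(1)[OF K]
  have cK: "cring (K i)" if "i \<in> I" for i using fld[OF that] by (rule domain.axioms(1))
  interpret R: cring ?R by (rule cring_prod_ring[OF cK])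
  note K' = cring.cring_simprules[OF cK]
  define J where "J = {f \<in> carrier ?R. \<exists>S \<in> \<F>. \<forall>i \<in> S. f i = \<zero>\<^bsub>K i\<^esub>}"
  have J: "ideal J ?R"
  proof (rule R.ideal_criterion)
    show "J \<subseteq> carrier ?R" by (auto simp: J_def)
    obtain S where S: "S \<in> \<F>" using F(1) by blast
    then have "\<forall>i \<in> S. \<zero>\<^bsub>?R\<^esub> i = \<zero>\<^bsub>K i\<^esub>" using F(3)[OF S] by (simp add: subset_iff)
    then have "\<zero>\<^bsub>?R\<^esub> \<in> J" unfolding J_def using S R.zero_closed by blast
    then show "J \<noteq> {}" by blast
    fix f assume f: "f \<in> J"
    then obtain S where S: "S \<in> \<F>" "\<And>i. i \<in> S \<Longrightarrow> f i = \<zero>\<^bsub>K i\<^esub>" and fc: "f \<in> carrier ?R"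
      unfolding J_def by blast
    show "f \<oplus>\<^bsub>?R\<^esub> g \<in> J" if g: "g \<in> J" for g
    proof -
      obtain T where T: "T \<in> \<F>" "\<And>i. i \<in> T \<Longrightarrow> g i = \<zero>\<^bsub>K i\<^esub>" and gc: "g \<in> carrier ?R"
        using g unfolding J_def by blast
      have "(f \<oplus>\<^bsub>?R\<^esub> g) i = \<zero>\<^bsub>K i\<^esub>" if i: "i \<in> S \<inter> T" for i
      proof -
        have "i \<in> I" using i F(3)[OF S(1)] by blast
        then show ?thesis using S(2) T(2) i K'(2,8) by simp
      qed
      then show ?thesis using R.a_closed[OF fc gc] F(4)[OF S(1) T(1)] unfolding J_def by blast
    qed
    show "x \<otimes>\<^bsub>?R\<^esub> f \<in> J" if x: "x \<in> carrier ?R" for x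
    proof -
      have "(x \<otimes>\<^bsub>?R\<^esub> f) i = \<zero>\<^bsub>K i\<^esub>" if i: "i \<in> S" for i
      proof -
        have "i \<in> I" using i F(3)[OF S(1)] by blast
        then show ?thesis using S(2) i x K'(27) by (auto simp: PiE_iff)
      qed
      then show ?thesis using R.m_closed[OF x fc] S(1) unfolding J_def by blast
    qed
  qed
  have one: "\<one>\<^bsub>?R\<^esub> \<notin> J"
  proof
    assume "\<one>\<^bsub>?R\<^esub> \<in> J"
    then obtain S where S: "S \<in> \<F>" "\<And>i. i \<in> S \<Longrightarrow> \<one>\<^bsub>?R\<^esub> i = \<zero>\<^bsub>K i\<^esub>" unfolding J_def by blast
    obtain i where i: "i \<in> S" using S(1) F(2) by fastforce
    have iI: "i \<in> I" using i F(3)[OF S(1)] by blast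
    show False using S(2)[OF i] iI domain.one_not_zero[OF fld[OF iI]] by simp
  qed
  obtain M where M: "maximalideal M ?R" and JM: "J \<subseteq> M"
    using R.exists_maximalideal[OF J one] by blast
  have Mi: "ideal M ?R" using M by (rule maximalideal.axioms(1))
  show thesis
  proof (rule that[of "?R Quot M" "a_r_coset ?R M"])
    show "field (?R Quot M)" by (rule maximalideal.quotient_is_field[OF M R.is_cring])
    show "a_r_coset ?R M \<in> ring_hom ?R (?R Quot M)" by (rule ideal.rcos_ring_hom[OF Mi])
    have "M +>\<^bsub>?R\<^esub> f \<noteq> M +>\<^bsub>?R\<^esub> g" if fg: "f \<in> carrier ?R" "g \<in> carrier ?R" and S: "S \<in> \<F>"
      and ne: "\<forall>i \<in> S. f i \<noteq> g i" for f g S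
    proof
      assume eq: "M +>\<^bsub>?R\<^esub> f = M +>\<^bsub>?R\<^esub> g"
      define d where "d = f \<ominus>\<^bsub>?R\<^esub> g"
      have d: "d \<in> M" using R.quotient_eq_iff_same_a_r_cos[OF Mi fg] eq by (simp add: d_def)
      have dc: "d \<in> carrier ?R" using fg by (simp only: d_def R.minus_closed)
      \<comment> \<open>An inverse of \<open>d\<close> on \<open>S\<close>; elsewhere the value zero
        merely keeps \<open>v\<close> in the product. Thus the product of \<open>v\<close> and
        \<open>d\<close> is one on \<open>S\<close>, and the difference \<open>e\<close> between one
        and this product lies in \<open>J\<close>.\<close>
      define v where "v = (\<lambda>i \<in> I. if i \<in> S then inv\<^bsub>K i\<^esub> (d i) else \<zero>\<^bsub>K i\<^esub>)"
      have vd: "v i \<in> carrier (K i) \<and> (i \<in> S \<longrightarrow> v i \<otimes>\<^bsub>K i\<^esub> d i = \<one>\<^bsub>K i\<^esub>)" if i: "i \<in> I" for i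
      proof (cases "i \<in> S")
        case True
        interpret Ki: field "K i" by (rule K[OF i])
        have fi: "f i \<in> carrier (K i)" "g i \<in> carrier (K i)" "d i \<in> carrier (K i)"
          using fg dc i by (auto simp: PiE_iff)
        \<comment> \<open>Components of a difference are reached through the sum, for which a
          componentwise formula is available.\<close>
        have "f = d \<oplus>\<^bsub>?R\<^esub> g" unfolding d_def using fg
          by (metis R.minus_eq R.a_assoc R.a_inv_closed R.l_neg R.r_zero)
        then have "f i = d i \<oplus>\<^bsub>K i\<^esub> g i" using i by simp
        then have "d i \<noteq> \<zero>\<^bsub>K i\<^esub>" using ne True fi by auto
        then have "d i \<in> Units (K i)" using fi Ki.field_Units by blast
        then show ?thesis using True i by (simp add: v_def)
      next
        case False
        then show ?thesis using i K'(2)[OF i] by (simp add: v_def)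
      qed
      have vc: "v \<in> carrier ?R" using vd by (auto simp: v_def)
      define e where "e = \<one>\<^bsub>?R\<^esub> \<ominus>\<^bsub>?R\<^esub> v \<otimes>\<^bsub>?R\<^esub> d"
      have ec: "e \<in> carrier ?R" unfolding e_def by (intro R.minus_closed R.one_closed R.m_closed vc dc)
      have sum: "e \<oplus>\<^bsub>?R\<^esub> v \<otimes>\<^bsub>?R\<^esub> d = \<one>\<^bsub>?R\<^esub>"
        unfolding e_def using R.m_closed[OF vc dc] R.one_closed
        by (metis R.minus_eq R.a_assoc R.a_inv_closed R.l_neg R.r_zero)
      have "e i = \<zero>\<^bsub>K i\<^esub>" if i: "i \<in> S" for i
      proof -
        have iI: "i \<in> I" using i F(3)[OF S] by blast
        interpret Ki: field "K i" by (rule K[OF iI])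
        have ei: "e i \<in> carrier (K i)" using ec iI by (auto simp: PiE_iff)
        have "e i \<oplus>\<^bsub>K i\<^esub> \<one>\<^bsub>K i\<^esub> = \<one>\<^bsub>K i\<^esub>"
          using fun_cong[OF sum, of i] vd[OF iI] i iI by simp
        then show ?thesis using ei by (metis Ki.add.l_cancel_one' Ki.a_comm Ki.one_closed)
      qed
      then have "e \<in> M" using ec S JM unfolding J_def by blast
      moreover have "v \<otimes>\<^bsub>?R\<^esub> d \<in> M" by (rule ideal.I_l_closed[OF Mi d vc])
      ultimately have "\<one>\<^bsub>?R\<^esub> \<in> M"
        using additive_subgroup.a_closed[OF ideal.axioms(1)[OF Mi]] sum by metis
      then show False using maximalideal.I_notcarr[OF M] ideal.one_imp_carrier[OF Mi] by blast
    qed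
    then show "\<forall>f \<in> carrier ?R. \<forall>g \<in> carrier ?R. \<forall>S \<in> \<F>.
       (\<forall>i \<in> S. f i \<noteq> g i) \<longrightarrow> M +>\<^bsub>?R\<^esub> f \<noteq> M +>\<^bsub>?R\<^esub> g" by blast
  qed
qed


section \<open>Congruences as kernels of homomorphisms into fields\<close>

text \<open>The kernel of \<open>g\<close>. By \<open>k_congruenceE\<close> all
  \<open>k\<close>-congruences arise so from maps into fields, which lets properties such as
  cancellation be checked inside a field.\<close>

definition hom_congruence :: "'a pmonoid \<Rightarrow> ('a \<Rightarrow> 'b) \<Rightarrow> ('a \<times> 'a) set" where
  "hom_congruence A g = {(a, b). a \<in> carrier A \<and> b \<in> carrier A \<and> g a = g b}"

lemma quot_pm_mult:
  assumes A: "pointed_monoid A" and c: "congruence A c" and ab: "a \<in> carrier A" "b \<in> carrier A"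
  shows "c `` {a} \<otimes>\<^bsub>quot_pm A c\<^esub> c `` {b} = c `` {a \<otimes>\<^bsub>A\<^esub> b}"
proof -
  interpret pointed_monoid A by fact
  have e: "equiv (carrier A) c" and m: "\<And>x y l. (x, y) \<in> c \<Longrightarrow> l \<in> carrier A \<Longrightarrow> (l \<otimes>\<^bsub>A\<^esub> x, l \<otimes>\<^bsub>A\<^esub> y) \<in> c"
    using c by (auto simp: congruence_def)
  have *: "c `` {x \<otimes>\<^bsub>A\<^esub> y} = c `` {a \<otimes>\<^bsub>A\<^esub> b}" if "(a, x) \<in> c" "(b, y) \<in> c" for x y
  proof -
    have xy: "x \<in> carrier A" "y \<in> carrier A" using that e by (auto dest: equivE simp: equiv_def)
    have "(b \<otimes>\<^bsub>A\<^esub> a, b \<otimes>\<^bsub>A\<^esub> x) \<in> c" "(x \<otimes>\<^bsub>A\<^esub> b, x \<otimes>\<^bsub>A\<^esub> y) \<in> c" using m that ab xy by auto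
    then have "(a \<otimes>\<^bsub>A\<^esub> b, x \<otimes>\<^bsub>A\<^esub> y) \<in> c"
      using e ab xy m_comm[of b a] m_comm[of b x] by (metis equivE transD)
    then show ?thesis using e equiv_class_eq by metis
  qed
  have "(a, a) \<in> c" "(b, b) \<in> c" using e ab by (auto simp: equiv_def refl_on_def)
  then have ne: "c `` {a} \<noteq> {}" "c `` {b} \<noteq> {}" by blast+
  have "(\<Union>x \<in> c `` {a}. \<Union>y \<in> c `` {b}. c `` {x \<otimes>\<^bsub>A\<^esub> y}) =
      (\<Union>x \<in> c `` {a}. \<Union>y \<in> c `` {b}. c `` {a \<otimes>\<^bsub>A\<^esub> b})"
    by (intro SUP_cong refl *) auto
  then show ?thesis using ne by (simp add: quot_pm_def)
qed

text \<open>The element type of \<open>K\<close> is forced: \<open>pm_domain\<close> codes fields by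
  lists of lists over the carrier type, and classes of the quotient have type \<open>'a set\<close>.
  The quotient map followed by the embedding has kernel \<open>c\<close>.\<close>

lemma k_congruenceE:
  assumes A: "pointed_monoid A" and c: "k_congruence k A \<phi> c"
  obtains K :: "'a set list list ring" and g where "field K" "g \<in> pm_hom (A :: 'a pmonoid) (mult_pm K)"
    "c = hom_congruence A g"
proof -
  interpret pointed_monoid A by fact
  have cc: "congruence A c" and "pm_domain (quot_pm A c)" using c by (auto simp: k_congruence_def)
  then obtain K :: "'a set list list ring" and S f where K: "field K" "pm_submonoid S (mult_pm K)"
    and f: "f \<in> pm_iso (quot_pm A c) ((mult_pm K)\<lparr>carrier := S\<rparr>)"
    unfolding pm_domain_def by blast
  have e: "equiv (carrier A) c" using cc by (simp add: congruence_def)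
  have S: "S \<subseteq> carrier K" using K(2) by (simp add: pm_submonoid_def submonoid_def mult_pm_def)
  have q: "c `` {a} \<in> carrier (quot_pm A c)" if "a \<in> carrier A" for a
    using that by (simp add: quot_pm_def quotientI)
  have inj: "inj_on f (carrier (quot_pm A c))" and fS: "\<And>x. x \<in> carrier (quot_pm A c) \<Longrightarrow> f x \<in> S"
    and fm: "\<And>x y. x \<in> carrier (quot_pm A c) \<Longrightarrow> y \<in> carrier (quot_pm A c) \<Longrightarrow>
      f (x \<otimes>\<^bsub>quot_pm A c\<^esub> y) = f x \<otimes>\<^bsub>K\<^esub> f y"
    and f1: "f (c `` {\<one>\<^bsub>A\<^esub>}) = \<one>\<^bsub>K\<^esub>" and f0: "f (c `` {pzero A}) = \<zero>\<^bsub>K\<^esub>"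
    using f by (auto simp: pm_iso_def pm_hom_def hom_def bij_betw_def mult_pm_def quot_pm_def)
  let ?g = "\<lambda>a. f (c `` {a})"
  have "?g (a \<otimes>\<^bsub>A\<^esub> b) = ?g a \<otimes>\<^bsub>K\<^esub> ?g b" if "a \<in> carrier A" "b \<in> carrier A" for a b
    using fm[OF q q] quot_pm_mult[OF A cc] that by simp
  then have "?g \<in> pm_hom A (mult_pm K)"
    using fS[OF q] S f1 f0 by (auto simp: pm_hom_def hom_def mult_pm_def)
  moreover have "c = hom_congruence A ?g"
  proof -
    have "(a, b) \<in> c \<longleftrightarrow> a \<in> carrier A \<and> b \<in> carrier A \<and> ?g a = ?g b" for a b
      using equiv_class_eq_iff[OF e] inj_onD[OF inj _ q q, of a b] by metis
    then show ?thesis by (auto simp: hom_congruence_def)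
  qed
  ultimately show thesis using that K(1) by blast
qed

text \<open>Converse to \<open>k_congruenceE\<close> for a field of arbitrary element type, such as
  a quotient of a product; \<open>pm_domainI\<close> supplies the recoding into the type demanded by
  \<open>pm_domain\<close>.\<close>

lemma k_congruence_hom_congruence:
  fixes K :: "'f ring"
  assumes A: "pointed_monoid A" and K: "field K" and g: "g \<in> pm_hom A (mult_pm K)"
    and inj: "inj_on (\<lambda>l. g (\<phi> l)) (carrier k)" and \<phi>: "\<phi> \<in> carrier k \<rightarrow> carrier A"
  shows "k_congruence k A \<phi> (hom_congruence A g)"
proof -
  interpret pointed_monoid A by fact
  let ?c = "hom_congruence A g"
  have gK: "\<And>a. a \<in> carrier A \<Longrightarrow> g a \<in> carrier K"
    and gm: "\<And>a b. a \<in> carrier A \<Longrightarrow> b \<in> carrier A \<Longrightarrow> g (a \<otimes>\<^bsub>A\<^esub> b) = g a \<otimes>\<^bsub>K\<^esub> g b"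
    and g1: "g \<one>\<^bsub>A\<^esub> = \<one>\<^bsub>K\<^esub>" and g0: "g (pzero A) = \<zero>\<^bsub>K\<^esub>"
    using g by (auto simp: pm_hom_def hom_def mult_pm_def)
  have e: "equiv (carrier A) ?c"
    by (rule equivI) (auto simp: hom_congruence_def refl_on_def sym_def trans_def)
  have c: "congruence A ?c" unfolding congruence_def using e gm by (auto simp: hom_congruence_def)
  have cls: "?c `` {a} = ?c `` {b} \<longleftrightarrow> g a = g b" if "a \<in> carrier A" "b \<in> carrier A" for a b
    using eq_equiv_class_iff[OF e that] that by (simp add: hom_congruence_def)
  let ?Q = "quot_pm A ?c"
  have memE: "\<exists>a \<in> carrier A. x = ?c `` {a}" if "x \<in> carrier ?Q" for x
    using that by (auto simp: quot_pm_def quotient_def)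
  have mem: "?c `` {a} \<in> carrier ?Q" if "a \<in> carrier A" for a
    using that by (simp add: quot_pm_def quotientI)
  have one: "\<one>\<^bsub>?Q\<^esub> = ?c `` {\<one>\<^bsub>A\<^esub>}" and zero: "pzero ?Q = ?c `` {pzero A}"
    by (simp_all add: quot_pm_def)
  note mult = quot_pm_mult[OF A c]
  have Q: "pointed_monoid ?Q"
  proof (rule pointed_monoid.intro)
    show "comm_monoid ?Q"
    proof (rule comm_monoidI)
      fix x y assume "x \<in> carrier ?Q" "y \<in> carrier ?Q"
      then obtain a b where ab: "a \<in> carrier A" "b \<in> carrier A" "x = ?c `` {a}" "y = ?c `` {b}"
        using memE by blast
      show "x \<otimes>\<^bsub>?Q\<^esub> y \<in> carrier ?Q" using ab by (simp add: mult mem)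
      show "x \<otimes>\<^bsub>?Q\<^esub> y = y \<otimes>\<^bsub>?Q\<^esub> x" using ab by (simp add: mult m_comm)
      show "x \<otimes>\<^bsub>?Q\<^esub> y \<otimes>\<^bsub>?Q\<^esub> z = x \<otimes>\<^bsub>?Q\<^esub> (y \<otimes>\<^bsub>?Q\<^esub> z)" if "z \<in> carrier ?Q" for z
        using memE[OF that] ab by (auto simp: mult m_assoc)
    next
      show "\<one>\<^bsub>?Q\<^esub> \<in> carrier ?Q" by (simp add: one mem)
      show "\<one>\<^bsub>?Q\<^esub> \<otimes>\<^bsub>?Q\<^esub> x = x" if "x \<in> carrier ?Q" for x
        using memE[OF that] by (auto simp: one mult)
    qed
    show "pointed_monoid_axioms ?Q"
    proof
      show "pzero ?Q \<in> carrier ?Q" by (simp add: zero mem)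
      show "pzero ?Q \<otimes>\<^bsub>?Q\<^esub> x = pzero ?Q" if "x \<in> carrier ?Q" for x
        using memE[OF that] by (auto simp: zero mult)
    qed
  qed
  \<comment> \<open>The factorization of \<open>g\<close> through the quotient, evaluated at a
    chosen representative; \<open>g\<close> is constant on classes.\<close>
  define h where "h x = g (SOME a. a \<in> x)" for x
  have h: "h (?c `` {a}) = g a" if "a \<in> carrier A" for a
  proof -
    have "a \<in> ?c `` {a}" using that by (simp add: hom_congruence_def)
    then have "(SOME b. b \<in> ?c `` {a}) \<in> ?c `` {a}" by (rule someI)
    moreover have "g b = g a" if "b \<in> ?c `` {a}" for b using that by (simp add: hom_congruence_def)
    ultimately show ?thesis unfolding h_def by blast
  qed
  have "h x \<in> carrier K" if "x \<in> carrier ?Q" for x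
    using memE[OF that] h gK by auto
  moreover have "h (x \<otimes>\<^bsub>?Q\<^esub> y) = h x \<otimes>\<^bsub>K\<^esub> h y" if "x \<in> carrier ?Q" "y \<in> carrier ?Q" for x y
    using memE[OF that(1)] memE[OF that(2)] by (auto simp: mult h gm)
  moreover have "h \<one>\<^bsub>?Q\<^esub> = \<one>\<^bsub>K\<^esub>" "h (pzero ?Q) = \<zero>\<^bsub>K\<^esub>" by (simp_all add: one zero h g1 g0)
  ultimately have "h \<in> pm_hom ?Q (mult_pm K)" by (auto simp: pm_hom_def hom_def mult_pm_def)
  moreover have "inj_on h (carrier ?Q)"
  proof (rule inj_onI)
    fix x y assume "x \<in> carrier ?Q" "y \<in> carrier ?Q" and eq: "h x = h y"
    then obtain a b where "a \<in> carrier A" "b \<in> carrier A" "x = ?c `` {a}" "y = ?c `` {b}"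
      using memE by blast
    then show "x = y" using eq h cls by metis
  qed
  ultimately have "pm_domain ?Q" by (rule pm_domainI[OF Q K])
  moreover have "inj_on (\<lambda>l. ?c `` {\<phi> l}) (carrier k)"
    using inj cls \<phi> by (auto simp: inj_on_def Pi_iff)
  ultimately show ?thesis using c by (simp add: k_congruence_def)
qed

section \<open>Topology and sobriety of the congruence space\<close>

text \<open>The empty set is absorbed as the empty union. Openness is kept in the inductive cases,
  since images of intersections under an injective map require the sets to lie in the space.\<close>

lemma openin_scong_induct [consumes 1, case_names all sub Int Un]:
  assumes "openin (scong k A \<phi>) W"
    and "P {c. k_congruence k A \<phi> c}"
    and "\<And>a b. a \<in> carrier A \<Longrightarrow> b \<in> carrier A \<Longrightarrow> P {c. k_congruence k A \<phi> c \<and> (a, b) \<notin> c}"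
    and "\<And>V W. openin (scong k A \<phi>) V \<Longrightarrow> openin (scong k A \<phi>) W \<Longrightarrow> P V \<Longrightarrow> P W \<Longrightarrow> P (V \<inter> W)"
    and "\<And>\<W>. (\<And>W. W \<in> \<W> \<Longrightarrow> openin (scong k A \<phi>) W \<and> P W) \<Longrightarrow> P (\<Union>\<W>)"
  shows "P W"
proof -
  let ?B = "insert {c. k_congruence k A \<phi> c}
        {{c. k_congruence k A \<phi> c \<and> (a, b) \<notin> c} | a b. a \<in> carrier A \<and> b \<in> carrier A}"
  have o: "openin (scong k A \<phi>) V \<longleftrightarrow> generate_topology_on ?B V" for V
    by (simp add: scong_def openin_topology_generated_by_iff)
  have "generate_topology_on ?B W" using assms(1) o by simp
  then show ?thesis
  proof induction
    case Empty
    then show ?case using assms(5)[of "{}"] by simp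
  next
    case (Int V W)
    then show ?case using assms(4) o by simp
  next
    case (UN \<W>)
    then show ?case using assms(5) o by simp
  next
    case (Basis V)
    then show ?case using assms(2,3) by blast
  qed
qed

lemma openin_scong_sub:
  "a \<in> carrier A \<Longrightarrow> b \<in> carrier A \<Longrightarrow> openin (scong k A \<phi>) {c. k_congruence k A \<phi> c \<and> (a, b) \<notin> c}"
  unfolding scong_def by (rule topology_generated_by_Basis) blast

lemma k_congruence_subset: "k_congruence k A \<phi> c \<Longrightarrow> c \<subseteq> carrier A \<times> carrier A"
  by (auto simp: k_congruence_def congruence_def equiv_def)

text \<open>Absence of a pair passes to smaller congruences, so every neighbourhood of a larger
  \<open>d\<close> contains \<open>c\<close>; conversely a pair in \<open>c\<close> but not in
  \<open>d\<close> gives a subbasic neighbourhood of \<open>d\<close> that misses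
  \<open>c\<close>.\<close>

lemma closure_of_scong:
  assumes c: "k_congruence k A \<phi> c"
  shows "scong k A \<phi> closure_of {c} = {d. k_congruence k A \<phi> d \<and> c \<subseteq> d}"
proof -
  have "c \<in> W" if "k_congruence k A \<phi> d" "c \<subseteq> d" "openin (scong k A \<phi>) W" "d \<in> W" for W d
    using that(3,4) by (induction rule: openin_scong_induct) (use c that(1,2) in blast)+
  moreover have "c \<subseteq> d" if "\<And>W. openin (scong k A \<phi>) W \<Longrightarrow> d \<in> W \<Longrightarrow> c \<in> W" "k_congruence k A \<phi> d" for d
  proof (rule subrelI)
    fix a b assume ab: "(a, b) \<in> c"
    then have "a \<in> carrier A" "b \<in> carrier A" using k_congruence_subset[OF c] by auto
    from that(1)[OF openin_scong_sub[OF this]] show "(a, b) \<in> d" using ab that(2) by blast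
  qed
  ultimately show ?thesis unfolding closure_of_def topspace_scong by blast
qed

text \<open>The fields behind the members of \<open>Z\<close> are combined by
  \<open>filter_product_field\<close> over the nonempty open traces on \<open>Z\<close>. Pairs in
  the intersection have equal images in the product itself; a pair outside it has images that differ
  at all points of the trace of one subbasic set.\<close>

lemma k_congruence_Inter:
  assumes A: "pointed_monoid A" and \<phi>: "\<phi> \<in> carrier k \<rightarrow> carrier A"
    and Z: "irreducible_closed (scong k A \<phi>) Z"
  shows "k_congruence k A \<phi> (\<Inter>Z)"
proof -
  interpret pointed_monoid A by fact
  have "Z \<subseteq> topspace (scong k A \<phi>)" and Zne: "Z \<noteq> {}"
    using Z by (auto simp: irreducible_closed_def dest: closedin_subset)
  then have Zk: "k_congruence k A \<phi> c" if "c \<in> Z" for c using that by (auto simp: topspace_scong)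
  have "\<exists>(K :: 'a set list list ring) g. field K \<and> g \<in> pm_hom A (mult_pm K) \<and> c = hom_congruence A g"
    if "c \<in> Z" for c using k_congruenceE[OF A Zk[OF that]] by blast
  then obtain K :: "_ \<Rightarrow> 'a set list list ring" and g where K: "\<And>c. c \<in> Z \<Longrightarrow> field (K c)"
    and g: "\<And>c. c \<in> Z \<Longrightarrow> g c \<in> pm_hom A (mult_pm (K c))"
    and c: "\<And>c. c \<in> Z \<Longrightarrow> c = hom_congruence A (g c)" by metis
  let ?F = "{W \<inter> Z | W. openin (scong k A \<phi>) W \<and> W \<inter> Z \<noteq> {}}" and ?R = "prod_ring Z K"
  have F1: "?F \<noteq> {}" using Zne \<open>Z \<subseteq> _\<close> by blast
  have F2: "{} \<notin> ?F" and F3: "\<And>S. S \<in> ?F \<Longrightarrow> S \<subseteq> Z" by auto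
  have F4: "S \<inter> T \<in> ?F" if ST: "S \<in> ?F" "T \<in> ?F" for S T
  proof -
    obtain V W where VW: "S = V \<inter> Z" "openin (scong k A \<phi>) V" "V \<inter> Z \<noteq> {}"
      "T = W \<inter> Z" "openin (scong k A \<phi>) W" "W \<inter> Z \<noteq> {}"
      using ST(1)[THEN CollectD] ST(2)[THEN CollectD] by (elim exE conjE) simp
    have "V \<inter> W \<inter> Z \<noteq> {}" by (rule irreducible_closed_meets[OF Z VW(2,5,3,6)])
    moreover have "S \<inter> T = V \<inter> W \<inter> Z" unfolding VW(1,4) by blast
    ultimately show ?thesis using openin_Int[OF VW(2,5)] by blast
  qed
  obtain L :: "(('a \<times> 'a) set \<Rightarrow> 'a set list list) set ring" and p where L: "field L" "p \<in> ring_hom ?R L"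
    and sep: "\<forall>x \<in> carrier ?R. \<forall>y \<in> carrier ?R. \<forall>S \<in> ?F. (\<forall>c \<in> S. x c \<noteq> y c) \<longrightarrow> p x \<noteq> p y"
    by (rule filter_product_field[of Z K ?F, OF K F1 F2 F3 F4])
  define G where "G a = (\<lambda>c \<in> Z. g c a)" for a
  have gh: "a \<in> carrier A \<Longrightarrow> g c a \<in> carrier (K c)"
    "a \<in> carrier A \<Longrightarrow> b \<in> carrier A \<Longrightarrow> g c (a \<otimes>\<^bsub>A\<^esub> b) = g c a \<otimes>\<^bsub>K c\<^esub> g c b"
    "g c \<one>\<^bsub>A\<^esub> = \<one>\<^bsub>K c\<^esub>" "g c (pzero A) = \<zero>\<^bsub>K c\<^esub>" if "c \<in> Z" for a b c
    using g[OF that] by (auto simp: pm_hom_def hom_def mult_pm_def)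
  have G: "a \<in> carrier A \<Longrightarrow> G a \<in> carrier ?R"
    "a \<in> carrier A \<Longrightarrow> b \<in> carrier A \<Longrightarrow> G (a \<otimes>\<^bsub>A\<^esub> b) = G a \<otimes>\<^bsub>?R\<^esub> G b"
    "G \<one>\<^bsub>A\<^esub> = \<one>\<^bsub>?R\<^esub>" "G (pzero A) = \<zero>\<^bsub>?R\<^esub>" for a b
    unfolding G_def prod_ring_simps using gh by (auto intro!: restrict_ext)
  interpret R: cring ?R
    by (rule cring_prod_ring) (use K in \<open>blast intro: domain.axioms(1) field.axioms(1)\<close>)
  interpret L: field L by fact
  have hom: "(\<lambda>a. p (G a)) \<in> pm_hom A (mult_pm L)"
    using ring_hom_memE[OF L(2)] G ring_hom_zero[OF L(2) R.ring_axioms L.ring_axioms]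
    by (auto simp: pm_hom_def hom_def mult_pm_def)
  have ker: "\<Inter>Z = hom_congruence A (\<lambda>a. p (G a))"
  proof -
    have "p (G a) \<noteq> p (G b)" if ab: "a \<in> carrier A" "b \<in> carrier A" "c0 \<in> Z" "(a, b) \<notin> c0" for a b c0
    proof (rule sep[rule_format, OF G(1) G(1)])
      show "{c. k_congruence k A \<phi> c \<and> (a, b) \<notin> c} \<inter> Z \<in> ?F"
      proof -
        have "c0 \<in> {c. k_congruence k A \<phi> c \<and> (a, b) \<notin> c}" using ab Zk by simp
        then have "{c. k_congruence k A \<phi> c \<and> (a, b) \<notin> c} \<inter> Z \<noteq> {}" using ab(3) by blast
        then show ?thesis
          by (intro CollectI exI[of _ "{c. k_congruence k A \<phi> c \<and> (a, b) \<notin> c}"])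
            (simp only: openin_scong_sub[OF ab(1,2)] simp_thms)
      qed
      show "G a d \<noteq> G b d" if "d \<in> {c. k_congruence k A \<phi> c \<and> (a, b) \<notin> c} \<inter> Z" for d
      proof -
        have d: "d \<in> Z" "(a, b) \<notin> d" using that by blast+
        then have "g d a \<noteq> g d b" using c[OF d(1)] ab(1,2) unfolding hom_congruence_def by blast
        then show ?thesis using d(1) by (simp add: G_def)
      qed
    qed (use ab in auto)
    moreover have "G a = G b" if "(a, b) \<in> \<Inter>Z" for a b
      unfolding G_def by (rule restrict_ext) (use that c in \<open>unfold hom_congruence_def, blast\<close>)
    moreover have "a \<in> carrier A \<and> b \<in> carrier A" if "(a, b) \<in> \<Inter>Z" for a b
      using that Zne k_congruence_subset[OF Zk] by blast
    ultimately show ?thesis by (auto simp: hom_congruence_def)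
  qed
  show ?thesis unfolding ker
  proof (rule k_congruence_hom_congruence[OF A L(1) hom _ \<phi>], rule inj_onI)
    fix l l' assume l: "l \<in> carrier k" "l' \<in> carrier k" and eq: "p (G (\<phi> l)) = p (G (\<phi> l'))"
    \<comment> \<open>One member of \<open>Z\<close> suffices: its injectivity on \<open>k\<close>
      passes to the smaller relation.\<close>
    obtain d where d: "d \<in> Z" using Zne by blast
    have "(\<phi> l, \<phi> l') \<in> \<Inter>Z" unfolding ker using l eq \<phi> by (auto simp: hom_congruence_def)
    then have "(\<phi> l, \<phi> l') \<in> d" using d by blast
    moreover have "equiv (carrier A) d" "inj_on (\<lambda>l. d `` {\<phi> l}) (carrier k)"
      using Zk[OF d] by (auto simp: k_congruence_def congruence_def)
    ultimately show "l = l'" using l by (metis equiv_class_eq inj_onD)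
  qed
qed

text \<open>The intersection of \<open>Z\<close> adheres to \<open>Z\<close>, so it lies in the
  closed set \<open>Z\<close> and, closures being sets of larger congruences, generates it. The same
  description of closures gives uniqueness by antisymmetry.\<close>

lemma sober_scong:
  assumes A: "pointed_monoid A" and \<phi>: "\<phi> \<in> carrier k \<rightarrow> carrier A"
  shows "sober_space (scong k A \<phi>)"
  unfolding sober_space_def
proof (intro allI impI)
  fix Z assume Z: "irreducible_closed (scong k A \<phi>) Z"
  let ?T = "scong k A \<phi>"
  have Zc: "closedin ?T Z" and Zne: "Z \<noteq> {}" using Z by (auto simp: irreducible_closed_def)
  have ZT: "Z \<subseteq> {c. k_congruence k A \<phi> c}" using closedin_subset[OF Zc] by (simp add: topspace_scong)
  have k: "k_congruence k A \<phi> (\<Inter>Z)" by (rule k_congruence_Inter[OF A \<phi> Z])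
  \<comment> \<open>A subbasic set containing \<open>\<Inter>Z\<close> omits a pair that some member
    of \<open>Z\<close> already omits; irreducibility enters at binary intersections.\<close>
  have meets: "\<Inter>Z \<in> W \<longrightarrow> W \<inter> Z \<noteq> {}" if "openin ?T W" for W
    using that
  proof (induction rule: openin_scong_induct)
    case (Int V W)
    then show ?case using irreducible_closed_meets[OF Z, of V W] by blast
  qed (use Zne ZT in blast)+
  have "\<Inter>Z \<in> Z"
  proof (rule ccontr)
    assume "\<Inter>Z \<notin> Z"
    moreover have "openin ?T (topspace ?T - Z)" using Zc by blast
    ultimately show False using meets[of "topspace ?T - Z"] k by (auto simp: topspace_scong)
  qed
  then have "?T closure_of {\<Inter>Z} \<subseteq> Z" using Zc by (simp add: closure_of_minimal)
  moreover have "Z \<subseteq> ?T closure_of {\<Inter>Z}" unfolding closure_of_scong[OF k] using ZT by blast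
  moreover have "c = d" if "k_congruence k A \<phi> c" "k_congruence k A \<phi> d" "?T closure_of {c} = ?T closure_of {d}" for c d
    using that unfolding closure_of_scong[OF that(1)] closure_of_scong[OF that(2)] by blast
  ultimately show "\<exists>!x. x \<in> topspace ?T \<and> ?T closure_of {x} = Z"
    using k by (intro ex1I[of _ "\<Inter>Z"]) (auto simp: topspace_scong)
qed

section \<open>Congruences and localization\<close>

lemma pm_homD:
  assumes "f \<in> pm_hom A B"
  shows "a \<in> carrier A \<Longrightarrow> f a \<in> carrier B"
    "a \<in> carrier A \<Longrightarrow> b \<in> carrier A \<Longrightarrow> f (a \<otimes>\<^bsub>A\<^esub> b) = f a \<otimes>\<^bsub>B\<^esub> f b"
    "f \<one>\<^bsub>A\<^esub> = \<one>\<^bsub>B\<^esub>" "f (pzero A) = pzero B"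
  using assms by (auto simp: pm_hom_def hom_def)

lemma pm_homI:
  assumes "\<And>a. a \<in> carrier A \<Longrightarrow> f a \<in> carrier B"
    "\<And>a b. a \<in> carrier A \<Longrightarrow> b \<in> carrier A \<Longrightarrow> f (a \<otimes>\<^bsub>A\<^esub> b) = f a \<otimes>\<^bsub>B\<^esub> f b"
    "f \<one>\<^bsub>A\<^esub> = \<one>\<^bsub>B\<^esub>" "f (pzero A) = pzero B"
  shows "f \<in> pm_hom A B"
  using assms by (auto simp: pm_hom_def hom_def)

lemma pm_hom_pow:
  assumes A: "pointed_monoid A" and B: "pointed_monoid B" and f: "f \<in> pm_hom A B" and a: "a \<in> carrier A"
  shows "f (a [^]\<^bsub>A\<^esub> (n :: nat)) = f a [^]\<^bsub>B\<^esub> n"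
proof -
  interpret A: pointed_monoid A by fact
  interpret B: pointed_monoid B by fact
  show ?thesis using a pm_homD[OF f] by (induction n) auto
qed

lemma mult_pm_simps [simp]:
  "carrier (mult_pm K) = carrier K" "a \<otimes>\<^bsub>mult_pm K\<^esub> b = a \<otimes>\<^bsub>K\<^esub> b"
  "\<one>\<^bsub>mult_pm K\<^esub> = \<one>\<^bsub>K\<^esub>" "pzero (mult_pm K) = \<zero>\<^bsub>K\<^esub>"
  by (simp_all add: mult_pm_def)

context pointed_monoid
begin

lemma k_congruence_refl: "k_congruence k A \<phi> c \<Longrightarrow> a \<in> carrier A \<Longrightarrow> (a, a) \<in> c"
  by (auto simp: k_congruence_def congruence_def equiv_def refl_on_def)

lemma k_congruence_inj:
  assumes "k_congruence k A \<phi> c" "l \<in> carrier k" "l' \<in> carrier k" "(\<phi> l, \<phi> l') \<in> c"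
  shows "l = l'"
proof -
  have "equiv (carrier A) c" "inj_on (\<lambda>l. c `` {\<phi> l}) (carrier k)"
    using assms(1) by (auto simp: k_congruence_def congruence_def)
  then show ?thesis using assms(2-4) by (metis equiv_class_eq inj_onD)
qed

lemma k_congruence_one:
  assumes c: "k_congruence k A \<phi> c"
  shows "(\<one>, pzero A) \<notin> c"
proof -
  obtain K :: "'a set list list ring" and g where K: "field K" and g: "g \<in> pm_hom A (mult_pm K)"
    and eq: "c = hom_congruence A g" using k_congruenceE[OF pointed_monoid_axioms c] .
  interpret K: field K by fact
  show ?thesis using pm_homD(3,4)[OF g] by (simp add: eq hom_congruence_def)
qed

lemma k_congruence_mult_zero_iff:
  assumes c: "k_congruence k A \<phi> c" and ab: "a \<in> carrier A" "b \<in> carrier A"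
  shows "(a \<otimes> b, pzero A) \<in> c \<longleftrightarrow> (a, pzero A) \<in> c \<or> (b, pzero A) \<in> c"
proof -
  obtain K :: "'a set list list ring" and g where K: "field K" and g: "g \<in> pm_hom A (mult_pm K)"
    and eq: "c = hom_congruence A g" using k_congruenceE[OF pointed_monoid_axioms c] .
  interpret K: field K by fact
  show ?thesis using pm_homD[OF g] ab K.integral_iff by (simp add: eq hom_congruence_def)
qed

lemma k_congruence_cancel:
  assumes c: "k_congruence k A \<phi> c" and u: "u \<in> carrier A" "(u, pzero A) \<notin> c"
    and ab: "a \<in> carrier A" "b \<in> carrier A"
  shows "(u \<otimes> a, u \<otimes> b) \<in> c \<longleftrightarrow> (a, b) \<in> c"
proof -
  obtain K :: "'a set list list ring" and g where K: "field K" and g: "g \<in> pm_hom A (mult_pm K)"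
    and eq: "c = hom_congruence A g" using k_congruenceE[OF pointed_monoid_axioms c] .
  interpret K: field K by fact
  have "g u \<noteq> \<zero>\<^bsub>K\<^esub>" using u pm_homD[OF g] by (simp add: eq hom_congruence_def)
  then show ?thesis using pm_homD[OF g] ab u(1) K.m_lcancel by (simp add: eq hom_congruence_def)
qed

lemma k_congruence_unit:
  assumes c: "k_congruence k A \<phi> c" and u: "u \<in> Units A"
  shows "(u, pzero A) \<notin> c"
  using k_congruence_mult_zero_iff[OF c, of u "inv u"] k_congruence_one[OF c] u by auto

lemma k_congruence_pow:
  assumes c: "k_congruence k A \<phi> c" and u: "u \<in> carrier A" "(u, pzero A) \<notin> c"
  shows "(u [^] (n :: nat), pzero A) \<notin> c"
proof (induction n)
  case 0
  then show ?case using k_congruence_one[OF c] by simp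
next
  case (Suc n)
  then show ?case using k_congruence_mult_zero_iff[OF c nat_pow_closed[OF u(1)] u(1)] u(2) by simp
qed

lemma Units_pow: "u \<in> Units A \<Longrightarrow> u [^] (n :: nat) \<in> Units A"
  by (induction n) auto

end

text \<open>Composition with \<open>r\<close> turns the kernel of \<open>g\<close> into the kernel
  of \<open>g \<circ> r\<close>. Injectivity on \<open>k\<close> is inherited because
  \<open>\<psi>\<close> factors as \<open>\<phi>\<close> followed by \<open>r\<close> there.\<close>

lemma k_congruence_pullback:
  assumes B: "pointed_monoid B" and C: "pointed_monoid C" and r: "r \<in> pm_hom B C"
    and \<phi>: "\<phi> \<in> carrier k \<rightarrow> carrier B" and \<psi>: "\<And>l. l \<in> carrier k \<Longrightarrow> \<psi> l = r (\<phi> l)"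
    and c: "k_congruence k C \<psi> c"
  shows "k_congruence k B \<phi> (pullback B r c)"
proof -
  interpret C: pointed_monoid C by fact
  obtain K :: "'b set list list ring" and g where K: "field K" and g: "g \<in> pm_hom C (mult_pm K)"
    and eq: "c = hom_congruence C g" using k_congruenceE[OF C c] .
  note r' = pm_homD[OF r] and g' = pm_homD[OF g]
  have "pullback B r c = hom_congruence B (\<lambda>b. g (r b))"
    using r'(1) by (auto simp: pullback_def eq hom_congruence_def)
  moreover have "k_congruence k B \<phi> (hom_congruence B (\<lambda>b. g (r b)))"
  proof (rule k_congruence_hom_congruence[OF B K _ _ \<phi>])
    show "(\<lambda>b. g (r b)) \<in> pm_hom B (mult_pm K)" by (rule pm_homI) (use r' g' in auto)
    show "inj_on (\<lambda>l. g (r (\<phi> l))) (carrier k)"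
    proof (rule inj_onI)
      fix l l' assume l: "l \<in> carrier k" "l' \<in> carrier k" and e: "g (r (\<phi> l)) = g (r (\<phi> l'))"
      then have "(\<psi> l, \<psi> l') \<in> c" using \<phi> r'(1) \<psi> by (auto simp: eq hom_congruence_def Pi_iff)
      then show "l = l'" by (rule C.k_congruence_inj[OF c l])
    qed
  qed
  ultimately show ?thesis by simp
qed

text \<open>The preimage of the subbasic set of \<open>(a, b)\<close> is the subbasic set of
  \<open>(r a, r b)\<close>.\<close>

lemma continuous_map_pullback:
  assumes B: "pointed_monoid B" and C: "pointed_monoid C" and r: "r \<in> pm_hom B C"
    and \<phi>: "\<phi> \<in> carrier k \<rightarrow> carrier B" and \<psi>: "\<And>l. l \<in> carrier k \<Longrightarrow> \<psi> l = r (\<phi> l)"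
  shows "continuous_map (scong k C \<psi>) (scong k B \<phi>) (pullback B r)"
proof -
  note pb = k_congruence_pullback[OF B C r \<phi> \<psi>]
  have "openin (scong k C \<psi>) {c \<in> topspace (scong k C \<psi>). pullback B r c \<in> W}"
    if "openin (scong k B \<phi>) W" for W
    using that
  proof (induction rule: openin_scong_induct)
    case all
    have "{c \<in> topspace (scong k C \<psi>). pullback B r c \<in> {c. k_congruence k B \<phi> c}} = topspace (scong k C \<psi>)"
      using pb by (auto simp: topspace_scong)
    then show ?case by simp
  next
    case (sub a b)
    then have ab: "r a \<in> carrier C" "r b \<in> carrier C" using pm_homD(1)[OF r] by auto
    have "{c \<in> topspace (scong k C \<psi>). pullback B r c \<in> {c. k_congruence k B \<phi> c \<and> (a, b) \<notin> c}} =
      {c. k_congruence k C \<psi> c \<and> (r a, r b) \<notin> c}"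
      using pb sub by (auto simp: topspace_scong pullback_def)
    then show ?case using openin_scong_sub[OF ab] by simp
  next
    case (Int V W)
    have "{c \<in> topspace (scong k C \<psi>). pullback B r c \<in> V \<inter> W} =
      {c \<in> topspace (scong k C \<psi>). pullback B r c \<in> V} \<inter> {c \<in> topspace (scong k C \<psi>). pullback B r c \<in> W}"
      by blast
    then show ?case using Int(3,4) by auto
  next
    case (Un \<W>)
    have "{c \<in> topspace (scong k C \<psi>). pullback B r c \<in> \<Union>\<W>} =
      (\<Union>W \<in> \<W>. {c \<in> topspace (scong k C \<psi>). pullback B r c \<in> W})" by blast
    then show ?case using Un by auto
  qed
  then show ?thesis using pb by (auto simp: continuous_map_def topspace_scong)
qed

text \<open>\<open>r\<close> exhibits \<open>C\<close> as the localization of \<open>B\<close> at the powers of \<open>h\<close>, up to isomorphism.\<close>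

definition localizes :: "'b pmonoid \<Rightarrow> 'c pmonoid \<Rightarrow> ('b \<Rightarrow> 'c) \<Rightarrow> 'b \<Rightarrow> bool" where
  "localizes B C r h \<longleftrightarrow> h \<in> carrier B \<and> r \<in> pm_hom B C \<and> r h \<in> Units C \<and>
     (\<forall>x \<in> carrier C. \<exists>n :: nat. \<exists>a \<in> carrier B. r h [^]\<^bsub>C\<^esub> n \<otimes>\<^bsub>C\<^esub> x = r a) \<and>
     (\<forall>a \<in> carrier B. \<forall>b \<in> carrier B. r a = r b \<longrightarrow>
        (\<exists>n :: nat. h [^]\<^bsub>B\<^esub> n \<otimes>\<^bsub>B\<^esub> a = h [^]\<^bsub>B\<^esub> n \<otimes>\<^bsub>B\<^esub> b))"

lemma localizes_pm_hom: "localizes B C r h \<Longrightarrow> r \<in> pm_hom B C"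
  by (simp add: localizes_def)

locale localization_map = B: pointed_monoid B + C: pointed_monoid C
  for B :: "'b pmonoid" and C :: "'c pmonoid" +
  fixes r h
  assumes loc: "localizes B C r h"
begin

lemma hB: "h \<in> carrier B" and r: "r \<in> pm_hom B C" and unit: "r h \<in> Units C"
  using loc by (auto simp: localizes_def)

lemmas rD = pm_homD[OF r]
lemmas r_pow = pm_hom_pow[OF B.pointed_monoid_axioms C.pointed_monoid_axioms r hB]

lemma clear_denominator:
  assumes "x \<in> carrier C"
  obtains n :: nat and a where "a \<in> carrier B" "r h [^]\<^bsub>C\<^esub> n \<otimes>\<^bsub>C\<^esub> x = r a"
  using loc assms unfolding localizes_def by blast

lemma r_eqD:
  assumes "a \<in> carrier B" "b \<in> carrier B" "r a = r b"
  obtains n :: nat where "h [^]\<^bsub>B\<^esub> n \<otimes>\<^bsub>B\<^esub> a = h [^]\<^bsub>B\<^esub> n \<otimes>\<^bsub>B\<^esub> b"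
  using loc assms unfolding localizes_def by blast

lemma clear_denominator_mult:
  assumes x: "x \<in> carrier C" and a: "a \<in> carrier B" "r h [^]\<^bsub>C\<^esub> n \<otimes>\<^bsub>C\<^esub> x = r a"
  shows "r h [^]\<^bsub>C\<^esub> (m + n :: nat) \<otimes>\<^bsub>C\<^esub> x = r (h [^]\<^bsub>B\<^esub> m \<otimes>\<^bsub>B\<^esub> a)"
proof -
  have "r h [^]\<^bsub>C\<^esub> (m + n) \<otimes>\<^bsub>C\<^esub> x = r h [^]\<^bsub>C\<^esub> m \<otimes>\<^bsub>C\<^esub> (r h [^]\<^bsub>C\<^esub> n \<otimes>\<^bsub>C\<^esub> x)"
    using x rD(1)[OF hB] by (simp add: C.nat_pow_mult[symmetric] C.m_assoc)
  then show ?thesis using a hB by (simp add: rD(2) r_pow)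
qed

lemma clear_denominators2:
  assumes xy: "x \<in> carrier C" "y \<in> carrier C"
  obtains n :: nat and a b where "a \<in> carrier B" "b \<in> carrier B"
    "r h [^]\<^bsub>C\<^esub> n \<otimes>\<^bsub>C\<^esub> x = r a" "r h [^]\<^bsub>C\<^esub> n \<otimes>\<^bsub>C\<^esub> y = r b"
proof -
  obtain m a where a: "a \<in> carrier B" "r h [^]\<^bsub>C\<^esub> (m :: nat) \<otimes>\<^bsub>C\<^esub> x = r a" using clear_denominator[OF xy(1)] .
  obtain n b where b: "b \<in> carrier B" "r h [^]\<^bsub>C\<^esub> (n :: nat) \<otimes>\<^bsub>C\<^esub> y = r b" using clear_denominator[OF xy(2)] .
  show thesis
    by (rule that[of "h [^]\<^bsub>B\<^esub> n \<otimes>\<^bsub>B\<^esub> a" "h [^]\<^bsub>B\<^esub> m \<otimes>\<^bsub>B\<^esub> b" "n + m"])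
      (use clear_denominator_mult[OF xy(1) a, of n] clear_denominator_mult[OF xy(2) b, of m] a b hB in \<open>auto simp: add.commute\<close>)
qed

text \<open>Three elements are treated at once because \<open>germs\<close> describes a congruent
  pair of fractions by two numerators and one denominator.\<close>

lemma clear_denominators3:
  assumes xyz: "x \<in> carrier C" "y \<in> carrier C" "z \<in> carrier C"
  obtains n :: nat and a b c where "a \<in> carrier B" "b \<in> carrier B" "c \<in> carrier B"
    "r h [^]\<^bsub>C\<^esub> n \<otimes>\<^bsub>C\<^esub> x = r a" "r h [^]\<^bsub>C\<^esub> n \<otimes>\<^bsub>C\<^esub> y = r b" "r h [^]\<^bsub>C\<^esub> n \<otimes>\<^bsub>C\<^esub> z = r c"
proof -
  obtain m a b where ab: "a \<in> carrier B" "b \<in> carrier B"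
    "r h [^]\<^bsub>C\<^esub> (m :: nat) \<otimes>\<^bsub>C\<^esub> x = r a" "r h [^]\<^bsub>C\<^esub> m \<otimes>\<^bsub>C\<^esub> y = r b" using clear_denominators2[OF xyz(1,2)] .
  obtain n c where c: "c \<in> carrier B" "r h [^]\<^bsub>C\<^esub> (n :: nat) \<otimes>\<^bsub>C\<^esub> z = r c" using clear_denominator[OF xyz(3)] .
  show thesis
    by (rule that[of "h [^]\<^bsub>B\<^esub> n \<otimes>\<^bsub>B\<^esub> a" "h [^]\<^bsub>B\<^esub> n \<otimes>\<^bsub>B\<^esub> b" "h [^]\<^bsub>B\<^esub> m \<otimes>\<^bsub>B\<^esub> c" "n + m"])
      (use clear_denominator_mult[OF xyz(1) ab(1,3), of n] clear_denominator_mult[OF xyz(2) ab(2,4), of n]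
        clear_denominator_mult[OF xyz(3) c, of m] ab c hB in \<open>auto simp: add.commute\<close>)
qed

lemma pow_nonzero: "k_congruence k C \<psi> c \<Longrightarrow> (r h [^]\<^bsub>C\<^esub> (n :: nat), pzero C) \<notin> c"
  using C.k_congruence_unit[OF _ C.Units_pow[OF unit]] .

text \<open>\<open>r h\<close> is a unit, so its powers are cancellable modulo \<open>c\<close>.
  Hence \<open>c\<close> is governed by the pairs coming from \<open>B\<close>, which yields both
  injectivity and openness of the pullback map.\<close>

lemma k_congruence_iff_clear:
  assumes c: "k_congruence k C \<psi> c" and xy: "x \<in> carrier C" "y \<in> carrier C"
    and ab: "a \<in> carrier B" "b \<in> carrier B"
    and eq: "r h [^]\<^bsub>C\<^esub> (n :: nat) \<otimes>\<^bsub>C\<^esub> x = r a" "r h [^]\<^bsub>C\<^esub> n \<otimes>\<^bsub>C\<^esub> y = r b"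
  shows "(x, y) \<in> c \<longleftrightarrow> (a, b) \<in> pullback B r c"
proof -
  have "(x, y) \<in> c \<longleftrightarrow> (r h [^]\<^bsub>C\<^esub> n \<otimes>\<^bsub>C\<^esub> x, r h [^]\<^bsub>C\<^esub> n \<otimes>\<^bsub>C\<^esub> y) \<in> c"
    by (rule C.k_congruence_cancel[OF c _ pow_nonzero[OF c] xy, symmetric])
      (use rD(1)[OF hB] in simp)
  then show ?thesis using eq ab by (simp add: pullback_def)
qed

lemma inj_pullback: "inj_on (pullback B r) {c. k_congruence k C \<psi> c}"
proof (rule inj_onI)
  fix c c' assume c: "c \<in> {c. k_congruence k C \<psi> c}" "c' \<in> {c. k_congruence k C \<psi> c}"
    and eq: "pullback B r c = pullback B r c'"
  have "(x, y) \<in> c \<longleftrightarrow> (x, y) \<in> c'" if xy: "x \<in> carrier C" "y \<in> carrier C" for x y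
  proof -
    obtain n a b where "a \<in> carrier B" "b \<in> carrier B"
      "r h [^]\<^bsub>C\<^esub> (n :: nat) \<otimes>\<^bsub>C\<^esub> x = r a" "r h [^]\<^bsub>C\<^esub> n \<otimes>\<^bsub>C\<^esub> y = r b" using clear_denominators2[OF xy] .
    then show ?thesis using k_congruence_iff_clear[OF _ xy] c eq by blast
  qed
  then show "c = c'" using k_congruence_subset c by blast
qed

lemma h_not_in_pullback:
  assumes "k_congruence k C \<psi> c"
  shows "(h, pzero B) \<notin> pullback B r c"
  using C.k_congruence_unit[OF assms unit] by (simp add: pullback_def rD(4))

text \<open>Together with \<open>h_not_in_pullback\<close> this identifies the image of the pullback
  map as the open set where \<open>h\<close> is not congruent to zero. A map \<open>g\<close> into a
  field with kernel \<open>d\<close> makes such an \<open>h\<close> invertible and so extends over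
  the localization to \<open>e\<close>, whose kernel is the required congruence.\<close>

lemma surj_pullback:
  assumes \<phi>: "\<phi> \<in> carrier k \<rightarrow> carrier B" and \<psi>: "\<And>l. l \<in> carrier k \<Longrightarrow> \<psi> l = r (\<phi> l)"
    and d: "k_congruence k B \<phi> d" and hd: "(h, pzero B) \<notin> d"
  obtains c where "k_congruence k C \<psi> c" "pullback B r c = d"
proof -
  obtain K :: "'b set list list ring" and g where K: "field K" and g: "g \<in> pm_hom B (mult_pm K)"
    and deq: "d = hom_congruence B g" using k_congruenceE[OF B.pointed_monoid_axioms d] .
  interpret K: field K by fact
  note g' = pm_homD[OF g, simplified]
  have gh: "g h \<in> carrier K" "g h \<noteq> \<zero>\<^bsub>K\<^esub>"
    using hd hB g' by (auto simp: deq hom_congruence_def)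
  have g_pow: "g (h [^]\<^bsub>B\<^esub> n) = g h [^]\<^bsub>K\<^esub> n" for n :: nat
    using hB g' by (induction n) auto
  have pow: "g h [^]\<^bsub>K\<^esub> n \<in> Units K" for n :: nat
    using gh K.field_Units K.Units_pow_closed by blast
  have cancel: "a = b" if "g h [^]\<^bsub>K\<^esub> (n :: nat) \<otimes>\<^bsub>K\<^esub> a = g h [^]\<^bsub>K\<^esub> n \<otimes>\<^bsub>K\<^esub> b" "a \<in> carrier K" "b \<in> carrier K" for n a b
    using that K.Units_l_cancel[OF pow] by blast
  \<comment> \<open>\<open>y\<close> must fit every way of clearing the denominator of
    \<open>x\<close>, so that the function \<open>e\<close> chosen from this statement satisfies its
    equation for whichever \<open>n\<close> and \<open>a\<close> are convenient.\<close>
  have ex: "\<exists>y \<in> carrier K. \<forall>(n :: nat) a. a \<in> carrier B \<longrightarrow> r h [^]\<^bsub>C\<^esub> n \<otimes>\<^bsub>C\<^esub> x = r a \<longrightarrow>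
      g h [^]\<^bsub>K\<^esub> n \<otimes>\<^bsub>K\<^esub> y = g a" if x: "x \<in> carrier C" for x
  proof -
    obtain n0 a0 where a0: "a0 \<in> carrier B" "r h [^]\<^bsub>C\<^esub> (n0 :: nat) \<otimes>\<^bsub>C\<^esub> x = r a0" using clear_denominator[OF x] .
    define y where "y = inv\<^bsub>K\<^esub> (g h [^]\<^bsub>K\<^esub> n0) \<otimes>\<^bsub>K\<^esub> g a0"
    have yK: "y \<in> carrier K" using pow g'(1)[OF a0(1)] by (simp add: y_def)
    have y0: "g h [^]\<^bsub>K\<^esub> n0 \<otimes>\<^bsub>K\<^esub> y = g a0"
      using pow[of n0] g'(1)[OF a0(1)] gh(1) by (simp add: y_def K.m_assoc[symmetric])
    have "g h [^]\<^bsub>K\<^esub> n \<otimes>\<^bsub>K\<^esub> y = g a"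
      if a: "a \<in> carrier B" "r h [^]\<^bsub>C\<^esub> n \<otimes>\<^bsub>C\<^esub> x = r a" for n :: nat and a
    proof -
      have "r (h [^]\<^bsub>B\<^esub> n \<otimes>\<^bsub>B\<^esub> a0) = r (h [^]\<^bsub>B\<^esub> n0 \<otimes>\<^bsub>B\<^esub> a)"
        using clear_denominator_mult[OF x a0, of n] clear_denominator_mult[OF x a, of n0] by (simp add: add.commute)
      \<comment> \<open>Elements of \<open>B\<close> with equal images in \<open>C\<close> agree
        only after multiplication by a further power of \<open>h\<close>; it is cancelled again in
        the field.\<close>
      then obtain m where "h [^]\<^bsub>B\<^esub> (m :: nat) \<otimes>\<^bsub>B\<^esub> (h [^]\<^bsub>B\<^esub> n \<otimes>\<^bsub>B\<^esub> a0) = h [^]\<^bsub>B\<^esub> m \<otimes>\<^bsub>B\<^esub> (h [^]\<^bsub>B\<^esub> n0 \<otimes>\<^bsub>B\<^esub> a)"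
        using r_eqD[of "h [^]\<^bsub>B\<^esub> n \<otimes>\<^bsub>B\<^esub> a0" "h [^]\<^bsub>B\<^esub> n0 \<otimes>\<^bsub>B\<^esub> a"] a0 a hB by auto
      from arg_cong[OF this, of g]
      have "g h [^]\<^bsub>K\<^esub> m \<otimes>\<^bsub>K\<^esub> (g h [^]\<^bsub>K\<^esub> n \<otimes>\<^bsub>K\<^esub> g a0) = g h [^]\<^bsub>K\<^esub> m \<otimes>\<^bsub>K\<^esub> (g h [^]\<^bsub>K\<^esub> n0 \<otimes>\<^bsub>K\<^esub> g a)"
        using hB a0(1) a(1) by (simp add: g' g_pow)
      then have "g h [^]\<^bsub>K\<^esub> n \<otimes>\<^bsub>K\<^esub> g a0 = g h [^]\<^bsub>K\<^esub> n0 \<otimes>\<^bsub>K\<^esub> g a"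
        by (rule cancel) (use gh(1) g' a0(1) a(1) in auto)
      moreover have "g h [^]\<^bsub>K\<^esub> n0 \<otimes>\<^bsub>K\<^esub> (g h [^]\<^bsub>K\<^esub> n \<otimes>\<^bsub>K\<^esub> y) = g h [^]\<^bsub>K\<^esub> n \<otimes>\<^bsub>K\<^esub> g a0"
        unfolding y0[symmetric] by (rule K.m_lcomm) (use gh(1) yK in auto)
      ultimately have "g h [^]\<^bsub>K\<^esub> n0 \<otimes>\<^bsub>K\<^esub> (g h [^]\<^bsub>K\<^esub> n \<otimes>\<^bsub>K\<^esub> y) = g h [^]\<^bsub>K\<^esub> n0 \<otimes>\<^bsub>K\<^esub> g a"
        by simp
      then show ?thesis by (rule cancel) (use gh(1) yK g' a in auto)
    qed
    then show ?thesis using yK by blast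
  qed
  then obtain e where eK: "\<And>x. x \<in> carrier C \<Longrightarrow> e x \<in> carrier K"
    and e: "\<And>x n a. x \<in> carrier C \<Longrightarrow> a \<in> carrier B \<Longrightarrow> r h [^]\<^bsub>C\<^esub> (n :: nat) \<otimes>\<^bsub>C\<^esub> x = r a \<Longrightarrow>
      g h [^]\<^bsub>K\<^esub> n \<otimes>\<^bsub>K\<^esub> e x = g a" by metis
  have er: "e (r a) = g a" if a: "a \<in> carrier B" for a
    using e[of "r a" a 0] a rD(1)[OF a] eK[OF rD(1)[OF a]] by simp
  have em: "e (x \<otimes>\<^bsub>C\<^esub> y) = e x \<otimes>\<^bsub>K\<^esub> e y" if xy: "x \<in> carrier C" "y \<in> carrier C" for x y
  proof -
    obtain n a b where ab: "a \<in> carrier B" "b \<in> carrier B"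
      "r h [^]\<^bsub>C\<^esub> (n :: nat) \<otimes>\<^bsub>C\<^esub> x = r a" "r h [^]\<^bsub>C\<^esub> n \<otimes>\<^bsub>C\<^esub> y = r b" using clear_denominators2[OF xy] .
    have rn: "r h [^]\<^bsub>C\<^esub> n \<in> carrier C" using rD(1)[OF hB] by simp
    have "r h [^]\<^bsub>C\<^esub> (n + n) \<otimes>\<^bsub>C\<^esub> (x \<otimes>\<^bsub>C\<^esub> y) = (r h [^]\<^bsub>C\<^esub> n \<otimes>\<^bsub>C\<^esub> x) \<otimes>\<^bsub>C\<^esub> (r h [^]\<^bsub>C\<^esub> n \<otimes>\<^bsub>C\<^esub> y)"
      using xy rn rD(1)[OF hB] by (simp add: C.nat_pow_mult[symmetric] C.m_ac)
    then have "r h [^]\<^bsub>C\<^esub> (n + n) \<otimes>\<^bsub>C\<^esub> (x \<otimes>\<^bsub>C\<^esub> y) = r (a \<otimes>\<^bsub>B\<^esub> b)" using ab by (simp add: rD(2))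
    then have "g h [^]\<^bsub>K\<^esub> (n + n) \<otimes>\<^bsub>K\<^esub> e (x \<otimes>\<^bsub>C\<^esub> y) = g a \<otimes>\<^bsub>K\<^esub> g b"
      using e[of "x \<otimes>\<^bsub>C\<^esub> y" "a \<otimes>\<^bsub>B\<^esub> b" "n + n"] xy ab by (simp add: g')
    also have "\<dots> = (g h [^]\<^bsub>K\<^esub> n \<otimes>\<^bsub>K\<^esub> e x) \<otimes>\<^bsub>K\<^esub> (g h [^]\<^bsub>K\<^esub> n \<otimes>\<^bsub>K\<^esub> e y)"
      using e[OF xy(1) ab(1,3)] e[OF xy(2) ab(2,4)] by simp
    also have "\<dots> = g h [^]\<^bsub>K\<^esub> (n + n) \<otimes>\<^bsub>K\<^esub> (e x \<otimes>\<^bsub>K\<^esub> e y)"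
      using gh(1) eK[OF xy(1)] eK[OF xy(2)] by (simp add: K.nat_pow_mult[symmetric] K.m_ac)
    finally show ?thesis by (rule cancel) (use eK xy in auto)
  qed
  have e1: "e \<one>\<^bsub>C\<^esub> = \<one>\<^bsub>K\<^esub>" "e (pzero C) = \<zero>\<^bsub>K\<^esub>"
    using er[of "\<one>\<^bsub>B\<^esub>"] er[of "pzero B"] by (simp_all add: rD(3,4) g'(3,4))
  have hom: "e \<in> pm_hom C (mult_pm K)" by (rule pm_homI) (use eK em e1 in auto)
  have "k_congruence k C \<psi> (hom_congruence C e)"
  proof (rule k_congruence_hom_congruence[OF C.pointed_monoid_axioms K hom])
    show "\<psi> \<in> carrier k \<rightarrow> carrier C" using \<phi> \<psi> rD(1) by (auto simp: Pi_iff)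
    show "inj_on (\<lambda>l. e (\<psi> l)) (carrier k)"
    proof (rule inj_onI)
      fix l l' assume l: "l \<in> carrier k" "l' \<in> carrier k" "e (\<psi> l) = e (\<psi> l')"
      have \<phi>l: "\<phi> l \<in> carrier B" "\<phi> l' \<in> carrier B" using \<phi> l by auto
      then have "(\<phi> l, \<phi> l') \<in> d" using l \<psi> er by (simp add: deq hom_congruence_def)
      then show "l = l'" by (rule B.k_congruence_inj[OF d l(1,2)])
    qed
  qed
  moreover have "pullback B r (hom_congruence C e) = d"
    using er rD(1) by (auto simp: pullback_def deq hom_congruence_def)
  ultimately show thesis by (rule that)
qed

text \<open>Over the open image, cut out by \<open>h\<close>, a pair in \<open>C\<close> may be
  replaced by a pair of cleared numerators in \<open>B\<close>, so a subbasic set goes to an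
  intersection of two subbasic sets. Finite intersections are preserved because the map is
  injective.\<close>

lemma open_map_pullback:
  assumes \<phi>: "\<phi> \<in> carrier k \<rightarrow> carrier B" and \<psi>: "\<And>l. l \<in> carrier k \<Longrightarrow> \<psi> l = r (\<phi> l)"
  shows "open_map (scong k C \<psi>) (scong k B \<phi>) (pullback B r)"
  unfolding open_map_def
proof (intro allI impI)
  note pb = k_congruence_pullback[OF B.pointed_monoid_axioms C.pointed_monoid_axioms r \<phi> \<psi>]
  note surj = surj_pullback[OF \<phi> \<psi>]
  have D: "openin (scong k B \<phi>) {d. k_congruence k B \<phi> d \<and> (h, pzero B) \<notin> d}"
    using openin_scong_sub[OF hB B.pzero_closed] .
  fix W assume "openin (scong k C \<psi>) W"
  then show "openin (scong k B \<phi>) (pullback B r ` W)"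
  proof (induction rule: openin_scong_induct)
    case all
    have "pullback B r ` {c. k_congruence k C \<psi> c} = {d. k_congruence k B \<phi> d \<and> (h, pzero B) \<notin> d}"
    proof
      show "pullback B r ` {c. k_congruence k C \<psi> c} \<subseteq> {d. k_congruence k B \<phi> d \<and> (h, pzero B) \<notin> d}"
        using pb h_not_in_pullback by blast
      show "{d. k_congruence k B \<phi> d \<and> (h, pzero B) \<notin> d} \<subseteq> pullback B r ` {c. k_congruence k C \<psi> c}"
        using surj by blast
    qed
    then show ?case using D by simp
  next
    case (sub x y)
    obtain n a b where ab: "a \<in> carrier B" "b \<in> carrier B"
      "r h [^]\<^bsub>C\<^esub> (n :: nat) \<otimes>\<^bsub>C\<^esub> x = r a" "r h [^]\<^bsub>C\<^esub> n \<otimes>\<^bsub>C\<^esub> y = r b" using clear_denominators2[OF sub] .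
    have iff: "(x, y) \<in> c \<longleftrightarrow> (a, b) \<in> pullback B r c" if "k_congruence k C \<psi> c" for c
      by (rule k_congruence_iff_clear[OF that sub ab])
    have "pullback B r ` {c. k_congruence k C \<psi> c \<and> (x, y) \<notin> c} =
      {d. k_congruence k B \<phi> d \<and> (h, pzero B) \<notin> d} \<inter> {d. k_congruence k B \<phi> d \<and> (a, b) \<notin> d}"
    proof
      show "pullback B r ` {c. k_congruence k C \<psi> c \<and> (x, y) \<notin> c} \<subseteq>
          {d. k_congruence k B \<phi> d \<and> (h, pzero B) \<notin> d} \<inter> {d. k_congruence k B \<phi> d \<and> (a, b) \<notin> d}"
        using pb h_not_in_pullback iff by blast
      show "{d. k_congruence k B \<phi> d \<and> (h, pzero B) \<notin> d} \<inter> {d. k_congruence k B \<phi> d \<and> (a, b) \<notin> d} \<subseteq>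
          pullback B r ` {c. k_congruence k C \<psi> c \<and> (x, y) \<notin> c}"
        using surj iff by blast
    qed
    then show ?case using openin_Int[OF D openin_scong_sub[OF ab(1,2), of k \<phi>]] by (simp only:)
  next
    case (Int V W)
    then have VW: "V \<subseteq> {c. k_congruence k C \<psi> c}" "W \<subseteq> {c. k_congruence k C \<psi> c}"
      using openin_subset[of "scong k C \<psi>"] by (simp_all add: topspace_scong)
    show ?case unfolding inj_on_image_Int[OF inj_pullback VW] using Int by blast
  next
    case (Un \<W>)
    then show ?case by (auto simp: image_Union)
  qed
qed

end

section \<open>Affine open subsets\<close>

text \<open>The intrinsic form of the basic open subset of \<open>U\<close> belonging to \<open>s\<close>, without reference to
  an isomorphism of \<open>U\<close> with a spectrum.\<close>

definition unit_locus :: "('x, 's) mspace \<Rightarrow> 'x set \<Rightarrow> 's \<Rightarrow> 'x set" where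
  "unit_locus X U s = {x. \<exists>N. openin (mtop X) N \<and> x \<in> N \<and> N \<subseteq> U \<and> mres X U N s \<in> Units (msec X N)}"

lemma pm_iso_Units_iff:
  assumes f: "f \<in> pm_iso A B" and A: "pointed_monoid A" and B: "pointed_monoid B" and a: "a \<in> carrier A"
  shows "f a \<in> Units B \<longleftrightarrow> a \<in> Units A"
proof
  interpret A: pointed_monoid A by fact
  interpret B: pointed_monoid B by fact
  have h: "f \<in> pm_hom A B" and b: "bij_betw f (carrier A) (carrier B)" using f by (auto simp: pm_iso_def)
  note h' = pm_homD[OF h]
  show "a \<in> Units A \<Longrightarrow> f a \<in> Units B"
  proof -
    assume u: "a \<in> Units A"
    have "f (inv\<^bsub>A\<^esub> a) \<otimes>\<^bsub>B\<^esub> f a = \<one>\<^bsub>B\<^esub>"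
      using u h'(2)[of "inv\<^bsub>A\<^esub> a" a] h'(3) a by simp
    moreover have "f (inv\<^bsub>A\<^esub> a) \<in> carrier B" "f a \<in> carrier B" using u a h'(1) by auto
    ultimately show ?thesis using B.m_comm[of "f a" "f (inv\<^bsub>A\<^esub> a)"] by (auto simp: Units_def)
  qed
  assume u: "f a \<in> Units B"
  then obtain c where c: "c \<in> carrier A" "inv\<^bsub>B\<^esub> (f a) = f c"
    using b by (metis B.Units_inv_closed bij_betwE bij_betw_imp_surj_on imageE)
  have "f (c \<otimes>\<^bsub>A\<^esub> a) = f \<one>\<^bsub>A\<^esub>" using h'(2)[OF c(1) a] h'(3) u c(2) by (metis B.Units_l_inv)
  then have ca: "c \<otimes>\<^bsub>A\<^esub> a = \<one>\<^bsub>A\<^esub>" using b c(1) a by (auto simp: bij_betw_def inj_on_def)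
  then have "a \<otimes>\<^bsub>A\<^esub> c = \<one>\<^bsub>A\<^esub>" using A.m_comm[OF c(1) a] by simp
  then show "a \<in> Units A" using ca c(1) a unfolding Units_def by blast
qed

lemma localizes_comp_iso:
  assumes A: "pointed_monoid A" and C: "pointed_monoid C" and D: "pointed_monoid D"
    and l: "localizes A C r h" and f: "f \<in> pm_iso C D"
  shows "localizes A D (\<lambda>a. f (r a)) h"
proof -
  interpret localization_map A C r h
    using A C l by (simp add: localization_map_def localization_map_axioms_def)
  have fh: "f \<in> pm_hom C D" and b: "bij_betw f (carrier C) (carrier D)" using f by (auto simp: pm_iso_def)
  note f' = pm_homD[OF fh]
  have "\<exists>n :: nat. \<exists>a \<in> carrier A. f (r h) [^]\<^bsub>D\<^esub> n \<otimes>\<^bsub>D\<^esub> y = f (r a)" if y: "y \<in> carrier D" for y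
  proof -
    obtain x where x: "x \<in> carrier C" "y = f x" using b y by (auto simp: bij_betw_def)
    obtain n a where a: "a \<in> carrier A" "r h [^]\<^bsub>C\<^esub> (n :: nat) \<otimes>\<^bsub>C\<^esub> x = r a" using clear_denominator[OF x(1)] .
    have "f (r h) [^]\<^bsub>D\<^esub> n \<otimes>\<^bsub>D\<^esub> y = f (r a)"
      using f'(2)[of "r h [^]\<^bsub>C\<^esub> n" x] x rD(1)[OF hB] a pm_hom_pow[OF C D fh rD(1)[OF hB]] by simp
    then show ?thesis using a(1) by blast
  qed
  moreover have "\<exists>n :: nat. h [^]\<^bsub>A\<^esub> n \<otimes>\<^bsub>A\<^esub> a = h [^]\<^bsub>A\<^esub> n \<otimes>\<^bsub>A\<^esub> a'"
    if "a \<in> carrier A" "a' \<in> carrier A" "f (r a) = f (r a')" for a a'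
  proof -
    have "r a = r a'" using b that rD(1) by (auto simp: bij_betw_def inj_on_def)
    then show ?thesis using r_eqD[OF that(1,2)] by metis
  qed
  moreover have "(\<lambda>a. f (r a)) \<in> pm_hom A D" by (rule pm_homI) (use rD f' in auto)
  moreover have "f (r h) \<in> Units D" using pm_iso_Units_iff[OF f C D rD(1)[OF hB]] unit by simp
  ultimately show ?thesis using hB unfolding localizes_def by blast
qed

text \<open>Moves the source of a localization from the coordinate monoid of a chart to the
  isomorphic monoid of sections; \<open>localizes_comp_iso\<close> does the same for the
  target.\<close>

lemma localizes_iso_comp:
  assumes A: "pointed_monoid A" and B: "pointed_monoid B" and C: "pointed_monoid C"
    and e: "e \<in> pm_iso A B" and rB: "r \<in> pm_hom B C" and l: "localizes A C (\<lambda>a. r (e a)) h"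
  shows "localizes B C r (e h)"
proof -
  interpret localization_map A C "\<lambda>a. r (e a)" h
    using A C l by (simp add: localization_map_def localization_map_axioms_def)
  have eh: "e \<in> pm_hom A B" and b: "bij_betw e (carrier A) (carrier B)" using e by (auto simp: pm_iso_def)
  note e' = pm_homD[OF eh]
  note pow = pm_hom_pow[OF A B eh hB]
  have c1: "\<exists>n :: nat. \<exists>y \<in> carrier B. r (e h) [^]\<^bsub>C\<^esub> n \<otimes>\<^bsub>C\<^esub> x = r y" if "x \<in> carrier C" for x
    using clear_denominator[OF that] e'(1) by metis
  have c2: "\<exists>n :: nat. e h [^]\<^bsub>B\<^esub> n \<otimes>\<^bsub>B\<^esub> y = e h [^]\<^bsub>B\<^esub> n \<otimes>\<^bsub>B\<^esub> y'"
    if y: "y \<in> carrier B" "y' \<in> carrier B" "r y = r y'" for y y'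
  proof -
    obtain a a' where a: "a \<in> carrier A" "y = e a" "a' \<in> carrier A" "y' = e a'"
      using b y unfolding bij_betw_def by blast
    have "r (e a) = r (e a')" using y(3) a by simp
    then obtain n where "h [^]\<^bsub>A\<^esub> (n :: nat) \<otimes>\<^bsub>A\<^esub> a = h [^]\<^bsub>A\<^esub> n \<otimes>\<^bsub>A\<^esub> a'"
      by (rule r_eqD[OF a(1,3)])
    then have "e h [^]\<^bsub>B\<^esub> n \<otimes>\<^bsub>B\<^esub> y = e h [^]\<^bsub>B\<^esub> n \<otimes>\<^bsub>B\<^esub> y'"
      using a hB e'(2)[of "h [^]\<^bsub>A\<^esub> n" a] e'(2)[of "h [^]\<^bsub>A\<^esub> n" a'] pow by simp
    then show ?thesis by blast
  qed
  show ?thesis unfolding localizes_def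
    by (intro conjI ballI impI) (assumption | rule rB unit e'(1)[OF hB] c1 c2)+
qed

text \<open>In a chart this turns the description of sections over basic open sets into an
  isomorphism of \<open>A\<close> with the sections over the whole affine set.\<close>

lemma localizes_one_bij:
  assumes A: "pointed_monoid A" and C: "pointed_monoid C" and l: "localizes A C r \<one>\<^bsub>A\<^esub>"
  shows "r \<in> pm_iso A C"
proof -
  interpret localization_map A C r "\<one>\<^bsub>A\<^esub>"
    using A C l by (simp add: localization_map_def localization_map_axioms_def)
  have "inj_on r (carrier A)"
  proof (rule inj_onI)
    fix a b assume ab: "a \<in> carrier A" "b \<in> carrier A" "r a = r b"
    obtain n where "\<one>\<^bsub>A\<^esub> [^]\<^bsub>A\<^esub> (n :: nat) \<otimes>\<^bsub>A\<^esub> a = \<one>\<^bsub>A\<^esub> [^]\<^bsub>A\<^esub> n \<otimes>\<^bsub>A\<^esub> b" using r_eqD[OF ab] .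
    then show "a = b" using ab by simp
  qed
  moreover have "x \<in> r ` carrier A" if x: "x \<in> carrier C" for x
  proof -
    obtain n a where "a \<in> carrier A" "r \<one>\<^bsub>A\<^esub> [^]\<^bsub>C\<^esub> (n :: nat) \<otimes>\<^bsub>C\<^esub> x = r a" using clear_denominator[OF x] .
    then show ?thesis using x by (simp add: rD(3))
  qed
  ultimately show ?thesis using r rD(1) by (auto simp: pm_iso_def bij_betw_def)
qed

section \<open>Sections of a spectrum as localizations\<close>

context pointed_monoid
begin

lemma mem_powers: "h \<in> carrier A \<Longrightarrow> h \<in> powers A h"
  unfolding powers_def by (intro CollectI exI[of _ "1 :: nat"]) simp

lemma one_in_powers: "\<one> \<in> powers A h"
  unfolding powers_def by (intro CollectI exI[of _ "0 :: nat"]) simp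

lemma powers_subset_compl_prime:
  assumes h: "h \<in> carrier A" and P: "P \<in> basic_open A h"
  shows "powers A h \<subseteq> carrier A - P"
proof -
  have S: "submonoid (carrier A - P) A" using P submonoid_prime by (simp add: basic_open_def)
  have "h [^] n \<in> carrier A - P" for n :: nat
    using P h submonoid.m_closed[OF S] submonoid.one_closed[OF S] by (induction n) (auto simp: basic_open_def)
  then show ?thesis by (auto simp: powers_def)
qed

lemma basic_open_one: "basic_open A \<one> = topspace (mspec_top A)"
  unfolding topspace_mspec using submonoid_prime submonoid.one_closed by (fastforce simp: basic_open_def)

lemma localizes_localization:
  assumes h: "h \<in> carrier A"
  shows "localizes A (localization A (powers A h)) (\<lambda>a. fraction A (powers A h) a \<one>) h"
proof -
  let ?H = "powers A h" and ?L = "localization A (powers A h)"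
  have H: "submonoid ?H A" by (rule submonoid_powers[OF h])
  note HA = submonoid.mem_carrier[OF H] and H1 = submonoid.one_closed[OF H] and Hh = mem_powers[OF h]
  note mult = fraction_mult[OF H] and eq = fraction_eq_iff[OF H]
  interpret L: pointed_monoid ?L by (rule pointed_monoid_localization[OF H])
  let ?r = "\<lambda>a. fraction A ?H a \<one>"
  have mem: "fraction A ?H a s \<in> carrier ?L" if "a \<in> carrier A" "s \<in> ?H" for a s
    using that by (auto simp: carrier_localization)
  have one: "\<one>\<^bsub>?L\<^esub> = fraction A ?H \<one> \<one>" by (simp add: localization_def)
  have hom: "?r \<in> pm_hom A ?L"
    by (rule pm_homI) (use mem mult H1 in \<open>auto simp: localization_def\<close>)
  have pow: "?r h [^]\<^bsub>?L\<^esub> n = ?r (h [^] n)" for n :: nat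
    using pm_hom_pow[OF pointed_monoid_axioms L.pointed_monoid_axioms hom h] by simp
  have inv: "fraction A ?H \<one> s \<otimes>\<^bsub>?L\<^esub> ?r s = \<one>\<^bsub>?L\<^esub>" if s: "s \<in> ?H" for s
  proof -
    have "fraction A ?H \<one> s \<otimes>\<^bsub>?L\<^esub> ?r s = fraction A ?H s s" using mult[OF _ s _ H1, of \<one> s] HA[OF s] s by simp
    also have "\<dots> = fraction A ?H \<one> \<one>" using eq[of s s \<one> \<one>] s HA[OF s] H1 by auto
    finally show ?thesis by (simp add: one)
  qed
  have "?r h \<in> Units ?L"
  proof -
    have "?r h \<otimes>\<^bsub>?L\<^esub> fraction A ?H \<one> h = \<one>\<^bsub>?L\<^esub>"
      using inv[OF Hh] L.m_comm[OF mem[OF h H1] mem[OF one_closed Hh]] by simp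
    then show ?thesis using inv[OF Hh] mem[OF one_closed Hh] mem[OF h H1] unfolding Units_def by blast
  qed
  moreover have "\<exists>n :: nat. \<exists>a \<in> carrier A. ?r h [^]\<^bsub>?L\<^esub> n \<otimes>\<^bsub>?L\<^esub> x = ?r a" if x: "x \<in> carrier ?L" for x
  proof -
    obtain a s where a: "x = fraction A ?H a s" "a \<in> carrier A" "s \<in> ?H" using x by (auto simp: carrier_localization)
    obtain n :: nat where n: "s = h [^] n" using a(3) by (auto simp: powers_def)
    have "?r s \<otimes>\<^bsub>?L\<^esub> x = fraction A ?H (s \<otimes> a) s"
      using mult[OF HA[OF a(3)] H1 a(2,3)] a HA by simp
    also have "\<dots> = ?r a" using eq[of "s \<otimes> a" s a \<one>] a HA H1 by auto
    finally show ?thesis using a(2) pow n by metis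
  qed
  moreover have "\<exists>n :: nat. h [^] n \<otimes> a = h [^] n \<otimes> b" if "a \<in> carrier A" "b \<in> carrier A" "?r a = ?r b" for a b
    using that eq[of a \<one> b \<one>] H1 by (auto simp: powers_def)
  ultimately show ?thesis using h hom unfolding localizes_def by blast
qed

text \<open>The fraction \<open>a / 1\<close> as a section over the basic open set of
  \<open>h\<close>; restriction between such sets then only changes \<open>h\<close>.\<close>

definition spec_section :: "'a \<Rightarrow> 'a \<Rightarrow> 'a set \<Rightarrow> ('a \<times> 'a) set" where
  "spec_section h a = (\<lambda>P \<in> basic_open A h. fraction A (carrier A - P) a \<one>)"

text \<open>The laws are transported along the isomorphism with the localization, where they are
  known; \<open>pm_iso\<close> itself demands no laws of its target.\<close>

lemma pointed_monoid_mspec_sec_basic: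
  assumes h: "h \<in> carrier A"
  shows "pointed_monoid (mspec_sec A (basic_open A h))"
proof -
  let ?L = "localization A (powers A h)" and ?M = "mspec_sec A (basic_open A h)"
  obtain f where f: "f \<in> pm_iso ?L ?M" using mspec_sec_basic_open[OF h] by (auto simp: mspec_def)
  have fh: "f \<in> pm_hom ?L ?M" and b: "f ` carrier ?L = carrier ?M" using f by (auto simp: pm_iso_def bij_betw_def)
  note f' = pm_homD[OF fh]
  interpret L: pointed_monoid ?L by (rule pointed_monoid_localization[OF submonoid_powers[OF h]])
  show ?thesis
  proof (rule pointed_monoid.intro)
    show "comm_monoid ?M"
    proof (rule comm_monoidI)
      fix x y assume "x \<in> carrier ?M" "y \<in> carrier ?M"
      then obtain a b where ab: "a \<in> carrier ?L" "b \<in> carrier ?L" "x = f a" "y = f b"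
        unfolding b[symmetric] by blast
      show "x \<otimes>\<^bsub>?M\<^esub> y \<in> carrier ?M" "x \<otimes>\<^bsub>?M\<^esub> y = y \<otimes>\<^bsub>?M\<^esub> x"
        using ab f' by (simp_all add: f'(2)[symmetric] L.m_comm)
      show "x \<otimes>\<^bsub>?M\<^esub> y \<otimes>\<^bsub>?M\<^esub> z = x \<otimes>\<^bsub>?M\<^esub> (y \<otimes>\<^bsub>?M\<^esub> z)" if "z \<in> carrier ?M" for z
        using that ab unfolding b[symmetric] by (auto simp: f'(2)[symmetric] L.m_assoc)
    next
      show "\<one>\<^bsub>?M\<^esub> \<in> carrier ?M" using f'(1,3) by (metis L.one_closed)
      show "\<one>\<^bsub>?M\<^esub> \<otimes>\<^bsub>?M\<^esub> x = x" if "x \<in> carrier ?M" for x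
        using that unfolding b[symmetric] f'(3)[symmetric] by (auto simp: f'(2)[symmetric])
    qed
    show "pointed_monoid_axioms ?M"
    proof
      show "pzero ?M \<in> carrier ?M" using f'(1,4) by (metis L.pzero_closed)
      show "pzero ?M \<otimes>\<^bsub>?M\<^esub> x = pzero ?M" if "x \<in> carrier ?M" for x
        using that unfolding b[symmetric] f'(4)[symmetric] by (auto simp: f'(2)[symmetric])
    qed
  qed
qed

lemma localizes_mspec_sec:
  assumes h: "h \<in> carrier A"
  shows "localizes A (mspec_sec A (basic_open A h)) (spec_section h) h"
proof -
  let ?H = "powers A h"
  let ?F = "\<lambda>x. \<lambda>P \<in> basic_open A h. \<Union>(a, s) \<in> x. fraction A (carrier A - P) a s"
  have H: "submonoid ?H A" by (rule submonoid_powers[OF h])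
  \<comment> \<open>The isomorphism is a union over representatives of a fraction; all of them give
    the same value at \<open>P\<close>, as the powers of \<open>h\<close> avoid
    \<open>P\<close>.\<close>
  have F: "?F (fraction A ?H a \<one>) = spec_section h a" if a: "a \<in> carrier A" for a
    unfolding spec_section_def
  proof (rule restrict_ext)
    fix P assume P: "P \<in> basic_open A h"
    have S: "submonoid (carrier A - P) A" using P submonoid_prime by (simp add: basic_open_def)
    note S1 = submonoid.one_closed[OF S] and HS = powers_subset_compl_prime[OF h P]
    have "fraction A (carrier A - P) b t = fraction A (carrier A - P) a \<one>"
      if bt: "(b, t) \<in> fraction A ?H a \<one>" for b t
    proof -
      obtain u where "u \<in> ?H" "b \<in> carrier A" "t \<in> ?H" "u \<otimes> (t \<otimes> a) = u \<otimes> (\<one> \<otimes> b)"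
        using bt by (auto simp: fraction_def loc_rel_def)
      then show ?thesis using fraction_eq_iff[OF S, of b t a \<one>] HS S1 a by (metis subsetD)
    qed
    moreover have "(a, \<one>) \<in> fraction A ?H a \<one>" by (rule fraction_self[OF H a one_in_powers])
    ultimately show "(\<Union>(b, t) \<in> fraction A ?H a \<one>. fraction A (carrier A - P) b t) = fraction A (carrier A - P) a \<one>"
      by fast
  qed
  have "localizes A (mspec_sec A (basic_open A h)) (\<lambda>a. ?F (fraction A ?H a \<one>)) h"
    by (rule localizes_comp_iso[OF pointed_monoid_axioms pointed_monoid_localization[OF H]
          pointed_monoid_mspec_sec_basic[OF h] localizes_localization[OF h]])
      (use mspec_sec_basic_open[OF h] in \<open>simp only: mspec_def mspace.simps\<close>)
  then show ?thesis
    unfolding localizes_def pm_hom_def hom_def using F h by (auto simp: Pi_iff)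
qed

text \<open>Invertibility is tested at the single prime \<open>P\<close>: there \<open>h / 1\<close>
  becomes a unit of the localization, and clearing denominators exhibits a multiple of
  \<open>h\<close> outside \<open>P\<close>.\<close>

lemma spec_section_unit_imp:
  assumes h: "h \<in> carrier A" and P: "P \<in> V" "pm_prime A P"
    and u: "s \<in> Units (mspec_sec A V)" and s: "s P = fraction A (carrier A - P) h \<one>"
  shows "h \<notin> P"
proof -
  let ?S = "carrier A - P"
  have S: "submonoid ?S A" by (rule submonoid_prime[OF P(2)])
  note S1 = submonoid.one_closed[OF S]
  obtain t where t: "t \<in> mspec_sec_carrier A V" "s \<otimes>\<^bsub>mspec_sec A V\<^esub> t = \<one>\<^bsub>mspec_sec A V\<^esub>"
    using u by (auto simp: Units_def mspec_sec_def)
  have "t P \<in> carrier (localization A ?S)" using t(1) P(1) by (auto simp: mspec_sec_carrier_def)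
  then obtain b w where b: "t P = fraction A ?S b w" "b \<in> carrier A" "w \<in> ?S"
    by (auto simp: carrier_localization)
  have "s P \<otimes>\<^bsub>localization A ?S\<^esub> t P = \<one>\<^bsub>localization A ?S\<^esub>"
    using fun_cong[OF t(2), of P] P(1) by (simp add: mspec_sec_def)
  then have "fraction A ?S (h \<otimes> b) (\<one> \<otimes> w) = fraction A ?S \<one> \<one>"
    using fraction_mult[OF S h S1 b(2,3)] by (simp add: s b(1) localization_def)
  then obtain v where v: "v \<in> ?S" "v \<otimes> (\<one> \<otimes> (h \<otimes> b)) = v \<otimes> (\<one> \<otimes> w \<otimes> \<one>)"
    using fraction_eq_iff[OF S, of "h \<otimes> b" "\<one> \<otimes> w" \<one> \<one>] h b S1 by auto
  have "v \<otimes> (h \<otimes> b) \<in> ?S" using v submonoid.m_closed[OF S v(1) b(3)] h b by simp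
  then have "h \<otimes> b \<notin> P" using prime_mult_iff[OF P(2), of v "h \<otimes> b"] v(1) h b by auto
  then show ?thesis using prime_mult_iff[OF P(2) h b(2)] by blast
qed

end

lemma pm_hom_Units:
  assumes f: "f \<in> pm_hom A B" and A: "pointed_monoid A" and B: "pointed_monoid B" and a: "a \<in> Units A"
  shows "f a \<in> Units B"
proof -
  interpret A: pointed_monoid A by fact
  note f' = pm_homD[OF f]
  have i: "inv\<^bsub>A\<^esub> a \<in> carrier A" "a \<in> carrier A" using a by auto
  have "f (inv\<^bsub>A\<^esub> a) \<otimes>\<^bsub>B\<^esub> f a = \<one>\<^bsub>B\<^esub>" "f a \<otimes>\<^bsub>B\<^esub> f (inv\<^bsub>A\<^esub> a) = \<one>\<^bsub>B\<^esub>"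
    using a i by (simp_all add: f'(2,3)[symmetric])
  then show ?thesis using f'(1) i unfolding Units_def by blast
qed

section \<open>Affine open sets in terms of restriction and units\<close>

locale presheafed_space =
  fixes X :: "('x, 's) mspace"
  assumes presheaf: "presheaf X"
begin

lemma sec: "openin (mtop X) U \<Longrightarrow> pointed_monoid (msec X U)"
  using presheaf by (simp add: presheaf_def)

lemma res_hom: "openin (mtop X) U \<Longrightarrow> openin (mtop X) V \<Longrightarrow> V \<subseteq> U \<Longrightarrow> mres X U V \<in> pm_hom (msec X U) (msec X V)"
  using presheaf by (simp add: presheaf_def)

lemma res_id: "openin (mtop X) U \<Longrightarrow> s \<in> carrier (msec X U) \<Longrightarrow> mres X U U s = s"
  using presheaf by (simp add: presheaf_def)

lemma res_res: "openin (mtop X) U \<Longrightarrow> openin (mtop X) V \<Longrightarrow> openin (mtop X) W \<Longrightarrow> V \<subseteq> U \<Longrightarrow> W \<subseteq> V \<Longrightarrow>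
    s \<in> carrier (msec X U) \<Longrightarrow> mres X V W (mres X U V s) = mres X U W s"
  using presheaf by (simp add: presheaf_def)

lemma res_Units: "openin (mtop X) U \<Longrightarrow> openin (mtop X) V \<Longrightarrow> V \<subseteq> U \<Longrightarrow> s \<in> Units (msec X U) \<Longrightarrow>
    mres X U V s \<in> Units (msec X V)"
  by (rule pm_hom_Units[OF res_hom sec sec])

text \<open>Transports the spectrum of \<open>A\<close> to \<open>U\<close>. Basic open sets become
  unit loci, which depend on the sections of \<open>X\<close> and not on the chart, so that
  different affine sets can be compared.\<close>

lemma affine_chart:
  assumes U: "affine_open X U"
  obtains A :: "'s pmonoid" and \<psi> e where "pointed_monoid A"
    "homeomorphic_map (subtopology (mtop X) U) (mspec_top A) \<psi>" "e \<in> pm_iso A (msec X U)"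
    "\<forall>h \<in> carrier A. unit_locus X U (e h) = {x \<in> U. h \<notin> \<psi> x}"
    "\<forall>h \<in> carrier A. openin (mtop X) (unit_locus X U (e h))"
    "\<forall>h \<in> carrier A. localizes (msec X U) (msec X (unit_locus X U (e h)))
       (mres X U (unit_locus X U (e h))) (e h)"
proof -
  let ?Y = "open_subspace X U"
  have Uo: "openin (mtop X) U" using U by (simp add: affine_open_def)
  obtain A :: "'s pmonoid" and \<psi> \<Phi> where A: "pointed_monoid A"
    and mor: "mspace_morphism ?Y (mspec A) \<psi> \<Phi>" and hom: "homeomorphic_map (mtop ?Y) (mtop (mspec A)) \<psi>"
    and iso: "\<And>V. openin (mtop (mspec A)) V \<Longrightarrow> \<Phi> V \<in> pm_iso (msec (mspec A) V) (msec ?Y (preim ?Y \<psi> V))"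
    using U unfolding affine_open_def mspace_isomorphic_def by blast
  interpret A: pointed_monoid A by fact
  have Y: "mtop ?Y = subtopology (mtop X) U" "msec ?Y = msec X" "mres ?Y = mres X"
    by (simp_all add: open_subspace_def)
  have Ut: "topspace (subtopology (mtop X) U) = U" using Uo by (auto dest: openin_subset)
  have M: "mtop (mspec A) = mspec_top A" "msec (mspec A) = mspec_sec A" "mres (mspec A) = (\<lambda>V W s. restrict s W)"
    by (simp_all add: mspec_def)
  define p where "p V = preim ?Y \<psi> V" for V
  have p: "p V = {x \<in> U. \<psi> x \<in> V}" for V using openin_subset[OF Uo] by (auto simp: p_def preim_def Y(1))
  have h: "homeomorphic_map (subtopology (mtop X) U) (mspec_top A) \<psi>" using hom by (simp only: Y M)
  have iso: "\<Phi> V \<in> pm_iso (mspec_sec A V) (msec X (p V))" if "openin (mspec_top A) V" for V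
    using iso[of V] that by (simp only: Y M p_def)
  have nat: "\<Phi> W (restrict t W) = mres X (p V) (p W) (\<Phi> V t)"
    if "openin (mspec_top A) V" "openin (mspec_top A) W" "W \<subseteq> V" "t \<in> carrier (mspec_sec A V)" for V W t
    using mor that by (simp add: mspace_morphism_def Y M p_def)
  have po: "openin (mtop X) (p V)" if "openin (mspec_top A) V" for V
  proof -
    have "openin (subtopology (mtop X) U) {x \<in> topspace (subtopology (mtop X) U). \<psi> x \<in> V}"
      by (rule openin_continuous_map_preimage[OF homeomorphic_imp_continuous_map[OF h] that])
    then show ?thesis using Uo by (simp only: p Ut openin_open_subtopology)
  qed
  \<comment> \<open>The whole spectrum written as a basic open set, so that results on basic open
    sets also cover global sections.\<close>
  define T where "T = basic_open A \<one>\<^bsub>A\<^esub>"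
  have To: "openin (mspec_top A) T" by (simp add: T_def A.openin_basic)
  have Tt: "T = topspace (mspec_top A)" by (simp add: T_def A.basic_open_one)
  have "\<psi> ` U = topspace (mspec_top A)" using homeomorphic_imp_surjective_map[OF h] Ut by simp
  then have pT: "p T = U" by (auto simp: p Tt)
  define e where "e a = \<Phi> T (A.spec_section \<one>\<^bsub>A\<^esub> a)" for a
  note locT = A.localizes_mspec_sec[OF A.one_closed, folded T_def]
  note pmT = A.pointed_monoid_mspec_sec_basic[OF A.one_closed, folded T_def]
  have e: "e \<in> pm_iso A (msec X U)"
    unfolding e_def
    by (rule localizes_one_bij[OF A sec[OF Uo]])
      (use localizes_comp_iso[OF A pmT sec[OF Uo] locT] iso[OF To] pT in simp)
  have eh: "e \<in> pm_hom A (msec X U)" using e by (simp add: pm_iso_def)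
  have ssT: "A.spec_section \<one>\<^bsub>A\<^esub> a \<in> carrier (mspec_sec A T)" if "a \<in> carrier A" for a
    by (rule pm_homD(1)[OF localizes_pm_hom[OF locT] that])
  have res: "mres X U (p (basic_open A g)) (e a) = \<Phi> (basic_open A g) (A.spec_section g a)"
    if "a \<in> carrier A" "g \<in> carrier A" for a g
  proof -
    have "basic_open A g \<subseteq> T" using openin_subset[OF A.openin_basic[OF that(2)]] by (simp add: Tt)
    then have "restrict (A.spec_section \<one>\<^bsub>A\<^esub> a) (basic_open A g) = A.spec_section g a"
      unfolding A.spec_section_def T_def[symmetric] by (auto simp: restrict_def fun_eq_iff)
    then show ?thesis
      using nat[OF To A.openin_basic[OF that(2)] \<open>_ \<subseteq> T\<close> ssT[OF that(1)]] by (simp add: pT e_def)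
  qed
  have pg: "openin (mtop X) (p (basic_open A g))" "p (basic_open A g) \<subseteq> U" if "g \<in> carrier A" for g
    using po[OF A.openin_basic[OF that]] by (auto simp: p)
  have loc: "localizes (msec X U) (msec X (p (basic_open A g))) (mres X U (p (basic_open A g))) (e g)"
    if g: "g \<in> carrier A" for g
  proof (rule localizes_iso_comp[OF A sec[OF Uo] sec[OF pg(1)[OF g]] e res_hom[OF Uo pg[OF g]]])
    have "localizes A (msec X (p (basic_open A g))) (\<lambda>a. \<Phi> (basic_open A g) (A.spec_section g a)) g"
      by (rule localizes_comp_iso[OF A A.pointed_monoid_mspec_sec_basic[OF g] sec[OF pg(1)[OF g]]
            A.localizes_mspec_sec[OF g] iso[OF A.openin_basic[OF g]]])
    \<comment> \<open>The two maps agree on the carrier of \<open>A\<close>, which is all that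
      \<open>localizes\<close> inspects.\<close>
    then show "localizes A (msec X (p (basic_open A g))) (\<lambda>a. mres X U (p (basic_open A g)) (e a)) g"
      using res g unfolding localizes_def pm_hom_def hom_def by (auto simp: Pi_iff)
  qed
  have locus: "unit_locus X U (e g) = p (basic_open A g)" if g: "g \<in> carrier A" for g
  proof
    have "mres X U (p (basic_open A g)) (e g) \<in> Units (msec X (p (basic_open A g)))"
      using loc[OF g] by (simp add: localizes_def)
    then show "p (basic_open A g) \<subseteq> unit_locus X U (e g)" unfolding unit_locus_def using pg[OF g] by blast
    show "unit_locus X U (e g) \<subseteq> p (basic_open A g)"
    proof
      fix x assume "x \<in> unit_locus X U (e g)"
      then obtain N where N: "openin (mtop X) N" "x \<in> N" "N \<subseteq> U" "mres X U N (e g) \<in> Units (msec X N)"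
        by (auto simp: unit_locus_def)
      \<comment> \<open>Units are understood over basic open sets, so \<open>N\<close> is shrunk to
        the preimage of one around \<open>\<psi> x\<close>; restriction preserves units.\<close>
      have "openin (subtopology (mtop X) U) N" using N Uo by (simp add: openin_open_subtopology)
      then have "openin (mspec_top A) (\<psi> ` N)"
        using homeomorphic_imp_open_map[OF h] by (simp add: open_map_def)
      moreover have "\<psi> x \<in> \<psi> ` N" using N(2) by blast
      ultimately obtain f where f: "f \<in> carrier A" "\<psi> x \<in> basic_open A f" "basic_open A f \<subseteq> \<psi> ` N"
        by (rule A.openin_mspecE)
      have "p (basic_open A f) \<subseteq> N"
      proof
        fix y assume "y \<in> p (basic_open A f)"
        then obtain z where "y \<in> U" "z \<in> N" "\<psi> y = \<psi> z" using f(3) by (auto simp: p)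
        then show "y \<in> N" using homeomorphic_imp_injective_map[OF h] N(3) Ut by (metis inj_onD subsetD)
      qed
      then have "mres X U (p (basic_open A f)) (e g) \<in> Units (msec X (p (basic_open A f)))"
        using res_Units[OF N(1) pg(1)[OF f(1)] _ N(4)] res_res[OF Uo N(1) pg(1)[OF f(1)] N(3), of "e g"]
          pm_homD(1)[OF eh g] by simp
      then have "\<Phi> (basic_open A f) (A.spec_section f g) \<in> Units (msec X (p (basic_open A f)))"
        using res[OF g f(1)] by simp
      then have u: "A.spec_section f g \<in> Units (mspec_sec A (basic_open A f))"
        using pm_iso_Units_iff[OF iso[OF A.openin_basic[OF f(1)]] A.pointed_monoid_mspec_sec_basic[OF f(1)]
            sec[OF pg(1)[OF f(1)]], of "A.spec_section f g"] pm_homD(1)[OF localizes_pm_hom[OF A.localizes_mspec_sec[OF f(1)]] g]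
        by simp
      have "pm_prime A (\<psi> x)" using f(2) by (simp add: basic_open_def)
      then have "g \<notin> \<psi> x"
        by (rule A.spec_section_unit_imp[OF g f(2) _ u]) (use f(2) in \<open>simp add: A.spec_section_def\<close>)
      then show "x \<in> p (basic_open A g)" using f(2) N by (auto simp: p basic_open_def)
    qed
  qed
  have prime: "pm_prime A (\<psi> x)" if "x \<in> U" for x
    using that pT by (auto simp: p Tt A.topspace_mspec)
  show thesis
  proof (rule that[OF A h e]; intro ballI)
    fix g assume g: "g \<in> carrier A"
    show "unit_locus X U (e g) = {x \<in> U. g \<notin> \<psi> x}"
      using prime by (auto simp: locus[OF g] p basic_open_def)
    show "openin (mtop X) (unit_locus X U (e g))" using pg[OF g] by (simp add: locus[OF g])
    show "localizes (msec X U) (msec X (unit_locus X U (e g))) (mres X U (unit_locus X U (e g))) (e g)"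
      using loc[OF g] by (simp add: locus[OF g])
  qed
qed

text \<open>Transported from \<open>openin_mspecE\<close>; injectivity of the chart brings the basic
  open set back inside \<open>N\<close>.\<close>

lemma affine_basis:
  assumes U: "affine_open X U" and N: "openin (mtop X) N" "x \<in> N" "N \<subseteq> U"
  obtains h where "h \<in> carrier (msec X U)" "x \<in> unit_locus X U h" "unit_locus X U h \<subseteq> N"
proof -
  have Uo: "openin (mtop X) U" using U by (simp add: affine_open_def)
  obtain A :: "'s pmonoid" and \<psi> e where A: "pointed_monoid A"
    and h: "homeomorphic_map (subtopology (mtop X) U) (mspec_top A) \<psi>" and e: "e \<in> pm_iso A (msec X U)"
    and l: "\<forall>h \<in> carrier A. unit_locus X U (e h) = {x \<in> U. h \<notin> \<psi> x}" by (rule affine_chart[OF U]) (rule that)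
  note l = l[rule_format]
  interpret A: pointed_monoid A by fact
  have Ut: "topspace (subtopology (mtop X) U) = U" using Uo by (auto dest: openin_subset)
  have "openin (subtopology (mtop X) U) N" using N Uo by (simp add: openin_open_subtopology)
  then have "openin (mspec_top A) (\<psi> ` N)"
    using homeomorphic_imp_open_map[OF h] by (simp add: open_map_def)
  moreover have "\<psi> x \<in> \<psi> ` N" using N(2) by blast
  ultimately obtain f where f: "f \<in> carrier A" "\<psi> x \<in> basic_open A f" "basic_open A f \<subseteq> \<psi> ` N"
    by (rule A.openin_mspecE)
  have "\<psi> ` U = {P. pm_prime A P}" using homeomorphic_imp_surjective_map[OF h] Ut A.topspace_mspec by simp
  then have sub: "unit_locus X U (e f) \<subseteq> N"
  proof -
    have "y \<in> N" if y: "y \<in> U" "f \<notin> \<psi> y" for y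
    proof -
      have "\<psi> y \<in> basic_open A f" using y \<open>\<psi> ` U = _\<close> by (auto simp: basic_open_def)
      then obtain z where "z \<in> N" "\<psi> y = \<psi> z" using f(3) by blast
      then show "y \<in> N" using homeomorphic_imp_injective_map[OF h] N(3) Ut y(1) by (metis inj_onD subsetD)
    qed
    then show ?thesis using l[OF f(1)] by blast
  qed
  show thesis
    by (rule that[OF _ _ sub])
      (use e f N l in \<open>auto simp: pm_iso_def pm_homD basic_open_def\<close>)
qed

lemma affine_localizes:
  assumes U: "affine_open X U" and s: "s \<in> carrier (msec X U)"
  shows "openin (mtop X) (unit_locus X U s)"
    and "localizes (msec X U) (msec X (unit_locus X U s)) (mres X U (unit_locus X U s)) s"
proof -
  obtain A :: "'s pmonoid" and \<psi> e where A: "pointed_monoid A"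
    and e: "e \<in> pm_iso A (msec X U)"
    and l: "\<forall>h \<in> carrier A. openin (mtop X) (unit_locus X U (e h))"
    "\<forall>h \<in> carrier A. localizes (msec X U) (msec X (unit_locus X U (e h)))
       (mres X U (unit_locus X U (e h))) (e h)" by (rule affine_chart[OF U]) (rule that)
  note l = l[rule_format]
  obtain a where "a \<in> carrier A" "s = e a" using e s by (auto simp: pm_iso_def bij_betw_def)
  then show "openin (mtop X) (unit_locus X U s)"
    "localizes (msec X U) (msec X (unit_locus X U s)) (mres X U (unit_locus X U s)) s" using l by auto
qed

text \<open>Points of a spectrum are primes, and this expresses the bijection through
  \<open>unit_locus\<close> alone. It yields the closed point of an affine set, from the nonunits,
  and the centre of a congruence, from its zero class.\<close>

lemma affine_prime:
  assumes U: "affine_open X U" and P: "pm_prime (msec X U) P"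
  shows "\<exists>!x. x \<in> U \<and> (\<forall>s \<in> carrier (msec X U). x \<in> unit_locus X U s \<longleftrightarrow> s \<notin> P)"
proof -
  have Uo: "openin (mtop X) U" using U by (simp add: affine_open_def)
  obtain A :: "'s pmonoid" and \<psi> e where A: "pointed_monoid A"
    and h: "homeomorphic_map (subtopology (mtop X) U) (mspec_top A) \<psi>" and e: "e \<in> pm_iso A (msec X U)"
    and l: "\<forall>h \<in> carrier A. unit_locus X U (e h) = {x \<in> U. h \<notin> \<psi> x}" by (rule affine_chart[OF U]) (rule that)
  note l = l[rule_format]
  interpret A: pointed_monoid A by fact
  have Ut: "topspace (subtopology (mtop X) U) = U" using Uo by (auto dest: openin_subset)
  have im: "\<psi> ` U = {Q. pm_prime A Q}" using homeomorphic_imp_surjective_map[OF h] Ut A.topspace_mspec by simp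
  have inj: "inj_on \<psi> U" using homeomorphic_imp_injective_map[OF h] Ut by simp
  have eh: "e \<in> pm_hom A (msec X U)" and bij: "e ` carrier A = carrier (msec X U)"
    using e by (auto simp: pm_iso_def bij_betw_def)
  note e' = pm_homD[OF eh]
  \<comment> \<open>The prime of \<open>A\<close> that matches \<open>P\<close>; since
    \<open>e\<close> is onto, this preimage stays proper.\<close>
  let ?Q = "{a \<in> carrier A. e a \<in> P}"
  have "pm_prime A ?Q"
  proof -
    have "P \<noteq> carrier (msec X U)" "P \<subseteq> carrier (msec X U)" using P by (auto simp: pm_prime_def pm_ideal_def)
    then obtain a where "a \<in> carrier A" "e a \<notin> P" unfolding bij[symmetric] by blast
    then have "?Q \<noteq> carrier A" by blast
    then show ?thesis using P e' unfolding pm_prime_def pm_ideal_def by auto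
  qed
  then obtain x where x: "x \<in> U" "\<psi> x = ?Q" using im by (metis (mono_tags, lifting) imageE mem_Collect_eq)
  have mem: "x \<in> unit_locus X U s \<longleftrightarrow> s \<notin> P" if s: "s \<in> carrier (msec X U)" for s
  proof -
    obtain a where a: "a \<in> carrier A" "s = e a" using bij s by blast
    then show ?thesis using l[OF a(1)] x by auto
  qed
  have uniq: "y = x" if y: "y \<in> U" "\<forall>s \<in> carrier (msec X U). y \<in> unit_locus X U s \<longleftrightarrow> s \<notin> P" for y
  proof -
    have "pm_prime A (\<psi> y)" using im y(1) by blast
    then have "\<psi> y \<subseteq> carrier A" by (simp add: pm_prime_def pm_ideal_def)
    moreover have "a \<in> \<psi> y \<longleftrightarrow> e a \<in> P" if "a \<in> carrier A" for a
      using y l[OF that] e'(1)[OF that] by auto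
    ultimately have "\<psi> y = ?Q" by blast
    then show ?thesis using x y(1) inj by (simp add: inj_on_def)
  qed
  show ?thesis
  proof (rule ex1I[of _ x])
    show "x \<in> U \<and> (\<forall>s \<in> carrier (msec X U). x \<in> unit_locus X U s \<longleftrightarrow> s \<notin> P)" using mem x(1) by blast
  qed (rule uniq; blast)
qed

end

section \<open>Gluing\<close>

context pointed_monoid
begin

text \<open>The maximal ideal of a local pointed monoid. Through \<open>affine_prime\<close> it
  gives a point such that a section invertible near it is a unit.\<close>

lemma pm_prime_nonunits:
  assumes ne: "\<one> \<noteq> pzero A"
  shows "pm_prime A (carrier A - Units A)"
  unfolding pm_prime_def pm_ideal_def
proof (intro conjI ballI impI)
  have "pzero A \<notin> Units A"
  proof
    assume u: "pzero A \<in> Units A"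
    then have "pzero A = pzero A \<otimes> inv (pzero A)" by (simp only: pzero_absorb Units_inv_closed)
    also have "\<dots> = \<one>" using u by (rule Units_r_inv)
    finally show False using ne by simp
  qed
  then show "pzero A \<in> carrier A - Units A" by simp
  show "carrier A - Units A \<noteq> carrier A" using Units_one_closed one_closed by blast
  show "a \<otimes> x \<in> carrier A - Units A" if a: "a \<in> carrier A" and x: "x \<in> carrier A - Units A" for a x
  proof -
    have "a \<otimes> x \<notin> Units A"
    proof
      assume u: "a \<otimes> x \<in> Units A"
      let ?y = "a \<otimes> inv (a \<otimes> x)"
      have "x \<otimes> ?y = (a \<otimes> x) \<otimes> inv (a \<otimes> x)"
        using m_lcomm[of x a "inv (a \<otimes> x)"] m_assoc[of a x "inv (a \<otimes> x)"] a x Units_inv_closed[OF u] by simp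
      then have "x \<otimes> ?y = \<one>" using u by simp
      moreover from this have "?y \<otimes> x = \<one>" using a x u m_comm[of x ?y] by simp
      moreover have "?y \<in> carrier A" using a u by simp
      ultimately show False using x unfolding Units_def by blast
    qed
    then show ?thesis using a x by simp
  qed
qed auto

text \<open>Prime because a field has no zero divisors, proper because \<open>\<one>\<close> is not
  congruent to zero.\<close>

lemma pm_prime_zero_class:
  assumes c: "k_congruence k A \<phi> c"
  shows "pm_prime A {a \<in> carrier A. (a, pzero A) \<in> c}"
  unfolding pm_prime_def pm_ideal_def
  using k_congruence_mult_zero_iff[OF c] k_congruence_one[OF c] k_congruence_refl[OF c] one_closed by auto

end

context presheafed_space
begin

text \<open>Being defined by neighbourhoods, unit loci restrict well; with basic open sets of
  charts, two unrelated spectra would have to be compared.\<close>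

lemma unit_locus_res:
  assumes U: "openin (mtop X) U" and V: "openin (mtop X) V" and UV: "U \<subseteq> V" and s: "s \<in> carrier (msec X V)"
  shows "unit_locus X U (mres X V U s) = unit_locus X V s \<inter> U"
proof (intro equalityI subsetI)
  fix x assume "x \<in> unit_locus X U (mres X V U s)"
  then obtain N where N: "openin (mtop X) N" "x \<in> N" "N \<subseteq> U" "mres X U N (mres X V U s) \<in> Units (msec X N)"
    by (auto simp: unit_locus_def)
  moreover have "mres X U N (mres X V U s) = mres X V N s" by (rule res_res[OF V U N(1) UV N(3) s])
  ultimately show "x \<in> unit_locus X V s \<inter> U" using UV unfolding unit_locus_def by auto
next
  fix x assume "x \<in> unit_locus X V s \<inter> U"
  then obtain N where N: "openin (mtop X) N" "x \<in> N" "N \<subseteq> V" "mres X V N s \<in> Units (msec X N)" and x: "x \<in> U"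
    by (auto simp: unit_locus_def)
  have NU: "openin (mtop X) (N \<inter> U)" using N(1) U by blast
  have "mres X N (N \<inter> U) (mres X V N s) = mres X V (N \<inter> U) s" by (rule res_res[OF V N(1) NU N(3) _ s]) blast
  moreover have "mres X U (N \<inter> U) (mres X V U s) = mres X V (N \<inter> U) s" by (rule res_res[OF V U NU UV _ s]) blast
  ultimately have "mres X U (N \<inter> U) (mres X V U s) \<in> Units (msec X (N \<inter> U))"
    using res_Units[OF N(1) NU _ N(4)] by simp
  then show "x \<in> unit_locus X U (mres X V U s)" using NU N(2) x unfolding unit_locus_def by blast
qed

lemma unit_locus_unit:
  assumes U: "openin (mtop X) U" and s: "s \<in> Units (msec X U)"
  shows "unit_locus X U s = U"
proof -
  interpret pointed_monoid "msec X U" by (rule sec[OF U])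
  have "mres X U U s \<in> Units (msec X U)" using s res_id[OF U Units_closed[OF s]] by simp
  then show ?thesis using U unfolding unit_locus_def by blast
qed

lemma affine_subset_localizes:
  assumes U: "affine_open X U" and V: "affine_open X V" and UV: "U \<subseteq> V"
    and ne: "\<one>\<^bsub>msec X U\<^esub> \<noteq> pzero (msec X U)"
  obtains h where "unit_locus X V h = U" "localizes (msec X V) (msec X U) (mres X V U) h"
proof -
  have Uo: "openin (mtop X) U" and Vo: "openin (mtop X) V" using U V by (auto simp: affine_open_def)
  interpret MU: pointed_monoid "msec X U" by (rule sec[OF Uo])
  obtain x where x: "x \<in> U"
    "\<And>s. s \<in> carrier (msec X U) \<Longrightarrow> x \<in> unit_locus X U s \<longleftrightarrow> s \<in> Units (msec X U)"
    using affine_prime[OF U MU.pm_prime_nonunits[OF ne]] by auto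
  \<comment> \<open>A locus taken in \<open>V\<close> but inside \<open>U\<close>, around the closed
    point \<open>x\<close> of \<open>U\<close>. Invertibility near \<open>x\<close> makes the
    restriction of \<open>h\<close> a unit on \<open>U\<close>, so the locus fills
    \<open>U\<close>.\<close>
  obtain h where h: "h \<in> carrier (msec X V)" "x \<in> unit_locus X V h" "unit_locus X V h \<subseteq> U"
    using affine_basis[OF V Uo x(1) UV] .
  let ?r = "mres X V U h"
  have r: "?r \<in> carrier (msec X U)" using pm_homD(1)[OF res_hom[OF Vo Uo UV] h(1)] .
  have loc: "unit_locus X U ?r = unit_locus X V h" using unit_locus_res[OF Uo Vo UV h(1)] h(3) by blast
  then have "?r \<in> Units (msec X U)" using x(2)[OF r] h(2) by simp
  then have eq: "unit_locus X V h = U" using unit_locus_unit[OF Uo] loc by simp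
  show thesis using that[OF eq] affine_localizes(2)[OF V h(1)] eq by simp
qed

end

section \<open>Transition maps and the quotient topology\<close>

text \<open>\<open>global\<close> records that \<open>\<phi>\<close> turns elements of
  \<open>k\<close> into global sections. All structure maps are restrictions of these, hence
  compatible with the transition maps.\<close>

locale congruence_space = presheafed_space X for X :: "('x, 's) mspace" +
  fixes k :: "'k pmonoid" and \<phi>
  assumes global: "l \<in> carrier k \<Longrightarrow>
    \<phi> (topspace (mspec_top k)) (\<lambda>P \<in> topspace (mspec_top k). fraction k (carrier k - P) l \<one>\<^bsub>k\<^esub>)
      \<in> carrier (msec X (topspace (mtop X)))"
begin

abbreviation "\<sigma> \<equiv> structure_map k X \<phi>"
abbreviation "kc U \<equiv> k_congruence k (msec X U) (\<sigma> U)"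
abbreviation "SC U \<equiv> scong k (msec X U) (\<sigma> U)"
abbreviation "pb V U \<equiv> pullback (msec X V) (mres X V U)"

lemma structure_map_closed: "openin (mtop X) U \<Longrightarrow> \<sigma> U \<in> carrier k \<rightarrow> carrier (msec X U)"
  unfolding structure_map_def using pm_homD(1)[OF res_hom[OF openin_topspace _ openin_subset] global] by blast

lemma structure_map_res:
  assumes "openin (mtop X) U" "openin (mtop X) V" "U \<subseteq> V" "l \<in> carrier k"
  shows "\<sigma> U l = mres X V U (\<sigma> V l)"
  unfolding structure_map_def
  by (rule res_res[symmetric]) (use assms global in \<open>auto dest: openin_subset\<close>)

text \<open>A \<open>k\<close>-congruence separates \<open>\<one>\<close> from zero, so its
  existence rules out the trivial monoid excluded in \<open>affine_subset_localizes\<close>.\<close>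

lemma affine_localization_map:
  assumes U: "affine_open X U" and V: "affine_open X V" and UV: "U \<subseteq> V" and c: "kc U c"
  obtains h where "unit_locus X V h = U" "localization_map (msec X V) (msec X U) (mres X V U) h"
proof -
  have Uo: "openin (mtop X) U" and Vo: "openin (mtop X) V" using U V by (auto simp: affine_open_def)
  interpret MU: pointed_monoid "msec X U" by (rule sec[OF Uo])
  have "\<one>\<^bsub>msec X U\<^esub> \<noteq> pzero (msec X U)"
    using MU.k_congruence_one[OF c] MU.k_congruence_refl[OF c MU.one_closed] by metis
  then obtain h where "unit_locus X V h = U" "localizes (msec X V) (msec X U) (mres X V U) h"
    using affine_subset_localizes[OF U V UV] by blast
  then show thesis
    using that sec[OF Uo] sec[OF Vo] by (simp add: localization_map_def localization_map_axioms_def)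
qed

lemma pb_open_continuous:
  assumes U: "affine_open X U" and V: "affine_open X V" and UV: "U \<subseteq> V"
  shows "continuous_map (SC U) (SC V) (pb V U)" and "open_map (SC U) (SC V) (pb V U)"
proof -
  have Uo: "openin (mtop X) U" and Vo: "openin (mtop X) V" using U V by (auto simp: affine_open_def)
  show "continuous_map (SC U) (SC V) (pb V U)"
    by (rule continuous_map_pullback[OF sec[OF Vo] sec[OF Uo] res_hom[OF Vo Uo UV] structure_map_closed[OF Vo]
          structure_map_res[OF Uo Vo UV]])
  show "open_map (SC U) (SC V) (pb V U)"
  proof (cases "\<exists>c. kc U c")
    case True
    then obtain h where "localization_map (msec X V) (msec X U) (mres X V U) h"
      using affine_localization_map[OF U V UV] by blast
    then interpret localization_map "msec X V" "msec X U" "mres X V U" h .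
    show ?thesis
      by (rule open_map_pullback[OF structure_map_closed[OF Vo] structure_map_res[OF Uo Vo UV]])
  next
    \<comment> \<open>Without a congruence over \<open>U\<close> its space is empty, and the empty
      set is its only open set.\<close>
    case False
    then have "W = {}" if "openin (SC U) W" for W
      using openin_subset[OF that] by (auto simp: topspace_scong)
    then show ?thesis unfolding open_map_def by fastforce
  qed
qed

lemma kc_pb:
  assumes "affine_open X U" "affine_open X V" "U \<subseteq> V" "kc U c"
  shows "kc V (pb V U c)"
  using continuous_map_image_subset_topspace[OF pb_open_continuous(1)[OF assms(1-3)]] assms(4)
  by (auto simp: topspace_scong)

abbreviation "S \<equiv> scong_sum k X \<phi>"
abbreviation "G \<equiv> scong_glue k X \<phi>"

lemma topspace_S: "topspace S = {(U, c). affine_open X U \<and> kc U c}"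
  by (auto simp: scong_sum_def topspace_scong)

lemma openin_S: "openin S W \<longleftrightarrow> W \<subseteq> topspace S \<and> (\<forall>U. affine_open X U \<longrightarrow> openin (SC U) {c. (U, c) \<in> W})"
  unfolding scong_sum_def openin_sum_topology topspace_sum_topology by blast

text \<open>One step up the inclusions, by openness of the transition maps; the step down,
  \<open>glue_preimage_open\<close>, uses their continuity.\<close>

lemma glue_image_open:
  assumes W: "openin S W"
  shows "openin S (G `` W)"
proof -
  have WS: "W \<subseteq> topspace S" using W by (rule openin_subset)
  have "openin (SC V) {d. (V, d) \<in> G `` W}" if V: "affine_open X V" for V
  proof -
    have "{d. (V, d) \<in> G `` W} = (\<Union>U \<in> {U. affine_open X U \<and> U \<subseteq> V}. pb V U ` {c. (U, c) \<in> W})"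
    proof (intro equalityI subsetI)
      fix d assume "d \<in> {d. (V, d) \<in> G `` W}"
      then show "d \<in> (\<Union>U \<in> {U. affine_open X U \<and> U \<subseteq> V}. pb V U ` {c. (U, c) \<in> W})"
        by (auto simp: scong_glue_def)
    next
      fix d assume "d \<in> (\<Union>U \<in> {U. affine_open X U \<and> U \<subseteq> V}. pb V U ` {c. (U, c) \<in> W})"
      then obtain U c where "affine_open X U" "U \<subseteq> V" "(U, c) \<in> W" "d = pb V U c" by blast
      moreover from this have "kc U c" using WS by (auto simp: topspace_S)
      ultimately have "((U, c), (V, d)) \<in> G" using V unfolding scong_glue_def by blast
      then show "d \<in> {d. (V, d) \<in> G `` W}" using \<open>(U, c) \<in> W\<close> by blast
    qed
    moreover have "openin (SC V) (pb V U ` {c. (U, c) \<in> W})" if "affine_open X U" "U \<subseteq> V" for U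
      using pb_open_continuous(2)[OF that(1) V that(2)] W that(1) unfolding openin_S open_map_def by blast
    ultimately show ?thesis by auto
  qed
  moreover have "G `` W \<subseteq> topspace S" using kc_pb by (auto simp: topspace_S scong_glue_def)
  ultimately show ?thesis unfolding openin_S by blast
qed

lemma glue_preimage_open:
  assumes W: "openin S W"
  shows "openin S (G\<inverse> `` W)"
proof -
  have "openin (SC U) {c. (U, c) \<in> G\<inverse> `` W}" if U: "affine_open X U" for U
  proof -
    have "{c. (U, c) \<in> G\<inverse> `` W} =
      (\<Union>V \<in> {V. affine_open X V \<and> U \<subseteq> V}. {c \<in> topspace (SC U). pb V U c \<in> {d. (V, d) \<in> W}})"
      using U by (auto simp: scong_glue_def topspace_scong)
    moreover have "openin (SC U) {c \<in> topspace (SC U). pb V U c \<in> {d. (V, d) \<in> W}}"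
      if "affine_open X V" "U \<subseteq> V" for V
      by (rule openin_continuous_map_preimage[OF pb_open_continuous(1)[OF U that]])
        (use W that(1) in \<open>simp add: openin_S\<close>)
    ultimately show ?thesis by auto
  qed
  moreover have "G\<inverse> `` W \<subseteq> topspace S" by (auto simp: topspace_S scong_glue_def)
  ultimately show ?thesis unfolding openin_S by blast
qed

abbreviation "E \<equiv> (G \<union> G\<inverse>)\<^sup>*"

text \<open>The saturation is a union over the lengths of zigzags. Its openness makes the quotient
  map open, which a quotient topology does not give by itself.\<close>

lemma E_image_open:
  assumes W: "openin S W"
  shows "openin S (E `` W)"
proof -
  have "openin S (((G \<union> G\<inverse>) ^^ n) `` W)" for n
  proof (induction n)
    case 0
    then show ?case using W by simp
  next
    case (Suc n)
    have "((G \<union> G\<inverse>) ^^ Suc n) `` W = G `` (((G \<union> G\<inverse>) ^^ n) `` W) \<union> G\<inverse> `` (((G \<union> G\<inverse>) ^^ n) `` W)"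
      by (auto simp: relcomp_Image)
    then show ?case using openin_Un[OF glue_image_open[OF Suc] glue_preimage_open[OF Suc]] by (simp only:)
  qed
  moreover have "E `` W = (\<Union>n. ((G \<union> G\<inverse>) ^^ n) `` W)" by (auto simp: rtrancl_is_UN_relpow)
  ultimately show ?thesis by auto
qed

lemma E_sym: "(p, p') \<in> E \<Longrightarrow> (p', p) \<in> E"
  by (rule symD[OF sym_rtrancl]) (auto simp: sym_def)

lemma E_class_eq_iff: "E `` {p} = E `` {p'} \<longleftrightarrow> (p, p') \<in> E"
proof
  show "E `` {p} = E `` {p'} \<Longrightarrow> (p, p') \<in> E" by blast
  show "(p, p') \<in> E \<Longrightarrow> E `` {p} = E `` {p'}" using E_sym rtrancl_trans[of _ _ "G \<union> G\<inverse>"] by blast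
qed

lemma open_map_E_class: "open_map S (scong_scheme k X \<phi>) (\<lambda>p. E `` {p})"
  unfolding open_map_def
proof (intro allI impI)
  fix W assume W: "openin S W"
  have WS: "W \<subseteq> topspace S" using W by (rule openin_subset)
  have "{p \<in> topspace S. E `` {p} \<in> (\<lambda>p. E `` {p}) ` W} = E `` W"
  proof (intro equalityI subsetI)
    fix p assume "p \<in> {p \<in> topspace S. E `` {p} \<in> (\<lambda>p. E `` {p}) ` W}"
    then obtain p' where "p' \<in> W" "E `` {p} = E `` {p'}" by blast
    then show "p \<in> E `` W" unfolding E_class_eq_iff using E_sym by blast
  next
    fix p assume p: "p \<in> E `` W"
    then obtain p' where "p' \<in> W" "E `` {p'} = E `` {p}" unfolding E_class_eq_iff by blast
    moreover have "p \<in> topspace S" using p openin_subset[OF E_image_open[OF W]] by blast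
    ultimately show "p \<in> {p \<in> topspace S. E `` {p} \<in> (\<lambda>p. E `` {p}) ` W}" by blast
  qed
  then show "openin (scong_scheme k X \<phi>) ((\<lambda>p. E `` {p}) ` W)"
    using WS E_image_open[OF W] unfolding scong_scheme_def openin_quotient_topology by auto
qed

text \<open>The point of \<open>U\<close> that corresponds to the zero class of \<open>c\<close>, which is a prime ideal.\<close>

definition centre :: "'x set \<Rightarrow> ('s \<times> 's) set \<Rightarrow> 'x \<Rightarrow> bool" where
  "centre U c x \<longleftrightarrow> x \<in> U \<and>
     (\<forall>s \<in> carrier (msec X U). x \<in> unit_locus X U s \<longleftrightarrow> (s, pzero (msec X U)) \<notin> c)"

text \<open>The congruence induced by \<open>c\<close> on the stalk at the centre, on representatives: near the centre
  \<open>s\<close> and \<open>t\<close> are the fractions \<open>a / g\<close> and \<open>b / g\<close> with \<open>a\<close> and \<open>b\<close> congruent.\<close>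

definition germs :: "'x set \<Rightarrow> ('s \<times> 's) set \<Rightarrow> ('x \<times> 'x set \<times> 's \<times> 's) set" where
  "germs U c = {(x, N, s, t). centre U c x \<and> openin (mtop X) N \<and> x \<in> N \<and>
     s \<in> carrier (msec X N) \<and> t \<in> carrier (msec X N) \<and>
     (\<exists>N' a b g. openin (mtop X) N' \<and> x \<in> N' \<and> N' \<subseteq> N \<and> N' \<subseteq> U \<and>
        a \<in> carrier (msec X U) \<and> b \<in> carrier (msec X U) \<and> g \<in> carrier (msec X U) \<and>
        (g, pzero (msec X U)) \<notin> c \<and> (a, b) \<in> c \<and>
        mres X N N' s \<otimes>\<^bsub>msec X N'\<^esub> mres X U N' g = mres X U N' a \<and>
        mres X N N' t \<otimes>\<^bsub>msec X N'\<^esub> mres X U N' g = mres X U N' b)}"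

section \<open>Invariance of the germ data under transition maps\<close>

lemma centre_ex1:
  assumes U: "affine_open X U" and c: "kc U c"
  shows "\<exists>!x. centre U c x"
proof -
  have Uo: "openin (mtop X) U" using U by (simp add: affine_open_def)
  interpret MU: pointed_monoid "msec X U" by (rule sec[OF Uo])
  have "centre U c x \<longleftrightarrow> x \<in> U \<and> (\<forall>s \<in> carrier (msec X U). x \<in> unit_locus X U s \<longleftrightarrow>
      s \<notin> {s \<in> carrier (msec X U). (s, pzero (msec X U)) \<in> c})" for x
    by (auto simp: centre_def)
  then show ?thesis using affine_prime[OF U MU.pm_prime_zero_class[OF c]] by simp
qed

lemma centre_pb:
  assumes U: "affine_open X U" and V: "affine_open X V" and UV: "U \<subseteq> V" and c: "kc U c"
  shows "centre V (pb V U c) x \<longleftrightarrow> centre U c x"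
proof -
  have Uo: "openin (mtop X) U" and Vo: "openin (mtop X) V" using U V by (auto simp: affine_open_def)
  interpret MV: pointed_monoid "msec X V" by (rule sec[OF Vo])
  note r = pm_homD[OF res_hom[OF Vo Uo UV]]
  have imp: "centre V (pb V U c) x" if x: "centre U c x" for x
    unfolding centre_def
  proof (intro conjI ballI)
    have xU: "x \<in> U" using x by (simp add: centre_def)
    then show "x \<in> V" using UV by blast
    show "x \<in> unit_locus X V s \<longleftrightarrow> (s, pzero (msec X V)) \<notin> pb V U c" if s: "s \<in> carrier (msec X V)" for s
    proof -
      have "x \<in> unit_locus X V s \<longleftrightarrow> x \<in> unit_locus X U (mres X V U s)"
        using unit_locus_res[OF Uo Vo UV s] xU by simp
      also have "\<dots> \<longleftrightarrow> (mres X V U s, pzero (msec X U)) \<notin> c" using x r(1)[OF s] by (simp add: centre_def)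
      finally show ?thesis using s r(4) by (simp add: pullback_def)
    qed
  qed
  \<comment> \<open>One implication has been shown; as centres exist uniquely on both sides, it is
    an equivalence.\<close>
  then show ?thesis using centre_ex1[OF U c] centre_ex1[OF V kc_pb[OF U V UV c]] by metis
qed

text \<open>From \<open>V\<close> to \<open>U\<close> a description by fractions is restricted. From
  \<open>U\<close> to \<open>V\<close> it must be lifted: both numerators and the denominator are
  multiplied by one power of the restriction of \<open>h\<close>, after which all three come from
  \<open>V\<close>. That power is a unit on \<open>U\<close> and so affects neither the fractions
  nor the congruence.\<close>

lemma germs_pb:
  assumes U: "affine_open X U" and V: "affine_open X V" and UV: "U \<subseteq> V" and c: "kc U c"
  shows "germs V (pb V U c) = germs U c"
proof -
  have Uo: "openin (mtop X) U" and Vo: "openin (mtop X) V" using U V by (auto simp: affine_open_def)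
  obtain h where "unit_locus X V h = U" and "localization_map (msec X V) (msec X U) (mres X V U) h"
    using affine_localization_map[OF U V UV c] .
  then interpret localization_map "msec X V" "msec X U" "mres X V U" h by simp
  note cen = centre_pb[OF U V UV c]
  have eq: "mres X U N (mres X V U a) = mres X V N a" if "openin (mtop X) N" "N \<subseteq> U" "a \<in> carrier (msec X V)" for N a
    by (rule res_res[OF Vo Uo that(1) UV that(2,3)])
  have "(x, N, s, t) \<in> germs V (pb V U c)" if "(x, N, s, t) \<in> germs U c" for x N s t
  proof -
    from that obtain N' a b g where x: "centre U c x" and N: "openin (mtop X) N" "x \<in> N"
      and st: "s \<in> carrier (msec X N)" "t \<in> carrier (msec X N)"
      and N': "openin (mtop X) N'" "x \<in> N'" "N' \<subseteq> N" "N' \<subseteq> U"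
      and abg: "a \<in> carrier (msec X U)" "b \<in> carrier (msec X U)" "g \<in> carrier (msec X U)"
      "(g, pzero (msec X U)) \<notin> c" "(a, b) \<in> c"
      and sa: "mres X N N' s \<otimes>\<^bsub>msec X N'\<^esub> mres X U N' g = mres X U N' a"
      and tb: "mres X N N' t \<otimes>\<^bsub>msec X N'\<^esub> mres X U N' g = mres X U N' b"
      unfolding germs_def by blast
    interpret M': pointed_monoid "msec X N'" by (rule sec[OF N'(1)])
    obtain n a' b' g' where abg': "a' \<in> carrier (msec X V)" "b' \<in> carrier (msec X V)" "g' \<in> carrier (msec X V)"
      and e: "mres X V U h [^]\<^bsub>msec X U\<^esub> (n :: nat) \<otimes>\<^bsub>msec X U\<^esub> a = mres X V U a'"
        "mres X V U h [^]\<^bsub>msec X U\<^esub> n \<otimes>\<^bsub>msec X U\<^esub> b = mres X V U b'"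
        "mres X V U h [^]\<^bsub>msec X U\<^esub> n \<otimes>\<^bsub>msec X U\<^esub> g = mres X V U g'" using clear_denominators3[OF abg(1-3)] .
    define u where "u = mres X V U h [^]\<^bsub>msec X U\<^esub> n"
    have u: "u \<in> carrier (msec X U)" "(u, pzero (msec X U)) \<notin> c"
      using rD(1)[OF hB] pow_nonzero[OF c] by (simp_all add: u_def)
    note p = pm_homD[OF res_hom[OF Uo N'(1,4)]] and pN = pm_homD[OF res_hom[OF N(1) N'(1,3)]]
    \<comment> \<open>Multiplying the equation by the restriction of \<open>u\<close> replaces
      \<open>g\<close> and \<open>d\<close> by their lifts.\<close>
    have key: "mres X N N' w \<otimes>\<^bsub>msec X N'\<^esub> mres X V N' g' = mres X V N' d'"
      if w: "w \<in> carrier (msec X N)" and d: "d \<in> carrier (msec X U)" "d' \<in> carrier (msec X V)"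
        "u \<otimes>\<^bsub>msec X U\<^esub> d = mres X V U d'"
        "mres X N N' w \<otimes>\<^bsub>msec X N'\<^esub> mres X U N' g = mres X U N' d" for w d d'
    proof -
      have "mres X V N' g' = mres X U N' u \<otimes>\<^bsub>msec X N'\<^esub> mres X U N' g"
        unfolding eq[OF N'(1,4) abg'(3), symmetric] e(3)[symmetric] u_def[symmetric] by (rule p(2)[OF u(1) abg(3)])
      moreover have "mres X V N' d' = mres X U N' u \<otimes>\<^bsub>msec X N'\<^esub> mres X U N' d"
        unfolding eq[OF N'(1,4) d(2), symmetric] d(3)[symmetric] by (rule p(2)[OF u(1) d(1)])
      ultimately show ?thesis unfolding d(4)[symmetric]
        using M'.m_lcomm[OF pN(1)[OF w] p(1)[OF u(1)] p(1)[OF abg(3)]] by simp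
    qed
    have "(g', pzero (msec X V)) \<notin> pb V U c"
      using C.k_congruence_mult_zero_iff[OF c u(1) abg(3)] u(2) abg(4) e(3)[folded u_def]
      by (simp add: pullback_def rD(4))
    moreover have "(a', b') \<in> pb V U c"
      using C.k_congruence_cancel[OF c u abg(1,2)] abg(5) e(1,2)[folded u_def] abg' by (simp add: pullback_def)
    moreover have "centre V (pb V U c) x" using x cen by simp
    ultimately show ?thesis unfolding germs_def
      using N st N' UV abg' key[OF st(1) abg(1) abg'(1) e(1)[folded u_def] sa]
        key[OF st(2) abg(2) abg'(2) e(2)[folded u_def] tb] by blast
  qed
  moreover have "(x, N, s, t) \<in> germs U c" if "(x, N, s, t) \<in> germs V (pb V U c)" for x N s t
  proof -
    from that obtain N' a b g where xV: "centre V (pb V U c) x" and N: "openin (mtop X) N" "x \<in> N"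
      and st: "s \<in> carrier (msec X N)" "t \<in> carrier (msec X N)"
      and N': "openin (mtop X) N'" "x \<in> N'" "N' \<subseteq> N" "N' \<subseteq> V"
      and abg: "a \<in> carrier (msec X V)" "b \<in> carrier (msec X V)" "g \<in> carrier (msec X V)"
      "(g, pzero (msec X V)) \<notin> pb V U c" "(a, b) \<in> pb V U c"
      and sa: "mres X N N' s \<otimes>\<^bsub>msec X N'\<^esub> mres X V N' g = mres X V N' a"
      and tb: "mres X N N' t \<otimes>\<^bsub>msec X N'\<^esub> mres X V N' g = mres X V N' b"
      unfolding germs_def by blast
    have x: "centre U c x" using xV cen by simp
    \<comment> \<open>\<open>N'\<close> may leave \<open>U\<close>; the centre lies in
      \<open>U\<close>, so the intersection is still a neighbourhood of it.\<close>
    let ?N = "N' \<inter> U"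
    have No: "openin (mtop X) ?N" and xN: "x \<in> ?N" using N' Uo x by (auto simp: centre_def)
    note p = pm_homD[OF res_hom[OF N'(1) No Int_lower1]] and pN = pm_homD[OF res_hom[OF N(1) N'(1,3)]]
      and pV = pm_homD[OF res_hom[OF Vo N'(1,4)]]
    have key: "mres X N ?N w \<otimes>\<^bsub>msec X ?N\<^esub> mres X U ?N (mres X V U g) = mres X U ?N (mres X V U d)"
      if w: "w \<in> carrier (msec X N)" and d: "d \<in> carrier (msec X V)"
        "mres X N N' w \<otimes>\<^bsub>msec X N'\<^esub> mres X V N' g = mres X V N' d" for w d
    proof -
      have "mres X N ?N w = mres X N' ?N (mres X N N' w)" by (rule res_res[OF N(1) N'(1) No N'(3) Int_lower1 w, symmetric])
      moreover have "mres X U ?N (mres X V U y) = mres X N' ?N (mres X V N' y)" if "y \<in> carrier (msec X V)" for y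
        unfolding eq[OF No Int_lower2 that] by (rule res_res[OF Vo N'(1) No N'(4) Int_lower1 that, symmetric])
      ultimately show ?thesis using p(2)[OF pN(1)[OF w] pV(1)[OF abg(3)]] d abg(3) by simp
    qed
    have "(mres X V U g, pzero (msec X U)) \<notin> c" "(mres X V U a, mres X V U b) \<in> c"
      using abg by (auto simp: pullback_def rD(4))
    then show ?thesis unfolding germs_def mem_Collect_eq case_prod_conv
      using x N st No xN N'(3) rD(1)[OF abg(1)] rD(1)[OF abg(2)] rD(1)[OF abg(3)]
        key[OF st(1) abg(1) sa] key[OF st(2) abg(2) tb] by (intro conjI exI[of _ ?N]) (assumption | blast)+
  qed
  ultimately show ?thesis by (intro equalityI subsetI) (metis prod_cases4)+
qed

text \<open>A congruence can be read off from its germs. One direction takes the denominator one. In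
  the other, equations near the centre hold over \<open>U\<close> after multiplication by powers of
  some \<open>h\<close> invertible near the centre; such powers are not congruent to zero and can be
  cancelled.\<close>

lemma germs_iff:
  assumes U: "affine_open X U" and c: "kc U c" and st: "s \<in> carrier (msec X U)" "t \<in> carrier (msec X U)"
    and x: "centre U c x"
  shows "(x, U, s, t) \<in> germs U c \<longleftrightarrow> (s, t) \<in> c"
proof
  have Uo: "openin (mtop X) U" using U by (simp add: affine_open_def)
  interpret MU: pointed_monoid "msec X U" by (rule sec[OF Uo])
  have xU: "x \<in> U" using x by (simp add: centre_def)
  {
    assume "(s, t) \<in> c"
    moreover have "mres X U U w \<otimes>\<^bsub>msec X U\<^esub> mres X U U \<one>\<^bsub>msec X U\<^esub> = mres X U U w" if "w \<in> carrier (msec X U)" for w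
      using that res_id[OF Uo] by simp
    ultimately show "(x, U, s, t) \<in> germs U c" unfolding germs_def mem_Collect_eq case_prod_conv
      using x xU Uo st MU.k_congruence_one[OF c] MU.one_closed subset_refl by metis
  }
  assume "(x, U, s, t) \<in> germs U c"
  then obtain N a b g where N: "openin (mtop X) N" "x \<in> N" "N \<subseteq> U"
    and abg: "a \<in> carrier (msec X U)" "b \<in> carrier (msec X U)" "g \<in> carrier (msec X U)"
    "(g, pzero (msec X U)) \<notin> c" "(a, b) \<in> c"
    and sa: "mres X U N s \<otimes>\<^bsub>msec X N\<^esub> mres X U N g = mres X U N a"
    and tb: "mres X U N t \<otimes>\<^bsub>msec X N\<^esub> mres X U N g = mres X U N b"
    unfolding germs_def by blast
  obtain h where h: "h \<in> carrier (msec X U)" "x \<in> unit_locus X U h" "unit_locus X U h \<subseteq> N"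
    using affine_basis[OF U N] .
  let ?D = "unit_locus X U h"
  have Do: "openin (mtop X) ?D" by (rule affine_localizes(1)[OF U h(1)])
  interpret localization_map "msec X U" "msec X ?D" "mres X U ?D" h
    using affine_localizes(2)[OF U h(1)] sec[OF Uo] sec[OF Do]
    by (simp add: localization_map_def localization_map_axioms_def)
  have hc: "(h, pzero (msec X U)) \<notin> c" using x h by (simp add: centre_def)
  note p = pm_homD[OF res_hom[OF Uo N(1,3)]] and q = pm_homD[OF res_hom[OF N(1) Do h(3)]]
  have key: "\<exists>n :: nat. h [^]\<^bsub>msec X U\<^esub> n \<otimes>\<^bsub>msec X U\<^esub> (w \<otimes>\<^bsub>msec X U\<^esub> g) = h [^]\<^bsub>msec X U\<^esub> n \<otimes>\<^bsub>msec X U\<^esub> d"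
    if w: "w \<in> carrier (msec X U)" "d \<in> carrier (msec X U)" and e: "mres X U N w \<otimes>\<^bsub>msec X N\<^esub> mres X U N g = mres X U N d" for w d
  proof -
    have "mres X U N (w \<otimes>\<^bsub>msec X U\<^esub> g) = mres X U N d" using p(2)[OF w(1) abg(3)] e by simp
    then have "mres X U ?D (w \<otimes>\<^bsub>msec X U\<^esub> g) = mres X U ?D d"
      using res_res[OF Uo N(1) Do N(3) h(3), of "w \<otimes>\<^bsub>msec X U\<^esub> g"] res_res[OF Uo N(1) Do N(3) h(3) w(2)]
        w(1) abg(3) by simp
    then show ?thesis using r_eqD[of "w \<otimes>\<^bsub>msec X U\<^esub> g" d] w abg(3) by (metis MU.m_closed)
  qed
  obtain m :: nat where m: "h [^]\<^bsub>msec X U\<^esub> m \<otimes>\<^bsub>msec X U\<^esub> (s \<otimes>\<^bsub>msec X U\<^esub> g) = h [^]\<^bsub>msec X U\<^esub> m \<otimes>\<^bsub>msec X U\<^esub> a"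
    using key[OF st(1) abg(1) sa] by blast
  obtain n :: nat where n: "h [^]\<^bsub>msec X U\<^esub> n \<otimes>\<^bsub>msec X U\<^esub> (t \<otimes>\<^bsub>msec X U\<^esub> g) = h [^]\<^bsub>msec X U\<^esub> n \<otimes>\<^bsub>msec X U\<^esub> b"
    using key[OF st(2) abg(2) tb] by blast
  define u v where "u = h [^]\<^bsub>msec X U\<^esub> m" and "v = h [^]\<^bsub>msec X U\<^esub> n"
  note m = m[folded u_def] and n = n[folded v_def]
  have uv: "u \<in> carrier (msec X U)" "(u, pzero (msec X U)) \<notin> c" "v \<in> carrier (msec X U)" "(v, pzero (msec X U)) \<notin> c"
    using h(1) MU.k_congruence_pow[OF c h(1) hc] by (simp_all add: u_def v_def)
  \<comment> \<open>A common multiple of both powers. Then \<open>w g s = w a\<close> is congruent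
    to \<open>w b = w g t\<close>, and \<open>w g\<close> can be cancelled.\<close>
  define w where "w = u \<otimes>\<^bsub>msec X U\<^esub> v"
  have w: "w \<in> carrier (msec X U)" "(w, pzero (msec X U)) \<notin> c"
    using uv MU.k_congruence_mult_zero_iff[OF c uv(1,3)] by (simp_all add: w_def)
  have wg: "w \<otimes>\<^bsub>msec X U\<^esub> g \<in> carrier (msec X U)" "(w \<otimes>\<^bsub>msec X U\<^esub> g, pzero (msec X U)) \<notin> c"
    using w abg MU.k_congruence_mult_zero_iff[OF c w(1) abg(3)] by simp_all
  have "(w \<otimes>\<^bsub>msec X U\<^esub> a, w \<otimes>\<^bsub>msec X U\<^esub> b) \<in> c" using MU.k_congruence_cancel[OF c w abg(1,2)] abg(5) by simp
  moreover have "w \<otimes>\<^bsub>msec X U\<^esub> a = (w \<otimes>\<^bsub>msec X U\<^esub> g) \<otimes>\<^bsub>msec X U\<^esub> s"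
  proof -
    have "w \<otimes>\<^bsub>msec X U\<^esub> a = v \<otimes>\<^bsub>msec X U\<^esub> (u \<otimes>\<^bsub>msec X U\<^esub> a)" unfolding w_def using uv abg(1) by (simp add: MU.m_ac)
    then show ?thesis unfolding m[symmetric] w_def using uv abg(3) st by (simp add: MU.m_ac)
  qed
  moreover have "w \<otimes>\<^bsub>msec X U\<^esub> b = (w \<otimes>\<^bsub>msec X U\<^esub> g) \<otimes>\<^bsub>msec X U\<^esub> t"
  proof -
    have "w \<otimes>\<^bsub>msec X U\<^esub> b = u \<otimes>\<^bsub>msec X U\<^esub> (v \<otimes>\<^bsub>msec X U\<^esub> b)" unfolding w_def using uv abg(2) by (simp add: MU.m_ac)
    then show ?thesis unfolding n[symmetric] w_def using uv abg(3) st by (simp add: MU.m_ac)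
  qed
  ultimately show "(s, t) \<in> c" using MU.k_congruence_cancel[OF c wg st] by simp
qed

lemma germs_E:
  assumes "((U, c), (V, d)) \<in> E"
  shows "germs U c = germs V d"
proof -
  have "case_prod germs p = case_prod germs p'" if "(p, p') \<in> E" for p p'
    using that
  proof induction
    case (step p' p'')
    have "case_prod germs q' = case_prod germs q" if "(q, q') \<in> G" for q q'
      using that germs_pb by (auto simp: scong_glue_def)
    then show ?case using step by (metis Un_iff converse_iff)
  qed simp
  from this[OF assms] show ?thesis by simp
qed

lemma E_inj:
  assumes U: "affine_open X U" and c: "kc U c" "kc U d" and E: "((U, c), (U, d)) \<in> E"
  shows "c = d"
proof -
  have eq: "germs U c = germs U d" by (rule germs_E[OF E])
  have Uo: "openin (mtop X) U" using U by (simp add: affine_open_def)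
  interpret MU: pointed_monoid "msec X U" by (rule sec[OF Uo])
  obtain x where x: "centre U c x" using centre_ex1[OF U c(1)] by blast
  \<comment> \<open>The pair of ones exhibits \<open>x\<close> in the common set of germs, so both
    congruences have the same centre and \<open>germs_iff\<close> applies to each.\<close>
  have "(x, U, \<one>\<^bsub>msec X U\<^esub>, \<one>\<^bsub>msec X U\<^esub>) \<in> germs U c"
    using germs_iff[OF U c(1) _ _ x] MU.k_congruence_refl[OF c(1)] by simp
  then have xd: "centre U d x" unfolding eq by (simp add: germs_def)
  have "(s, t) \<in> c \<longleftrightarrow> (s, t) \<in> d" if "s \<in> carrier (msec X U)" "t \<in> carrier (msec X U)" for s t
    using germs_iff[OF U c(1) that x] germs_iff[OF U c(2) that xd] eq by simp
  then show ?thesis using k_congruence_subset[OF c(1)] k_congruence_subset[OF c(2)] by blast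
qed

text \<open>The charts are the components of the sum followed by the quotient map: open by
  \<open>open_map_E_class\<close>, injective by \<open>E_inj\<close>, with sober source by
  \<open>sober_scong\<close>.\<close>

lemma sober_scong_scheme: "sober_space (scong_scheme k X \<phi>)"
proof (rule sober_space_local)
  fix y assume "y \<in> topspace (scong_scheme k X \<phi>)"
  have quo: "quotient_map S (scong_scheme k X \<phi>) (\<lambda>p. E `` {p})"
    unfolding scong_scheme_def by (rule quotient_map_quotient_topology)
  then have "y \<in> (\<lambda>p. E `` {p}) ` topspace S"
    using \<open>y \<in> _\<close> quotient_imp_surjective_map by blast
  then obtain U c where U: "affine_open X U" and c: "kc U c" and y: "y = E `` {(U, c)}"
    by (auto simp: topspace_S)
  have Uo: "openin (mtop X) U" using U by (simp add: affine_open_def)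
  let ?e = "\<lambda>c. E `` {(U, c)}"
  have "continuous_map (SC U) S (Pair U)"
    unfolding scong_sum_def using continuous_map_component_injection[of U "{U. affine_open X U}" SC] U by simp
  then have "continuous_map (SC U) (scong_scheme k X \<phi>) ((\<lambda>p. E `` {p}) \<circ> Pair U)"
    by (rule continuous_map_compose[OF _ quotient_imp_continuous_map[OF quo]])
  moreover have "open_map (SC U) S (Pair U)"
    unfolding scong_sum_def using open_map_component_injection[of U "{U. affine_open X U}" SC] U by simp
  then have "open_map (SC U) (scong_scheme k X \<phi>) ((\<lambda>p. E `` {p}) \<circ> Pair U)"
    by (rule open_map_compose[OF _ open_map_E_class])
  moreover have "inj_on ((\<lambda>p. E `` {p}) \<circ> Pair U) (topspace (SC U))"
    using E_inj[OF U] by (auto simp: inj_on_def topspace_scong E_class_eq_iff)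
  moreover have "sober_space (SC U)" by (rule sober_scong[OF sec[OF Uo] structure_map_closed[OF Uo]])
  moreover have "y \<in> ((\<lambda>p. E `` {p}) \<circ> Pair U) ` topspace (SC U)" using c y by (auto simp: topspace_scong)
  ultimately show "\<exists>(T :: ('s \<times> 's) set topology) e. sober_space T \<and> continuous_map T (scong_scheme k X \<phi>) e \<and>
      open_map T (scong_scheme k X \<phi>) e \<and> inj_on e (topspace T) \<and> y \<in> e ` topspace T" by blast
qed

end

theorem theorem5:
  fixes k :: "'k pmonoid"
    and X :: "('x, 's) mspace"
    and f :: "'x \<Rightarrow> 'k set"
    and \<phi> :: "'k set set \<Rightarrow> ('k set \<Rightarrow> ('k \<times> 'k) set) \<Rightarrow> 's"
  assumes "pm_domain k"
    and "k_scheme k X f \<phi>"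
    and "locally_of_finite_type X (mspec k) f \<phi>"
  shows "sober_space (scong_scheme k X \<phi>)"
proof -
  interpret k: pointed_monoid k using assms(1) by (simp add: pm_domain_def)
  have ps: "presheaf X" and mor: "mspace_morphism X (mspec k) f \<phi>"
    using assms(2) by (auto simp: k_scheme_def monoid_scheme_def sheaf_def)
  let ?T = "topspace (mspec_top k)"
  have M: "mtop (mspec k) = mspec_top k" "msec (mspec k) = mspec_sec k" by (simp_all add: mspec_def)
  have "continuous_map (mtop X) (mspec_top k) f" and hom: "\<phi> ?T \<in> pm_hom (mspec_sec k ?T) (msec X (preim X f ?T))"
    using mor by (simp_all add: mspace_morphism_def M)
  moreover from this have "preim X f ?T = topspace (mtop X)"
    by (auto simp: preim_def continuous_map_def)
  \<comment> \<open>Elements of \<open>k\<close> are global sections of the spectrum by the case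
    \<open>h = \<one>\<close> of \<open>spec_section\<close>, whose domain is the whole
    space.\<close>
  moreover have "(\<lambda>P \<in> ?T. fraction k (carrier k - P) l \<one>\<^bsub>k\<^esub>) \<in> carrier (mspec_sec k ?T)" if "l \<in> carrier k" for l
    using pm_homD(1)[OF localizes_pm_hom[OF k.localizes_mspec_sec[OF k.one_closed]] that]
    by (simp add: k.spec_section_def k.basic_open_one)
  ultimately interpret congruence_space X k \<phi>
    using ps by unfold_locales (auto simp: pm_homD)
  show ?thesis by (rule sober_scong_scheme)
qed

end
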